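(* (ZFC) If $\kappa$ is both the first (least) supercompact cardinal and the first (least) strongly compact cardinal, then $\langle V_{\kappa+1},\in\rangle$ satisfies Semi-Weak Vopěnka's Principle and the statement ``there is no strongly compact cardinal.''
   Context: A graph is a structure $\langle G,E\rangle$ where $G$ is a set and $E$ is an arbitrary binary relation on $G$. A homomorphism from $\langle G,E\rangle$ to $\langle G',E'\rangle$ is a function $h: G\to G'$ such that $\langle v,w\rangle\in E$ implies $\langle h(v),h(w)\rangle\in E'$. Semi-Weak Vopěnka's Principle (SWVP), a statement of second-order set theory, says that no sequence of graphs $\langle G_\alpha:\alpha\in\mathrm{Ord}\rangle$ has both of the following properties: whenever $\alpha\le\alpha'$ there is a homomorphism $G_{\alpha'}\to G_\alpha$ (not necessarily unique), and whenever $\alpha<\alpha'$ there is no homomorphism $G_\alpha\to G_{\alpha'}$. $V_\alpha$ denotes the $\alpha$-th level of the cumulative hierarchy (the set of all sets of rank less than $\alpha$). For $\kappa$ inaccessible, the structure $\langle V_{\kappa+1},\in\rangle$ is regarded as a model of second-order set theory whose sets are the elements of $V_\kappa$ and whose classes are the elements of $V_{\kappa+1}$ (supercompact cardinals are inaccessible). Thus SWVP in $\langle V_{\kappa+1},\in\rangle$ concerns sequences $\langle G_\alpha:\alpha<\kappa\rangle$ of graphs with each $G_\alpha\in V_\kappa$, and the first-order statement ``there is no strongly compact cardinal'' holds in $\langle V_{\kappa+1},\in\rangle$ if and only if it holds in $\langle V_\kappa,\in\rangle$, i.e. no uncountable cardinal $\kappa_0<\kappa$ is $X$-compact for every $X\in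 V_\kappa$. For a cardinal $\kappa$ and a set $X$, $\mathcal{P}_\kappa(X)=\{A\subset X: |A|<\kappa\}$. For an uncountable cardinal $\kappa$ and a set $X$, $\kappa$ is $X$-compact if there is a fine $\kappa$-complete ultrafilter $U$ on $\mathcal{P}_\kappa(X)$, where: fine means that for every $x\in X$ the set $\{A\in\mathcal{P}_\kappa(X): x\in A\}$ is in $U$; $\kappa$-complete means that the intersection of fewer than $\kappa$ many sets in $U$ is in $U$. An uncountable cardinal is strongly compact if it is $X$-compact for every set $X$. An uncountable cardinal $\kappa$ is $X$-supercompact if there is a fine $\kappa$-complete ultrafilter $U$ on $\mathcal{P}_\kappa(X)$ that is moreover normal, meaning that every choice function (a function $f$ with $f(A)\in A$ for all $A$ in its domain) defined on a set in $U$ is constant on a set in $U$. An uncountable cardinal is supercompact if it is $X$-supercompact for every set $X$. *)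

theory Defs
  imports Main
begin

text \<open>
  A theorem of ZFC is rendered as a statement about every model of first-order ZFC. The separation
  and replacement schemas therefore range over first-order formulas with parameters, not
  over arbitrary HOL predicates. All set-theoretic notions are interpreted inside
  the model.
\<close>

datatype fm = Mem nat nat | Eq nat nat | Neg fm | Conj fm fm | Forall nat fm

primrec sat :: "('v \<Rightarrow> 'v \<Rightarrow> bool) \<Rightarrow> (nat \<Rightarrow> 'v) \<Rightarrow> fm \<Rightarrow> bool" where
  "sat mem s (Mem i j) \<longleftrightarrow> mem (s i) (s j)"
| "sat mem s (Eq i j) \<longleftrightarrow> s i = s j"
| "sat mem s (Neg \<phi>) \<longleftrightarrow> \<not> sat mem s \<phi>"
| "sat mem s (Conj \<phi> \<psi>) \<longleftrightarrow> sat mem s \<phi> \<and> sat mem s \<psi>"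
| "sat mem s (Forall i \<phi>) \<longleftrightarrow> (\<forall>a. sat mem (s(i := a)) \<phi>)"

text \<open>
  Notions of set theory relativized to a structure with domain \<open>S\<close> and membership relation
  \<open>mem\<close>. Every quantifier over objects is bounded by \<open>S\<close>, so that each notion can be evaluated
  both in the universe (\<open>S = UNIV\<close>) and in a level of the cumulative hierarchy. HOL sets
  (\<open>elts\<close>, \<open>Ord\<close>, \<open>Pk\<close>, \<dots>) only abbreviate first-order conditions; functions, ultrafilters, graphs
  and homomorphisms are elements of the structure.
\<close>

locale set_structure =
  fixes S :: "'v set" and mem :: "'v \<Rightarrow> 'v \<Rightarrow> bool" (infix "\<epsilon>" 50)
begin

definition elts :: "'v \<Rightarrow> 'v set" where
  "elts a = {x \<in> S. x \<epsilon> a}"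

text \<open>\<open>p\<close> is the Kuratowski pair of \<open>x\<close> and \<open>y\<close>.\<close>

definition opair :: "'v \<Rightarrow> 'v \<Rightarrow> 'v \<Rightarrow> bool" where
  "opair p x y \<longleftrightarrow> (\<exists>s\<in>S. \<exists>d\<in>S. elts s = {x} \<and> elts d = {x, y} \<and> elts p = {s, d})"

definition related :: "'v \<Rightarrow> 'v \<Rightarrow> 'v \<Rightarrow> bool" where
  "related r x y \<longleftrightarrow> (\<exists>p\<in>elts r. opair p x y)"

text \<open>The domain \<open>D\<close> is a HOL set because it may be a proper class of the structure.\<close>

definition function_on :: "'v \<Rightarrow> 'v set \<Rightarrow> bool" where
  "function_on f D \<longleftrightarrow>
     (\<forall>p\<in>elts f. \<exists>x\<in>D. \<exists>y\<in>S. opair p x y) \<and>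
     (\<forall>x\<in>D. \<exists>!y\<in>S. related f x y)"

definition function_from_to :: "'v \<Rightarrow> 'v \<Rightarrow> 'v \<Rightarrow> bool" where
  "function_from_to f a b \<longleftrightarrow>
     function_on f (elts a) \<and> (\<forall>x\<in>elts a. \<forall>y\<in>S. related f x y \<longrightarrow> y \<in> elts b)"

definition bijection :: "'v \<Rightarrow> 'v \<Rightarrow> 'v \<Rightarrow> bool" where
  "bijection f a b \<longleftrightarrow>
     function_from_to f a b \<and> (\<forall>y\<in>elts b. \<exists>!x\<in>elts a. related f x y)"

definition equipotent :: "'v \<Rightarrow> 'v \<Rightarrow> bool" where
  "equipotent a b \<longleftrightarrow> (\<exists>f\<in>S. bijection f a b)"

text \<open>In the presence of Foundation the order on an ordinal is automatically a well-order.\<close>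

definition ordinal :: "'v \<Rightarrow> bool" where
  "ordinal \<alpha> \<longleftrightarrow>
     (\<forall>x\<in>elts \<alpha>. elts x \<subseteq> elts \<alpha>) \<and>
     (\<forall>x\<in>elts \<alpha>. \<forall>y\<in>elts \<alpha>. x \<epsilon> y \<or> x = y \<or> y \<epsilon> x)"

definition Ord :: "'v set" where
  "Ord = {\<alpha> \<in> S. ordinal \<alpha>}"

definition successor :: "'v \<Rightarrow> 'v" where
  "successor \<alpha> = (THE \<beta>. \<beta> \<in> S \<and> elts \<beta> = insert \<alpha> (elts \<alpha>))"

definition limit_ordinal :: "'v \<Rightarrow> bool" where
  "limit_ordinal \<gamma> \<longleftrightarrow>
     ordinal \<gamma> \<and> elts \<gamma> \<noteq> {} \<and> (\<forall>\<alpha>\<in>elts \<gamma>. \<exists>\<beta>\<in>elts \<gamma>. \<alpha> \<epsilon> \<beta>)"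

definition is_omega :: "'v \<Rightarrow> bool" where
  "is_omega w \<longleftrightarrow> limit_ordinal w \<and> (\<forall>\<alpha>\<in>elts w. \<not> limit_ordinal \<alpha>)"

definition cardinal :: "'v \<Rightarrow> bool" where
  "cardinal \<kappa> \<longleftrightarrow> ordinal \<kappa> \<and> (\<forall>\<alpha>\<in>elts \<kappa>. \<not> equipotent \<alpha> \<kappa>)"

definition uncountable_cardinal :: "'v \<Rightarrow> bool" where
  "uncountable_cardinal \<kappa> \<longleftrightarrow> cardinal \<kappa> \<and> (\<exists>w\<in>elts \<kappa>. is_omega w)"

definition card_less :: "'v \<Rightarrow> 'v \<Rightarrow> bool" where
  "card_less a \<kappa> \<longleftrightarrow> (\<exists>\<mu>\<in>elts \<kappa>. cardinal \<mu> \<and> equipotent a \<mu>)"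


subsection \<open>Compact and supercompact cardinals\<close>

definition Pk :: "'v \<Rightarrow> 'v \<Rightarrow> 'v set" where
  "Pk \<kappa> X = {A \<in> S. elts A \<subseteq> elts X \<and> card_less A \<kappa>}"

definition ultrafilter_on :: "'v set \<Rightarrow> 'v \<Rightarrow> bool" where
  "ultrafilter_on P U \<longleftrightarrow>
     (\<forall>A\<in>elts U. elts A \<subseteq> P) \<and>
     (\<exists>A\<in>elts U. elts A = P) \<and>
     (\<forall>A\<in>elts U. elts A \<noteq> {}) \<and>
     (\<forall>A\<in>elts U. \<forall>B\<in>S. elts A \<subseteq> elts B \<and> elts B \<subseteq> P \<longrightarrow> B \<in> elts U) \<and>
     (\<forall>A\<in>elts U. \<forall>B\<in>elts U. \<exists>C\<in>elts U. elts C = elts A \<inter> elts B) \<and>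
     (\<forall>A\<in>S. elts A \<subseteq> P \<longrightarrow> A \<in> elts U \<or> (\<exists>B\<in>elts U. elts B = P - elts A))"

definition fine :: "'v \<Rightarrow> 'v \<Rightarrow> 'v \<Rightarrow> bool" where
  "fine \<kappa> X U \<longleftrightarrow> (\<forall>x\<in>elts X. \<exists>B\<in>elts U. elts B = {A \<in> Pk \<kappa> X. x \<epsilon> A})"

definition complete :: "'v \<Rightarrow> 'v \<Rightarrow> bool" where
  "complete \<kappa> U \<longleftrightarrow>
     (\<forall>F\<in>S. elts F \<subseteq> elts U \<and> elts F \<noteq> {} \<and> card_less F \<kappa> \<longrightarrow>
        (\<exists>B\<in>elts U. elts B = (\<Inter>A\<in>elts F. elts A)))"

definition choice_function_on :: "'v \<Rightarrow> 'v \<Rightarrow> bool" where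
  "choice_function_on f D \<longleftrightarrow>
     function_on f (elts D) \<and> (\<forall>A\<in>elts D. \<forall>y\<in>S. related f A y \<longrightarrow> y \<epsilon> A)"

definition normal :: "'v \<Rightarrow> bool" where
  "normal U \<longleftrightarrow>
     (\<forall>D\<in>elts U. \<forall>f\<in>S. choice_function_on f D \<longrightarrow>
        (\<exists>B\<in>elts U. \<exists>c\<in>S. \<forall>A\<in>elts B. related f A c))"

definition X_compact :: "'v \<Rightarrow> 'v \<Rightarrow> bool" where
  "X_compact X \<kappa> \<longleftrightarrow>
     uncountable_cardinal \<kappa> \<and>
     (\<exists>U\<in>S. ultrafilter_on (Pk \<kappa> X) U \<and> fine \<kappa> X U \<and> complete \<kappa> U)"

definition strongly_compact :: "'v \<Rightarrow> bool" where
  "strongly_compact \<kappa> \<longleftrightarrow> uncountable_cardinal \<kappa> \<and> (\<forall>X\<in>S. X_compact X \<kappa>)"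

definition X_supercompact :: "'v \<Rightarrow> 'v \<Rightarrow> bool" where
  "X_supercompact X \<kappa> \<longleftrightarrow>
     uncountable_cardinal \<kappa> \<and>
     (\<exists>U\<in>S. ultrafilter_on (Pk \<kappa> X) U \<and> fine \<kappa> X U \<and> complete \<kappa> U \<and> normal U)"

definition supercompact :: "'v \<Rightarrow> bool" where
  "supercompact \<kappa> \<longleftrightarrow> uncountable_cardinal \<kappa> \<and> (\<forall>X\<in>S. X_supercompact X \<kappa>)"

definition first_strongly_compact :: "'v \<Rightarrow> bool" where
  "first_strongly_compact \<kappa> \<longleftrightarrow>
     strongly_compact \<kappa> \<and> (\<forall>\<mu>\<in>elts \<kappa>. \<not> strongly_compact \<mu>)"

definition first_supercompact :: "'v \<Rightarrow> bool" where
  "first_supercompact \<kappa> \<longleftrightarrow>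
     supercompact \<kappa> \<and> (\<forall>\<mu>\<in>elts \<kappa>. \<not> supercompact \<mu>)"

definition no_strongly_compact_cardinal :: bool where
  "no_strongly_compact_cardinal \<longleftrightarrow> \<not> (\<exists>\<mu>\<in>S. strongly_compact \<mu>)"


subsection \<open>The cumulative hierarchy\<close>

text \<open>
  The recursion is \<open>V\<^sub>\<alpha> = \<Union>{Pow V\<^sub>\<beta> | \<beta> < \<alpha>}\<close>; the function \<open>f\<close> below is the sequence of all
  \<open>V\<^sub>\<beta>\<close> with \<open>\<beta> < \<alpha>\<close>.
\<close>

definition subsets_of_values :: "'v \<Rightarrow> 'v \<Rightarrow> 'v set" where
  "subsets_of_values f \<beta> =
     {x \<in> S. \<exists>\<gamma>\<in>elts \<beta>. \<exists>u\<in>S. related f \<gamma> u \<and> elts x \<subseteq> elts u}"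

definition is_V :: "'v \<Rightarrow> 'v \<Rightarrow> bool" where
  "is_V \<alpha> v \<longleftrightarrow>
     (\<exists>f\<in>S. function_on f (elts \<alpha>) \<and>
        (\<forall>\<beta>\<in>elts \<alpha>. \<forall>w\<in>S. related f \<beta> w \<longrightarrow> elts w = subsets_of_values f \<beta>) \<and>
        elts v = subsets_of_values f \<alpha>)"

definition V :: "'v \<Rightarrow> 'v" where
  "V \<alpha> = (THE v. v \<in> S \<and> is_V \<alpha> v)"


subsection \<open>Graphs and Semi-Weak Vopenka's Principle\<close>

text \<open>\<open>g\<close> is the pair \<open>\<langle>G, E\<rangle>\<close>, where \<open>E\<close> is a subset of \<open>G \<times> G\<close>.\<close>

definition is_graph :: "'v \<Rightarrow> 'v \<Rightarrow> 'v \<Rightarrow> bool" where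
  "is_graph g G E \<longleftrightarrow>
     opair g G E \<and> (\<forall>p\<in>elts E. \<exists>v\<in>elts G. \<exists>w\<in>elts G. opair p v w)"

definition graph :: "'v \<Rightarrow> bool" where
  "graph g \<longleftrightarrow> (\<exists>G\<in>S. \<exists>E\<in>S. is_graph g G E)"

definition homomorphism :: "'v \<Rightarrow> 'v \<Rightarrow> 'v \<Rightarrow> bool" where
  "homomorphism h g g' \<longleftrightarrow>
     (\<exists>G\<in>S. \<exists>E\<in>S. \<exists>G'\<in>S. \<exists>E'\<in>S. is_graph g G E \<and> is_graph g' G' E' \<and>
        function_from_to h G G' \<and>
        (\<forall>v\<in>elts G. \<forall>w\<in>elts G. \<forall>v'\<in>elts G'. \<forall>w'\<in>elts G'.
           related E v w \<and> related h v v' \<and> related h w w' \<longrightarrow> related E' v' w'))"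

definition hom_exists :: "'v \<Rightarrow> 'v \<Rightarrow> bool" where
  "hom_exists g g' \<longleftrightarrow> (\<exists>h\<in>S. homomorphism h g g')"

text \<open>
  A second-order structure has sets \<open>S\<close> and classes \<open>C\<close>. A sequence of graphs indexed by the
  ordinals is a class \<open>F\<close> of pairs of sets.
\<close>

definition SWVP :: "'v set \<Rightarrow> bool" where
  "SWVP C \<longleftrightarrow>
     \<not> (\<exists>F\<in>C. function_on F Ord \<and>
          (\<forall>\<alpha>\<in>Ord. \<forall>g\<in>S. related F \<alpha> g \<longrightarrow> graph g) \<and>
          (\<forall>\<alpha>\<in>Ord. \<forall>\<alpha>'\<in>Ord. \<forall>g\<in>S. \<forall>g'\<in>S. related F \<alpha> g \<and> related F \<alpha>' g' \<longrightarrow>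
             (\<alpha> = \<alpha>' \<or> \<alpha> \<epsilon> \<alpha>' \<longrightarrow> hom_exists g' g) \<and>
             (\<alpha> \<epsilon> \<alpha>' \<longrightarrow> \<not> hom_exists g g')))"

end


subsection \<open>Models of ZFC\<close>

text \<open>
  In the schemas, \<open>s\<close> supplies the parameters of \<open>\<phi>\<close>; the variables 0 and 1 are the distinguished
  ones.
\<close>

locale zfc_model = set_structure UNIV mem
  for mem :: "'v \<Rightarrow> 'v \<Rightarrow> bool" (infix "\<epsilon>" 50) +
  assumes extensionality: "(\<forall>z. z \<epsilon> x \<longleftrightarrow> z \<epsilon> y) \<longrightarrow> x = y"
    and foundation: "(\<exists>z. z \<epsilon> x) \<longrightarrow> (\<exists>y. y \<epsilon> x \<and> \<not> (\<exists>z. z \<epsilon> x \<and> z \<epsilon> y))"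
    and pairing: "\<exists>p. \<forall>z. z \<epsilon> p \<longleftrightarrow> z = x \<or> z = y"
    and union: "\<exists>u. \<forall>z. z \<epsilon> u \<longleftrightarrow> (\<exists>y. y \<epsilon> x \<and> z \<epsilon> y)"
    and power_set: "\<exists>p. \<forall>y. y \<epsilon> p \<longleftrightarrow> (\<forall>z. z \<epsilon> y \<longrightarrow> z \<epsilon> x)"
    and infinity:
      "\<exists>w. (\<exists>e. e \<epsilon> w \<and> (\<forall>z. \<not> z \<epsilon> e)) \<and>
           (\<forall>x. x \<epsilon> w \<longrightarrow> (\<exists>y. y \<epsilon> w \<and> (\<forall>z. z \<epsilon> y \<longleftrightarrow> z \<epsilon> x \<or> z = x)))"
    and separation: "\<exists>b. \<forall>x. x \<epsilon> b \<longleftrightarrow> x \<epsilon> a \<and> sat mem (s(0 := x)) \<phi>"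
    and replacement:
      "(\<forall>x. x \<epsilon> a \<longrightarrow> (\<exists>!y. sat mem (s(0 := x, 1 := y)) \<phi>)) \<longrightarrow>
       (\<exists>b. \<forall>y. y \<epsilon> b \<longleftrightarrow> (\<exists>x. x \<epsilon> a \<and> sat mem (s(0 := x, 1 := y)) \<phi>))"
    and choice:
      "(\<forall>x. x \<epsilon> a \<longrightarrow> (\<exists>z. z \<epsilon> x)) \<and>
       (\<forall>x y. x \<epsilon> a \<and> y \<epsilon> a \<and> x \<noteq> y \<longrightarrow> \<not> (\<exists>z. z \<epsilon> x \<and> z \<epsilon> y)) \<longrightarrow>
       (\<exists>c. \<forall>x. x \<epsilon> a \<longrightarrow> (\<exists>!z. z \<epsilon> x \<and> z \<epsilon> c))"

text \<open>
  \<open>V_level mem \<alpha>\<close> is the collection of elements of \<open>V\<^sub>\<alpha>\<close> as computed in the universe. The structure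
  \<open>\<langle>V\<^sub>\<kappa>\<^sub>+\<^sub>1, \<in>\<rangle>\<close>, as a model of second-order set theory, has the elements of \<open>V\<^sub>\<kappa>\<close> as its sets and
  the elements of \<open>V\<^sub>\<kappa>\<^sub>+\<^sub>1\<close> as its classes. A first-order statement is evaluated with the quantifiers
  ranging over its sets.
\<close>

definition V_level :: "('v \<Rightarrow> 'v \<Rightarrow> bool) \<Rightarrow> 'v \<Rightarrow> 'v set" where
  "V_level mem \<alpha> = set_structure.elts UNIV mem (set_structure.V UNIV mem \<alpha>)"

definition V_succ_satisfies_SWVP :: "('v \<Rightarrow> 'v \<Rightarrow> bool) \<Rightarrow> 'v \<Rightarrow> bool" where
  "V_succ_satisfies_SWVP mem \<kappa> \<longleftrightarrow>
     set_structure.SWVP (V_level mem \<kappa>) mem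
       (V_level mem (set_structure.successor UNIV mem \<kappa>))"

definition V_succ_satisfies_no_strongly_compact :: "('v \<Rightarrow> 'v \<Rightarrow> bool) \<Rightarrow> 'v \<Rightarrow> bool" where
  "V_succ_satisfies_no_strongly_compact mem \<kappa> \<longleftrightarrow>
     set_structure.no_strongly_compact_cardinal (V_level mem \<kappa>) mem"

end

theory Submission
  imports Defs
begin

text \<open>
  If \<open>\<mu> < \<kappa>\<close> were strongly compact in \<open>V\<^sub>\<kappa>\<close>, then for every \<open>X\<close> one could integrate \<open>\<mu>\<close>-complete fine
  ultrafilters on \<open>P\<^sub>\<mu>(A)\<close>, \<open>A \<in> P\<^sub>\<kappa>(X)\<close>, along a \<open>\<kappa>\<close>-complete fine ultrafilter on \<open>P\<^sub>\<kappa>(X)\<close>, so \<open>\<mu>\<close>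
  would be strongly compact, contrary to the minimality of \<open>\<kappa>\<close>.

  For SWVP take a normal fine ultrafilter \<open>U\<close> on \<open>P\<^sub>\<kappa>(V\<^sub>\<kappa>\<^sub>+\<^sub>1)\<close> and let \<open>gap A\<close> be the least ordinal
  outside \<open>A\<close>. A function \<open>g\<close> on \<open>\<kappa>\<close> with \<open>g(\<gamma>) \<in> G\<^sub>\<gamma>\<^sub>+\<^sub>1\<close> is an element of \<open>V\<^sub>\<kappa>\<^sub>+\<^sub>1\<close>. For almost
  all \<open>A\<close>, with \<open>\<alpha> = gap A\<close>: every sequence \<open>(h\<^sub>\<gamma>(x))\<^sub>\<gamma>\<^sub><\<^sub>\<alpha>\<close>, where \<open>x \<in> G\<^sub>\<alpha>\<close> and
  \<open>h\<^sub>\<gamma> : G\<^sub>\<alpha> \<rightarrow> G\<^sub>\<gamma>\<^sub>+\<^sub>1\<close> are homomorphisms, extends to such a \<open>g \<in> A\<close>; and if \<open>g, e \<in> A\<close> are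
  adjacent at all coordinates below \<open>\<alpha>\<close>, then also at \<open>\<alpha>\<close>, since by normality a counterexample \<open>(g, e)\<close>
  would be the same for almost all \<open>A\<close> although \<open>gap A\<close> is almost always above any given ordinal.
  Hence \<open>x \<mapsto> g(\<alpha>)\<close> is a homomorphism \<open>G\<^sub>\<alpha> \<rightarrow> G\<^sub>\<alpha>\<^sub>+\<^sub>1\<close>.
\<close>

subsection \<open>Definability\<close>

text \<open>The schemas of the model reach only first-order definable conditions, so an argument in
  HOL about the model yields a set only when the predicate or function behind it has been shown
  definable with parameters. This obstacle shapes the proof: induction, recursion, choice and
  ultrafilter quantifiers are all restricted to definable predicates, and the side conditions are
  discharged by one syntax-directed set of rules. No ultrapower is formed. Almost-everywhere
  statements are written with a quantifier \<open>most U\<close>, for which normality, fineness and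
  completeness are rules. Without Los's theorem, the inclusion of V_\<beta> in almost every A,
  needed before normality can fix a value lying in V_\<beta>, takes an induction of its own
  (\<open>most_HV_subset\<close>). The shift in G_{\<gamma>+1} makes the coordinates match:
  homomorphisms from G_\<alpha> to G_{\<gamma>+1} are supplied for \<gamma> < \<alpha>, and the new
  coordinate \<gamma> = \<alpha> has its target in G_{\<alpha>+1}.\<close>

primrec rename :: "(nat \<Rightarrow> nat) \<Rightarrow> fm \<Rightarrow> fm" where
  "rename f (Mem i j) = Mem (f i) (f j)"
| "rename f (Eq i j) = Eq (f i) (f j)"
| "rename f (Neg \<phi>) = Neg (rename f \<phi>)"
| "rename f (Conj \<phi> \<psi>) = Conj (rename f \<phi>) (rename f \<psi>)"
| "rename f (Forall i \<phi>) = Forall (f i) (rename f \<phi>)"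

text \<open>Bound variables are renamed together with the free ones, so injectivity of
  \<open>f\<close> rules out capture: updating at \<open>f i\<close> and composing with
  \<open>f\<close> is the same as updating at \<open>i\<close>.\<close>

lemma sat_rename:
  assumes "inj f"
  shows "sat mem s (rename f \<phi>) \<longleftrightarrow> sat mem (s \<circ> f) \<phi>"
proof (induction \<phi> arbitrary: s)
  case (Forall i \<phi>)
  have "s(f i := a) \<circ> f = (s \<circ> f)(i := a)" for a
    using assms by (auto simp: fun_eq_iff dest: injD)
  then show ?case using Forall.IH by (simp del: fun_upd_apply o_apply)
qed auto

definition mix :: "(nat \<Rightarrow> 'v) \<Rightarrow> (nat \<Rightarrow> 'v) \<Rightarrow> nat \<Rightarrow> 'v" where
  "mix s t n = (if even n then s (n div 2) else t (n div 2))"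

lemma mix_even [simp]: "mix s t (2 * n) = s n" and mix_odd [simp]: "mix s t (Suc (2 * n)) = t n"
  and mix_1 [simp]: "mix s t (Suc 0) = t 0"
  by (simp_all add: mix_def)

lemma even_odd_cases: obtains k where "n = 2 * k" | k where "n = Suc (2 * k)"
  by (metis add.commute evenE oddE plus_1_eq_Suc)

lemma inj_even_odd:
  assumes "\<And>n. f (2 * n) = 2 * g n" "\<And>n. f (Suc (2 * n)) = Suc (2 * h n)" "inj g" "inj h"
  shows "inj f"
proof (rule injI)
  fix x y assume e: "f x = f y"
  show "x = y"
  proof (rule even_odd_cases[of x]; rule even_odd_cases[of y])
    fix k l assume "x = 2 * k" "y = 2 * l"
    then show ?thesis using e assms(1) injD[OF assms(3)] by auto
  next
    fix k l assume "x = 2 * k" "y = Suc (2 * l)"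
    then have "2 * g k = Suc (2 * h l)" using e assms(1,2) by simp
    then show ?thesis by presburger
  next
    fix k l assume "x = Suc (2 * k)" "y = 2 * l"
    then have "2 * g l = Suc (2 * h k)" using e assms(1,2) by simp
    then show ?thesis by presburger
  next
    fix k l assume "x = Suc (2 * k)" "y = Suc (2 * l)"
    then show ?thesis using e assms(2) injD[OF assms(4)] by auto
  qed
qed

context zfc_model
begin

lemma mem_elts [simp]: "x \<in> elts a \<longleftrightarrow> x \<epsilon> a"
  by (simp add: elts_def)

lemma ball_elts [simp]: "(\<forall>x\<in>elts a. P x) \<longleftrightarrow> (\<forall>x. x \<epsilon> a \<longrightarrow> P x)"
  and bex_elts [simp]: "(\<exists>x\<in>elts a. P x) \<longleftrightarrow> (\<exists>x. x \<epsilon> a \<and> P x)"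
  by auto

text \<open>
  \<open>Df\<close>, \<open>Tm\<close>, \<open>Cl\<close>: predicates, terms and classes definable with parameters, over De Bruijn
  environments, in which position 0 is the innermost bound object. In \<open>mix s t\<close> the even variables
  hold the environment and the odd ones the parameters; a variable for a new binder is then always
  available among the odd ones.
\<close>

definition Df :: "((nat \<Rightarrow> 'v) \<Rightarrow> bool) \<Rightarrow> bool" where
  "Df P \<longleftrightarrow> (\<exists>\<phi> t. \<forall>s. P s \<longleftrightarrow> sat mem (mix s t) \<phi>)"

definition Tm :: "((nat \<Rightarrow> 'v) \<Rightarrow> 'v) \<Rightarrow> bool" where
  "Tm x \<longleftrightarrow> Df (\<lambda>s. s 0 = x (\<lambda>n. s (Suc n)))"

definition Cl :: "((nat \<Rightarrow> 'v) \<Rightarrow> 'v set) \<Rightarrow> bool" where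
  "Cl A \<longleftrightarrow> Df (\<lambda>s. s 0 \<in> A (\<lambda>n. s (Suc n)))"

text \<open>Even variables move along \<open>f\<close> and the odd ones stay, so the parameters are
  untouched. Weakening under binders and exchange of positions are instances.\<close>

lemma Df_rename:
  assumes "inj f" "Df P"
  shows "Df (\<lambda>s. P (\<lambda>n. s (f n)))"
proof -
  obtain \<phi> t where P: "\<And>s. P s \<longleftrightarrow> sat mem (mix s t) \<phi>"
    using assms(2) unfolding Df_def by blast
  define F where "F n = (if even n then 2 * f (n div 2) else n)" for n
  have F: "F (2 * n) = 2 * f n" "F (Suc (2 * n)) = Suc (2 * n)" for n
    by (simp_all add: F_def)
  have "inj F"
    by (rule inj_even_odd[where g = f and h = "\<lambda>n. n"]) (auto simp: F assms(1))
  have "mix s t \<circ> F = mix (\<lambda>n. s (f n)) t" for s :: "nat \<Rightarrow> 'v"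
  proof
    fix n show "(mix s t \<circ> F) n = mix (\<lambda>n. s (f n)) t n"
      by (rule even_odd_cases[of n]) (simp_all add: F)
  qed
  then have "P (\<lambda>n. s (f n)) \<longleftrightarrow> sat mem (mix s t) (rename F \<phi>)" for s
    by (simp add: P sat_rename[OF \<open>inj F\<close>])
  then show ?thesis unfolding Df_def by blast
qed

lemma Df_not: assumes "Df P" shows "Df (\<lambda>s. \<not> P s)"
proof -
  obtain \<phi> t where "\<And>s. P s \<longleftrightarrow> sat mem (mix s t) \<phi>"
    using assms unfolding Df_def by blast
  then have "(\<not> P s) \<longleftrightarrow> sat mem (mix s t) (Neg \<phi>)" for s by simp
  then show ?thesis unfolding Df_def by blast
qed

lemma Df_conj:
  assumes "Df P" "Df Q"
  shows "Df (\<lambda>s. P s \<and> Q s)"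
proof -
  obtain \<phi> t where P: "\<And>s. P s \<longleftrightarrow> sat mem (mix s t) \<phi>"
    using assms(1) unfolding Df_def by blast
  obtain \<psi> u where Q: "\<And>s. Q s \<longleftrightarrow> sat mem (mix s u) \<psi>"
    using assms(2) unfolding Df_def by blast
  \<comment> \<open>Each formula has its own parameters; these are interleaved as
    \<open>mix t u\<close>, parameter n of the first going to position 2n and of the second to
    position 2n + 1.\<close>
  define f where "f n = (if even n then n else Suc (2 * (2 * (n div 2))))" for n :: nat
  define g where "g n = (if even n then n else Suc (2 * (Suc (2 * (n div 2)))))" for n :: nat
  have f: "f (2 * n) = 2 * n" "f (Suc (2 * n)) = Suc (2 * (2 * n))" for n
    by (simp_all add: f_def)
  have g: "g (2 * n) = 2 * n" "g (Suc (2 * n)) = Suc (2 * (Suc (2 * n)))" for n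
    by (simp_all add: g_def)
  have "inj f"
    by (rule inj_even_odd[where g = "\<lambda>n. n" and h = "\<lambda>n. 2 * n"]) (auto simp: f inj_def)
  have "inj g"
    by (rule inj_even_odd[where g = "\<lambda>n. n" and h = "\<lambda>n. Suc (2 * n)"]) (auto simp: g inj_def)
  have "mix s (mix t u) \<circ> f = mix s t" for s
  proof
    fix n show "(mix s (mix t u) \<circ> f) n = mix s t n"
      by (rule even_odd_cases[of n]) (simp_all only: f o_apply mix_even mix_odd)
  qed
  moreover have "mix s (mix t u) \<circ> g = mix s u" for s
  proof
    fix n show "(mix s (mix t u) \<circ> g) n = mix s u n"
      by (rule even_odd_cases[of n]) (simp_all only: g o_apply mix_even mix_odd)
  qed
  ultimately have "P s \<and> Q s \<longleftrightarrow> sat mem (mix s (mix t u)) (Conj (rename f \<phi>) (rename g \<psi>))" for s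
    by (simp add: P Q sat_rename \<open>inj f\<close> \<open>inj g\<close>)
  then show ?thesis unfolding Df_def by blast
qed

lemma Df_all:
  assumes "Df (\<lambda>s. P (s 0) (\<lambda>n. s (Suc n)))"
  shows "Df (\<lambda>s. \<forall>a. P a s)"
proof -
  obtain \<phi> t where P: "\<And>s. P (s 0) (\<lambda>n. s (Suc n)) \<longleftrightarrow> sat mem (mix s t) \<phi>"
    using assms unfolding Df_def by blast
  have P': "P a s \<longleftrightarrow> sat mem (mix (case_nat a s) t) \<phi>" for a s
    using P[of "case_nat a s"] by simp
  \<comment> \<open>The quantified object, environment position 0, becomes the odd variable 1. The
    parameters move up one place to vacate it and the rest of the environment moves down one; the
    entry \<open>undefined\<close> is overwritten by the quantifier.\<close>
  define t' where "t' = case_nat undefined t"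
  define f where "f n = (if n = 0 then 1 else if even n then n - 2 else n + 2)" for n :: nat
  have f: "f 0 = Suc 0" "f (2 * Suc n) = 2 * n" "f (Suc (2 * n)) = Suc (2 * Suc n)" for n
    by (simp_all add: f_def)
  have "inj f"
    by (rule inj_on_inverseI[where g = "\<lambda>n. if n = 1 then 0 else if even n then n + 2 else n - 2"])
      (auto simp: f_def elim!: evenE, presburger)
  have "(mix s t')(Suc 0 := a) \<circ> f = mix (case_nat a s) t" for a s
  proof
    fix n
    consider "n = 0" | k where "n = 2 * Suc k" | k where "n = Suc (2 * k)"
      using even_odd_cases[of n] by (metis mult_0_right not0_implies_Suc)
    then show "((mix s t')(Suc 0 := a) \<circ> f) n = mix (case_nat a s) t n"
    proof cases
      case 1
      then show ?thesis using mix_even[of "case_nat a s" t 0] by (simp add: f)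
    next
      case (2 k)
      have "2 * k \<noteq> Suc 0" by presburger
      then show ?thesis unfolding 2 o_apply f mix_even by simp
    next
      case (3 k)
      then show ?thesis unfolding 3 o_apply f mix_odd
        using mix_odd[of s t' "Suc k"] by (simp add: t'_def)
    qed
  qed
  then have "(\<forall>a. P a s) \<longleftrightarrow> sat mem (mix s t') (Forall (Suc 0) (rename f \<phi>))" for s
    by (simp add: P' sat_rename[OF \<open>inj f\<close>])
  then show ?thesis unfolding Df_def by blast
qed

lemma Df_mem_var: "Df (\<lambda>s. s i \<epsilon> s j)"
  unfolding Df_def by (rule exI[of _ "Mem (2 * i) (2 * j)"]) simp

lemma Df_eq_var: "Df (\<lambda>s. s i = s j)"
  unfolding Df_def by (rule exI[of _ "Eq (2 * i) (2 * j)"]) simp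

lemma Df_eq_const: "Df (\<lambda>s. s i = c)"
  unfolding Df_def
  by (rule exI[of _ "Eq (2 * i) (Suc 0)"], rule exI[of _ "\<lambda>_. c"]) simp

lemma Df_const: "Df (\<lambda>s. c)"
proof (cases c)
  case True
  then show ?thesis using Df_eq_var[of 0 0] by simp
next
  case False
  then show ?thesis using Df_not[OF Df_eq_var[of 0 0]] by simp
qed

lemma Tm_const: "Tm (\<lambda>s. c)"
  unfolding Tm_def by (rule Df_eq_const)

lemma Tm_var: "Tm (\<lambda>s. s i)"
  unfolding Tm_def by (rule Df_eq_var)

lemma Df_disj:
  assumes "Df P" "Df Q"
  shows "Df (\<lambda>s. P s \<or> Q s)"
proof -
  have "Df (\<lambda>s. \<not> (\<not> P s \<and> \<not> Q s))" by (intro Df_not Df_conj assms)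
  then show ?thesis by simp
qed

lemma Df_imp: "Df P \<Longrightarrow> Df Q \<Longrightarrow> Df (\<lambda>s. P s \<longrightarrow> Q s)"
  unfolding imp_conv_disj by (intro Df_disj Df_not)

lemma Df_iff: "Df P \<Longrightarrow> Df Q \<Longrightarrow> Df (\<lambda>s. P s \<longleftrightarrow> Q s)"
  unfolding iff_conv_conj_imp by (intro Df_conj Df_imp)

lemma Df_ex:
  assumes "Df (\<lambda>s. P (s 0) (\<lambda>n. s (Suc n)))"
  shows "Df (\<lambda>s. \<exists>a. P a s)"
proof -
  have "Df (\<lambda>s. \<not> (\<forall>a. \<not> P a s))" by (intro Df_not Df_all assms)
  then show ?thesis by simp
qed

lemma Df_if: "Df P \<Longrightarrow> Df Q \<Longrightarrow> Df R \<Longrightarrow> Df (\<lambda>s. if P s then Q s else R s)"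
  unfolding if_bool_eq_conj by (intro Df_conj Df_imp Df_not)

lemma Tm_shift:
  assumes "Tm x"
  shows "Tm (\<lambda>s. x (\<lambda>n. s (Suc n)))"
proof -
  define f where "f = case_nat 0 (\<lambda>n. Suc (Suc n))"
  have "inj f" by (auto simp: inj_def f_def split: nat.splits)
  from Df_rename[OF this assms[unfolded Tm_def]] show ?thesis
    by (simp add: Tm_def f_def)
qed

lemma Df_shift: "Df P \<Longrightarrow> Df (\<lambda>s. P (\<lambda>n. s (Suc n)))"
  by (rule Df_rename) auto

text \<open>Formulas have no function symbols, so a term is substituted by quantifying over its
  value; as the term is a total HOL function, the value always exists.\<close>

lemma Df_subst:
  assumes "Df (\<lambda>s. P (s 0) (\<lambda>n. s (Suc n)))" "Tm x"
  shows "Df (\<lambda>s. P (x s) s)"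
proof -
  have "Df (\<lambda>s. \<exists>a. a = x s \<and> P a s)"
    by (intro Df_ex Df_conj assms(2)[unfolded Tm_def]) (rule assms(1))
  then show ?thesis by simp
qed

text \<open>Under \<open>k\<close> new binders a term still reads the outer environment, which then
  begins at position \<open>k\<close>, while its value is to be found at one of the new
  positions.\<close>

lemma Df_var_eq:
  assumes "Tm x" "i < k"
  shows "Df (\<lambda>s. s i = x (\<lambda>n. s (n + k)))"
proof -
  define f where "f = case_nat i (\<lambda>n. n + k)"
  have "inj f" using \<open>i < k\<close> by (auto simp: inj_def f_def split: nat.splits)
  from Df_rename[OF this assms(1)[unfolded Tm_def]] show ?thesis
    by (simp add: f_def)
qed

text \<open>With this rule and its variants a notion is proved definable once, in variables, and
  then applies to arbitrary terms. The proofs that follow bind the arguments in reverse order, so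
  that the first one lands at position 0.\<close>

lemma Df_1:
  assumes "Df (\<lambda>s. P (s 0))" "Tm x"
  shows "Df (\<lambda>s. P (x s))"
  by (rule Df_subst[where P = "\<lambda>a s. P a"]) (use assms in auto)

lemma Df_2:
  assumes "Df (\<lambda>s. P (s 0) (s 1))" "Tm x" "Tm y"
  shows "Df (\<lambda>s. P (x s) (y s))"
proof -
  have "Df (\<lambda>s. \<exists>b a. a = x s \<and> b = y s \<and> P a b)"
    by (intro Df_ex Df_conj)
      (use assms Df_var_eq[of x 0 2] Df_var_eq[of y 1 2] in \<open>simp_all add: numeral_eq_Suc\<close>)
  then show ?thesis by simp
qed

lemma Df_3:
  assumes "Df (\<lambda>s. P (s 0) (s 1) (s 2))" "Tm x" "Tm y" "Tm z"
  shows "Df (\<lambda>s. P (x s) (y s) (z s))"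
proof -
  have "Df (\<lambda>s. \<exists>c b a. a = x s \<and> b = y s \<and> c = z s \<and> P a b c)"
    by (intro Df_ex Df_conj)
      (use assms Df_var_eq[of x 0 3] Df_var_eq[of y 1 3] Df_var_eq[of z 2 3] in \<open>simp_all add: numeral_eq_Suc\<close>)
  then show ?thesis by simp
qed

lemma Df_4:
  assumes "Df (\<lambda>s. P (s 0) (s 1) (s 2) (s 3))" "Tm x" "Tm y" "Tm z" "Tm w"
  shows "Df (\<lambda>s. P (x s) (y s) (z s) (w s))"
proof -
  have "Df (\<lambda>s. \<exists>d c b a. a = x s \<and> b = y s \<and> c = z s \<and> d = w s \<and> P a b c d)"
    by (intro Df_ex Df_conj)
      (use assms Df_var_eq[of x 0 4] Df_var_eq[of y 1 4] Df_var_eq[of z 2 4] Df_var_eq[of w 3 4]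
       in \<open>simp_all add: numeral_eq_Suc\<close>)
  then show ?thesis by simp
qed

lemma Tm_1:
  assumes "Tm (\<lambda>s. F (s 0))" "Tm x"
  shows "Tm (\<lambda>s. F (x s))"
proof -
  have "Df (\<lambda>s. s 1 = F (s 0))"
    using Df_rename[OF _ assms(1)[unfolded Tm_def], of "\<lambda>n. if n = 0 then 1 else if n = 1 then 0 else n"]
    by (force simp: inj_def)
  from Df_2[where P = "\<lambda>a b. b = F a", OF this Tm_shift[OF assms(2)] Tm_var[of 0]]
  show ?thesis unfolding Tm_def .
qed

lemma Tm_2:
  assumes "Tm (\<lambda>s. F (s 0) (s 1))" "Tm x" "Tm y"
  shows "Tm (\<lambda>s. F (x s) (y s))"
  unfolding Tm_def
  by (rule Df_3[where P = "\<lambda>c a b. c = F a b", OF _ Tm_var Tm_shift Tm_shift])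
    (use assms in \<open>simp_all add: Tm_def numeral_eq_Suc\<close>)

lemma Tm_3:
  assumes "Tm (\<lambda>s. F (s 0) (s 1) (s 2))" "Tm x" "Tm y" "Tm z"
  shows "Tm (\<lambda>s. F (x s) (y s) (z s))"
  unfolding Tm_def
  by (rule Df_4[where P = "\<lambda>d a b c. d = F a b c", OF _ Tm_var Tm_shift Tm_shift Tm_shift])
    (use assms in \<open>simp_all add: Tm_def numeral_eq_Suc\<close>)

lemma Df_mem: "Tm x \<Longrightarrow> Tm y \<Longrightarrow> Df (\<lambda>s. x s \<epsilon> y s)"
  by (rule Df_2[where P = mem]) (rule Df_mem_var)

lemma Df_eq: "Tm x \<Longrightarrow> Tm y \<Longrightarrow> Df (\<lambda>s. x s = y s)"
  by (rule Df_2[where P = "(=)"]) (rule Df_eq_var)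

lemma Df_ex1:
  assumes "Df (\<lambda>s. P (s 0) (\<lambda>n. s (Suc n)))"
  shows "Df (\<lambda>s. \<exists>!a. P a s)"
proof -
  have "inj (\<lambda>n::nat. case n of 0 \<Rightarrow> 0 | Suc n \<Rightarrow> Suc (Suc n))"
    by (auto simp: inj_def split: nat.splits)
  from Df_rename[OF this assms]
  have *: "Df (\<lambda>s. P (s 0) (\<lambda>n. s (Suc (Suc n))))" by simp
  have "Df (\<lambda>s. \<exists>a. P a s \<and> (\<forall>b. P b s \<longrightarrow> b = a))"
    by (intro Df_ex Df_conj Df_all Df_imp Df_eq Tm_var assms *)
  then show ?thesis by (simp add: Ex1_def)
qed

lemma Cl_Collect: "Df (\<lambda>s. P (s 0) (\<lambda>n. s (Suc n))) \<Longrightarrow> Cl (\<lambda>s. {x. P x s})"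
  by (simp add: Cl_def)

lemma Cl_const_elts: "Tm a \<Longrightarrow> Cl (\<lambda>s. elts (a s))"
  unfolding Cl_def mem_elts by (intro Df_mem Tm_var Tm_shift)

lemma Df_in: 
  assumes "Tm x" "Cl A"
  shows "Df (\<lambda>s. x s \<in> A s)"
  by (rule Df_subst[where P = "\<lambda>a s. a \<in> A s", OF _ assms(1)]) (use assms in \<open>simp add: Cl_def\<close>)

lemma Cl_UNIV: "Cl (\<lambda>s. UNIV)" and Cl_empty: "Cl (\<lambda>s. {})"
  by (simp_all add: Cl_def Df_const)

lemma Cl_insert: "Tm x \<Longrightarrow> Cl A \<Longrightarrow> Cl (\<lambda>s. insert (x s) (A s))"
  unfolding Cl_def insert_iff by (intro Df_disj Df_eq Tm_var Tm_shift) auto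

lemma Cl_Int: "Cl A \<Longrightarrow> Cl B \<Longrightarrow> Cl (\<lambda>s. A s \<inter> B s)"
  unfolding Cl_def Int_iff by (intro Df_conj)

lemma Cl_Diff: "Cl A \<Longrightarrow> Cl B \<Longrightarrow> Cl (\<lambda>s. A s - B s)"
  unfolding Cl_def Diff_iff by (intro Df_conj Df_not)

lemma Df_ball: "Cl A \<Longrightarrow> Df (\<lambda>s. P (s 0) (\<lambda>n. s (Suc n))) \<Longrightarrow> Df (\<lambda>s. \<forall>x\<in>A s. P x s)"
  unfolding Ball_def by (intro Df_all Df_imp) (auto simp: Cl_def)

lemma Df_bex: "Cl A \<Longrightarrow> Df (\<lambda>s. P (s 0) (\<lambda>n. s (Suc n))) \<Longrightarrow> Df (\<lambda>s. \<exists>x\<in>A s. P x s)"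
  unfolding Bex_def by (intro Df_ex Df_conj) (auto simp: Cl_def)

lemma Df_subset: "Cl A \<Longrightarrow> Cl B \<Longrightarrow> Df (\<lambda>s. A s \<subseteq> B s)"
  unfolding subset_iff by (intro Df_all Df_imp) (auto simp: Cl_def)

lemma Df_set_eq: "Cl A \<Longrightarrow> Cl B \<Longrightarrow> Df (\<lambda>s. A s = B s)"
  unfolding set_eq_iff by (intro Df_all Df_iff) (auto simp: Cl_def)

lemma Cl_INT: 
  assumes "Cl A" "Cl (\<lambda>s. B (s 0) (\<lambda>n. s (Suc n)))"
  shows "Cl (\<lambda>s. \<Inter>x\<in>A s. B x s)"
proof -
  have "inj (\<lambda>n::nat. if n = 0 then 1 else if n = 1 then 0 else n)" by (auto simp: inj_def)
  from Df_rename[OF this assms(2)[unfolded Cl_def]]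
  have "Df (\<lambda>s. s 1 \<in> B (s 0) (\<lambda>n. s (Suc (Suc n))))" by simp
  moreover have inj: "inj (case_nat 0 (\<lambda>n. Suc (Suc n)))"
    by (auto simp: inj_def split: nat.splits)
  have "Df (\<lambda>s. s 0 \<in> A (\<lambda>n. s (Suc (Suc n))))"
    using Df_rename[OF inj assms(1)[unfolded Cl_def]] by simp
  ultimately show ?thesis
    unfolding Cl_def INT_iff Ball_def by (intro Df_all Df_imp) auto
qed

text \<open>As introduction rules, these reduce the definability of a concrete expression to that of
  its variables and constants, by recursion on its shape.\<close>

named_theorems df
lemmas [df] = Df_not Df_conj Df_disj Df_imp Df_iff Df_all Df_ex Df_ex1 Df_if Df_const
  Tm_const Tm_var Df_mem Df_eq Cl_Collect Cl_const_elts Df_in Cl_UNIV Cl_empty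
  Cl_insert Cl_Int Cl_Diff Df_ball Df_bex Df_subset Df_set_eq Cl_INT

lemma Df_opair [df]: "Tm p \<Longrightarrow> Tm x \<Longrightarrow> Tm y \<Longrightarrow> Df (\<lambda>s. opair (p s) (x s) (y s))"
  by (rule Df_3[where P = opair], unfold opair_def) (intro df)

lemma Df_related [df]: "Tm p \<Longrightarrow> Tm x \<Longrightarrow> Tm y \<Longrightarrow> Df (\<lambda>s. related (p s) (x s) (y s))"
  by (rule Df_3[where P = related], unfold related_def) (intro df)

section \<open>Set existence from the two schemas, and definite descriptions\<close>

lemma ex_Sep:
  assumes "Df (\<lambda>s. P (s 0))"
  shows "\<exists>b. \<forall>x. x \<epsilon> b \<longleftrightarrow> x \<epsilon> a \<and> P x"
proof -
  obtain \<phi> t where P: "\<And>s. P (s 0) \<longleftrightarrow> sat mem (mix s t) \<phi>"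
    using assms unfolding Df_def by blast
  have "(mix s t)(0 := x) = mix (s(0 := x)) t" for s x
    by (auto simp: mix_def fun_eq_iff)
  then have "P x \<longleftrightarrow> sat mem ((mix s t)(0 := x)) \<phi>" for s x
    using P[of "s(0 := x)"] by simp
  with separation[of a "mix undefined t" \<phi>] show ?thesis by simp
qed

lemma ex_Repl:
  assumes "Tm (\<lambda>s. F (s 0))"
  shows "\<exists>b. \<forall>y. y \<epsilon> b \<longleftrightarrow> (\<exists>x. x \<epsilon> a \<and> y = F x)"
proof -
  obtain \<phi> t where P: "\<And>s. s 0 = F (s 1) \<longleftrightarrow> sat mem (mix s t) \<phi>"
    using assms unfolding Df_def Tm_def by auto
  \<comment> \<open>In \<open>\<phi>\<close> the value is variable 0 and the argument, at position 1
    of the environment, is variable 2; the schema expects the argument at 0 and the value at 1. All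
    other variables move up by two, and \<open>S\<close> shifts the valuation accordingly.\<close>
  define f :: "nat \<Rightarrow> nat" where "f n = (if n = 0 then 1 else if n = 2 then 0 else n + 2)" for n
  have "inj f" by (auto simp: inj_def f_def)
  define S where "S n = mix undefined t (n - 2)" for n
  have "S(0 := x, 1 := y) \<circ> f = mix (undefined(0 := y, 1 := x)) t" for x y
  proof
    fix n show "(S(0 := x, 1 := y) \<circ> f) n = mix (undefined(0 := y, 1 := x)) t n"
      using mix_even[of "undefined(0 := y, 1 := x)" t 1]
      by (auto simp: f_def S_def numeral_2_eq_2) (auto simp: mix_def elim!: evenE)
  qed
  then have "sat mem (S(0 := x, 1 := y)) (rename f \<phi>) \<longleftrightarrow> y = F x" for x y
    using P[of "undefined(0 := y, 1 := x)"] by (simp add: sat_rename[OF \<open>inj f\<close>] del: fun_upd_apply) simp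
  with replacement[of a S "rename f \<phi>"] show ?thesis by simp
qed

lemma ext: "(\<And>z. z \<epsilon> x \<longleftrightarrow> z \<epsilon> y) \<Longrightarrow> x = y"
  using extensionality by blast

lemma elts_eq_iff [simp]: "elts x = elts y \<longleftrightarrow> x = y"
  by (auto intro!: ext simp: set_eq_iff)

text \<open>Without a unique witness, \<open>THE\<close> returns an unspecified value that may vary
  with the predicate and is not known to be definable. The empty set as default makes every
  description of a definable predicate a definable term.\<close>

definition the1 :: "('v \<Rightarrow> bool) \<Rightarrow> 'v" where
  "the1 P = (if \<exists>!x. P x then THE x. P x else THE x. \<forall>z. \<not> z \<epsilon> x)"

lemma the1_equality: "P a \<Longrightarrow> (\<And>x. P x \<Longrightarrow> x = a) \<Longrightarrow> the1 P = a"
  unfolding the1_def by (metis the_equality)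

lemma the1I: "\<exists>!x. P x \<Longrightarrow> P (the1 P)"
  unfolding the1_def by (simp add: theI')

lemma Tm_the1 [df]:
  assumes "Df (\<lambda>s. P (s 0) (\<lambda>n. s (Suc n)))"
  shows "Tm (\<lambda>s. the1 (\<lambda>x. P x s))"
proof -
  define c where "c = (THE x. \<forall>z. \<not> z \<epsilon> x)"
  have "inj (\<lambda>n::nat. if n = 0 then 0 else Suc n)" by (auto simp: inj_def)
  from Df_rename[OF this assms]
  have *: "Df (\<lambda>s. P (s 0) (\<lambda>n. s (Suc (Suc n))))" by simp
  have "Df (\<lambda>s. if \<exists>!x. P x (\<lambda>n. s (Suc n)) then P (s 0) (\<lambda>n. s (Suc n)) else s 0 = c)"
    by (intro df * assms)
  moreover have "(if \<exists>!x. P x s then P y s else y = c) \<longleftrightarrow> y = the1 (\<lambda>x. P x s)" for y s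
    unfolding the1_def c_def[symmetric] by (auto intro: theI the_equality[symmetric])
  ultimately show ?thesis unfolding Tm_def by simp
qed

definition Sep :: "'v \<Rightarrow> ('v \<Rightarrow> bool) \<Rightarrow> 'v" where
  "Sep a P = the1 (\<lambda>b. \<forall>x. x \<epsilon> b \<longleftrightarrow> x \<epsilon> a \<and> P x)"

definition Repl :: "'v \<Rightarrow> ('v \<Rightarrow> 'v) \<Rightarrow> 'v" where
  "Repl a F = the1 (\<lambda>b. \<forall>y. y \<epsilon> b \<longleftrightarrow> (\<exists>x. x \<epsilon> a \<and> y = F x))"

lemma the1_set:
  assumes "\<exists>b. \<forall>x. x \<epsilon> b \<longleftrightarrow> Q x"
  shows "x \<epsilon> the1 (\<lambda>b. \<forall>x. x \<epsilon> b \<longleftrightarrow> Q x) \<longleftrightarrow> Q x"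
proof -
  obtain b where b: "\<forall>x. x \<epsilon> b \<longleftrightarrow> Q x" using assms by blast
  have "the1 (\<lambda>b. \<forall>x. x \<epsilon> b \<longleftrightarrow> Q x) = b"
    by (rule the1_equality[where P = "\<lambda>b. \<forall>x. x \<epsilon> b \<longleftrightarrow> Q x", OF b]) (simp add: b ext)
  with b show ?thesis by simp
qed

lemma mem_Sep: "Df (\<lambda>s. P (s 0)) \<Longrightarrow> x \<epsilon> Sep a P \<longleftrightarrow> x \<epsilon> a \<and> P x"
  unfolding Sep_def by (rule the1_set[OF ex_Sep])

lemma mem_Repl: "Tm (\<lambda>s. F (s 0)) \<Longrightarrow> y \<epsilon> Repl a F \<longleftrightarrow> (\<exists>x. x \<epsilon> a \<and> y = F x)"
  unfolding Repl_def by (rule the1_set[OF ex_Repl])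

lemma Df_skip:
  assumes "Df (\<lambda>s. P (s 0) (\<lambda>n. s (Suc n)))"
  shows "Df (\<lambda>s. P (s 0) (\<lambda>n. s (Suc (Suc n))))"
proof -
  have "inj (\<lambda>n::nat. if n = 0 then 0 else Suc n)" by (auto simp: inj_def)
  from Df_rename[OF this assms] show ?thesis by simp
qed

lemma Tm_skip:
  assumes "Tm (\<lambda>s. F (s 0) (\<lambda>n. s (Suc n)))"
  shows "Tm (\<lambda>s. F (s 0) (\<lambda>n. s (Suc (Suc n))))"
proof -
  have "inj (\<lambda>n::nat. if n \<le> 1 then n else Suc n)" by (auto simp: inj_def)
  from Df_rename[OF this assms[unfolded Tm_def]] show ?thesis unfolding Tm_def by simp
qed

lemma Tm_Sep [df]:
  assumes "Tm a" "Df (\<lambda>s. P (s 0) (\<lambda>n. s (Suc n)))"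
  shows "Tm (\<lambda>s. Sep (a s) (\<lambda>x. P x s))"
  unfolding Sep_def by (intro df Tm_shift assms Df_skip[OF assms(2)])

lemma Tm_Repl [df]:
  assumes "Tm a" "Tm (\<lambda>s. F (s 0) (\<lambda>n. s (Suc n)))"
  shows "Tm (\<lambda>s. Repl (a s) (\<lambda>x. F x s))"
proof -
  have "Tm (\<lambda>s. F (s 0) (\<lambda>n. s (Suc (Suc (Suc n)))))"
    using Tm_skip[of "\<lambda>x s. F x (\<lambda>n. s (Suc n))"] Tm_skip[OF assms(2)] by simp
  then show ?thesis
    unfolding Repl_def by (intro df Tm_shift assms)
qed

section \<open>Set-theoretic operations as definable terms\<close>

definition upair :: "'v \<Rightarrow> 'v \<Rightarrow> 'v" where "upair x y = the1 (\<lambda>p. \<forall>z. z \<epsilon> p \<longleftrightarrow> z = x \<or> z = y)"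
definition vunion :: "'v \<Rightarrow> 'v" where "vunion x = the1 (\<lambda>u. \<forall>z. z \<epsilon> u \<longleftrightarrow> (\<exists>y. y \<epsilon> x \<and> z \<epsilon> y))"
definition vpow :: "'v \<Rightarrow> 'v" where "vpow x = the1 (\<lambda>u. \<forall>z. z \<epsilon> u \<longleftrightarrow> (\<forall>y. y \<epsilon> z \<longrightarrow> y \<epsilon> x))"
definition pr :: "'v \<Rightarrow> 'v \<Rightarrow> 'v" where "pr x y = upair (upair x x) (upair x y)"
definition un :: "'v \<Rightarrow> 'v \<Rightarrow> 'v" where "un x y = vunion (upair x y)"
definition suc :: "'v \<Rightarrow> 'v" where "suc x = un x (upair x x)"
definition app :: "'v \<Rightarrow> 'v \<Rightarrow> 'v" where "app f x = the1 (\<lambda>y. related f x y)"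
definition vlam :: "'v \<Rightarrow> ('v \<Rightarrow> 'v) \<Rightarrow> 'v" where "vlam a F = Repl a (\<lambda>x. pr x (F x))"
definition cart :: "'v \<Rightarrow> 'v \<Rightarrow> 'v" where "cart a b = vunion (Repl a (\<lambda>x. Repl b (\<lambda>y. pr x y)))"
definition dom :: "'v \<Rightarrow> 'v" where "dom f = Sep (vunion (vunion f)) (\<lambda>x. \<exists>y. related f x y)"

lemma mem_upair [simp]: "z \<epsilon> upair x y \<longleftrightarrow> z = x \<or> z = y"
  unfolding upair_def by (rule the1_set[OF pairing])
lemma mem_vunion [simp]: "z \<epsilon> vunion x \<longleftrightarrow> (\<exists>y. y \<epsilon> x \<and> z \<epsilon> y)"
  unfolding vunion_def by (rule the1_set[OF union])
lemma mem_vpow [simp]: "z \<epsilon> vpow x \<longleftrightarrow> (\<forall>y. y \<epsilon> z \<longrightarrow> y \<epsilon> x)"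
  unfolding vpow_def by (rule the1_set[OF power_set])
lemma mem_un [simp]: "z \<epsilon> un x y \<longleftrightarrow> z \<epsilon> x \<or> z \<epsilon> y"
  unfolding un_def by auto
lemma mem_suc [simp]: "z \<epsilon> suc x \<longleftrightarrow> z \<epsilon> x \<or> z = x"
  unfolding suc_def by auto

lemma Tm_upair [df]: "Tm x \<Longrightarrow> Tm y \<Longrightarrow> Tm (\<lambda>s. upair (x s) (y s))"
  by (rule Tm_2[where F = upair], unfold upair_def) (intro df)
lemma Tm_vunion [df]: "Tm x \<Longrightarrow> Tm (\<lambda>s. vunion (x s))"
  by (rule Tm_1[where F = vunion], unfold vunion_def) (intro df)
lemma Tm_vpow [df]: "Tm x \<Longrightarrow> Tm (\<lambda>s. vpow (x s))"
  by (rule Tm_1[where F = vpow], unfold vpow_def) (intro df)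
lemma Tm_pr [df]: "Tm x \<Longrightarrow> Tm y \<Longrightarrow> Tm (\<lambda>s. pr (x s) (y s))"
  by (rule Tm_2[where F = pr], unfold pr_def) (intro df)
lemma Tm_un [df]: "Tm x \<Longrightarrow> Tm y \<Longrightarrow> Tm (\<lambda>s. un (x s) (y s))"
  by (rule Tm_2[where F = un], unfold un_def) (intro df)
lemma Tm_suc [df]: "Tm x \<Longrightarrow> Tm (\<lambda>s. suc (x s))"
  by (rule Tm_1[where F = suc], unfold suc_def) (intro df)
lemma Tm_app [df]: "Tm x \<Longrightarrow> Tm y \<Longrightarrow> Tm (\<lambda>s. app (x s) (y s))"
  by (rule Tm_2[where F = app], unfold app_def) (intro df)
lemma Tm_vlam [df]: "Tm a \<Longrightarrow> Tm (\<lambda>s. F (s 0) (\<lambda>n. s (Suc n))) \<Longrightarrow> Tm (\<lambda>s. vlam (a s) (\<lambda>x. F x s))"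
  unfolding vlam_def by (intro df)
lemma Tm_cart [df]: "Tm x \<Longrightarrow> Tm y \<Longrightarrow> Tm (\<lambda>s. cart (x s) (y s))"
  by (rule Tm_2[where F = cart], unfold cart_def) (intro df)
lemma Tm_dom [df]: "Tm x \<Longrightarrow> Tm (\<lambda>s. dom (x s))"
  by (rule Tm_1[where F = dom], unfold dom_def) (intro df)

lemma pr_inject [simp]: "pr x y = pr x' y' \<longleftrightarrow> x = x' \<and> y = y'"
proof
  assume "pr x y = pr x' y'"
  then have "z \<epsilon> pr x y \<longleftrightarrow> z \<epsilon> pr x' y'" for z by simp
  then have *: "z = upair x x \<or> z = upair x y \<longleftrightarrow> z = upair x' x' \<or> z = upair x' y'" for z
    by (simp add: pr_def)
  have u: "upair a b = upair c d \<longleftrightarrow> (a = c \<and> b = d) \<or> (a = d \<and> b = c)" for a b c d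
  proof
    assume "upair a b = upair c d"
    then have "z = a \<or> z = b \<longleftrightarrow> z = c \<or> z = d" for z
      using mem_upair[of z a b] mem_upair[of z c d] by simp
    from this[of a] this[of b] this[of c] this[of d]
    show "(a = c \<and> b = d) \<or> (a = d \<and> b = c)" by auto
  qed (auto intro: ext)
  show "x = x' \<and> y = y'"
    using *[of "upair x x"] *[of "upair x y"] *[of "upair x' y'"] by (auto simp: u)
qed simp

lemma opair_iff: "opair p x y \<longleftrightarrow> p = pr x y"
proof -
  have 1: "elts s = {x} \<longleftrightarrow> s = upair x x" for s x
    by (subst elts_eq_iff[symmetric]) (auto simp: set_eq_iff)
  have 2: "elts s = {x, y} \<longleftrightarrow> s = upair x y" for s x y
    by (subst elts_eq_iff[symmetric]) (auto simp: set_eq_iff)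
  show ?thesis by (simp add: opair_def 1 2 pr_def)
qed

lemma related_iff: "related r x y \<longleftrightarrow> pr x y \<epsilon> r"
  by (auto simp: related_def opair_iff)

lemma mem_cart [simp]: "p \<epsilon> cart a b \<longleftrightarrow> (\<exists>x y. x \<epsilon> a \<and> y \<epsilon> b \<and> p = pr x y)"
proof -
  have "y \<epsilon> Repl b (\<lambda>y. pr x y) \<longleftrightarrow> (\<exists>z. z \<epsilon> b \<and> y = pr x z)" for y x
    by (rule mem_Repl) (intro df)
  moreover have "z \<epsilon> Repl a (\<lambda>x. Repl b (\<lambda>y. pr x y)) \<longleftrightarrow> (\<exists>x. x \<epsilon> a \<and> z = Repl b (\<lambda>y. pr x y))" for z
    by (rule mem_Repl) (intro df)
  ultimately show ?thesis by (auto simp: cart_def)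
qed

lemma mem_vlam: "Tm (\<lambda>s. F (s 0)) \<Longrightarrow> p \<epsilon> vlam a F \<longleftrightarrow> (\<exists>x. x \<epsilon> a \<and> p = pr x (F x))"
  unfolding vlam_def by (rule mem_Repl) (intro df)

lemma app_eq: "related f x y \<Longrightarrow> (\<And>y'. related f x y' \<Longrightarrow> y' = y) \<Longrightarrow> app f x = y"
  unfolding app_def by (rule the1_equality)

lemma app_vlam: "Tm (\<lambda>s. F (s 0)) \<Longrightarrow> x \<epsilon> a \<Longrightarrow> app (vlam a F) x = F x"
  by (rule app_eq) (auto simp: mem_vlam related_iff)

lemma dom_iff: "x \<epsilon> dom f \<longleftrightarrow> (\<exists>y. related f x y)"
proof -
  have "x \<epsilon> dom f \<longleftrightarrow> x \<epsilon> vunion (vunion f) \<and> (\<exists>y. related f x y)"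
    unfolding dom_def by (rule mem_Sep) (intro df)
  moreover have "x \<epsilon> vunion (vunion f)" if "related f x y" for y
  proof -
    have "upair x y \<epsilon> vunion f"
      using that by (auto simp: related_iff pr_def intro: exI[of _ "pr x y"])
    moreover have "x \<epsilon> upair x y" by simp
    ultimately show ?thesis unfolding mem_vunion[of x] by blast
  qed
  ultimately show ?thesis by blast
qed

lemma Tm_app1 [simp]: "Tm (\<lambda>s. app f (s 0))"
  by (intro df)

lemma mem_minimal: "z \<epsilon> x \<Longrightarrow> \<exists>y. y \<epsilon> x \<and> (\<forall>z. z \<epsilon> x \<longrightarrow> \<not> z \<epsilon> y)"
  using foundation[of x] by blast

lemma mem_no_3_cycle: "x \<epsilon> y \<Longrightarrow> y \<epsilon> z \<Longrightarrow> \<not> z \<epsilon> x"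
  using mem_minimal[of x "un (upair x y) (upair z z)"] by auto

lemma mem_not_sym: "x \<epsilon> y \<Longrightarrow> \<not> y \<epsilon> x"
  using mem_minimal[of x "upair x y"] by auto

lemma mem_irrefl [simp]: "\<not> x \<epsilon> x"
  using mem_not_sym by blast

subsection \<open>Ordinals and recursion\<close>

lemma ordinal_iff:
  "ordinal \<alpha> \<longleftrightarrow> (\<forall>x y. x \<epsilon> \<alpha> \<longrightarrow> y \<epsilon> x \<longrightarrow> y \<epsilon> \<alpha>) \<and>
    (\<forall>x y. x \<epsilon> \<alpha> \<longrightarrow> y \<epsilon> \<alpha> \<longrightarrow> x \<epsilon> y \<or> x = y \<or> y \<epsilon> x)"
  unfolding ordinal_def ball_elts subset_iff mem_elts by blast

lemma ordinal_trans: "ordinal \<alpha> \<Longrightarrow> x \<epsilon> \<alpha> \<Longrightarrow> y \<epsilon> x \<Longrightarrow> y \<epsilon> \<alpha>"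
  unfolding ordinal_iff by blast

lemma ordinal_comparable: "ordinal \<alpha> \<Longrightarrow> x \<epsilon> \<alpha> \<Longrightarrow> y \<epsilon> \<alpha> \<Longrightarrow> x \<epsilon> y \<or> x = y \<or> y \<epsilon> x"
  unfolding ordinal_iff by blast

lemma ordinal_elem:
  assumes "ordinal \<alpha>" "x \<epsilon> \<alpha>"
  shows "ordinal x"
  unfolding ordinal_iff
proof (intro conjI allI impI)
  fix y z assume y: "y \<epsilon> x" and z: "z \<epsilon> y"
  then have "z \<epsilon> \<alpha>" using assms ordinal_trans by blast
  then have "x \<epsilon> z \<or> x = z \<or> z \<epsilon> x" using assms ordinal_comparable by blast
  with y z show "z \<epsilon> x" using mem_no_3_cycle mem_not_sym by blast
next
  fix y z assume "y \<epsilon> x" "z \<epsilon> x"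
  then show "y \<epsilon> z \<or> y = z \<or> z \<epsilon> y"
    using assms ordinal_trans ordinal_comparable by blast
qed

text \<open>If \<open>\<gamma>\<close> is not \<open>\<alpha>\<close>, the least element
  \<open>\<delta>\<close> of \<open>\<alpha>\<close> outside \<open>\<gamma>\<close> is
  \<open>\<gamma>\<close> itself: below \<open>\<delta>\<close> everything lies in
  \<open>\<gamma>\<close> by minimality, and an element of \<open>\<gamma>\<close> not below
  \<open>\<delta>\<close> would put \<open>\<delta>\<close> into \<open>\<gamma>\<close> by
  transitivity.\<close>

lemma ordinal_subset:
  assumes "ordinal \<alpha>" "\<And>x. x \<epsilon> \<gamma> \<Longrightarrow> x \<epsilon> \<alpha>" "\<And>x y. x \<epsilon> \<gamma> \<Longrightarrow> y \<epsilon> x \<Longrightarrow> y \<epsilon> \<gamma>"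
  shows "\<gamma> = \<alpha> \<or> \<gamma> \<epsilon> \<alpha>"
proof (cases "\<gamma> = \<alpha>")
  case False
  have S: "x \<epsilon> Sep \<alpha> (\<lambda>x. \<not> x \<epsilon> \<gamma>) \<longleftrightarrow> x \<epsilon> \<alpha> \<and> \<not> x \<epsilon> \<gamma>" for x
    by (rule mem_Sep) (intro df)
  obtain x where "x \<epsilon> \<alpha>" "\<not> x \<epsilon> \<gamma>" using False assms(2) ext by blast
  then obtain \<delta> where d: "\<delta> \<epsilon> \<alpha>" "\<not> \<delta> \<epsilon> \<gamma>" "\<And>z. z \<epsilon> \<delta> \<Longrightarrow> z \<epsilon> \<alpha> \<Longrightarrow> z \<epsilon> \<gamma>"
    using mem_minimal[of x "Sep \<alpha> (\<lambda>x. \<not> x \<epsilon> \<gamma>)"] S by blast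
  have "\<gamma> = \<delta>"
  proof (rule ext, rule iffI)
    fix z assume z: "z \<epsilon> \<gamma>"
    then have "z \<epsilon> \<delta> \<or> z = \<delta> \<or> \<delta> \<epsilon> z"
      using assms(1,2) d(1) ordinal_comparable by blast
    with z d(2) assms(3) show "z \<epsilon> \<delta>" by blast
  next
    fix z assume "z \<epsilon> \<delta>"
    then show "z \<epsilon> \<gamma>" using d(1,3) assms(1) ordinal_trans by blast
  qed
  with d show ?thesis by blast
qed simp

text \<open>The intersection is a transitive subset of both ordinals, so it equals one of them or
  belongs to both; in the latter case it would be a member of itself.\<close>

lemma ordinal_linear:
  assumes "ordinal \<alpha>" "ordinal \<beta>"
  shows "\<alpha> \<epsilon> \<beta> \<or> \<alpha> = \<beta> \<or> \<beta> \<epsilon> \<alpha>"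
proof -
  define \<gamma> where "\<gamma> = Sep \<alpha> (\<lambda>x. x \<epsilon> \<beta>)"
  have g: "x \<epsilon> \<gamma> \<longleftrightarrow> x \<epsilon> \<alpha> \<and> x \<epsilon> \<beta>" for x
    unfolding \<gamma>_def by (rule mem_Sep) (intro df)
  have "\<gamma> = \<alpha> \<or> \<gamma> \<epsilon> \<alpha>"
    by (rule ordinal_subset[OF assms(1)]) (use g assms ordinal_trans in blast)+
  moreover have "\<gamma> = \<beta> \<or> \<gamma> \<epsilon> \<beta>"
    by (rule ordinal_subset[OF assms(2)]) (use g assms ordinal_trans in blast)+
  ultimately show ?thesis using g[of \<gamma>] by auto
qed

lemma ordinal_suc:
  assumes "ordinal \<alpha>"
  shows "ordinal (suc \<alpha>)"
  using assms unfolding ordinal_iff mem_suc by metis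

lemma ordinal_suc_mem:
  assumes "ordinal \<alpha>" "\<beta> \<epsilon> \<alpha>"
  shows "suc \<beta> = \<alpha> \<or> suc \<beta> \<epsilon> \<alpha>"
  using ordinal_linear[OF assms(1) ordinal_suc[OF ordinal_elem[OF assms]]] assms
    mem_not_sym by auto

text \<open>The least counterexample comes from separation on \<open>suc \<alpha>\<close>, which is
  why induction is confined to definable predicates.\<close>

lemma ordinal_induct:
  assumes "Df (\<lambda>s. P (s 0))" "ordinal \<alpha>"
    and step: "\<And>\<alpha>. ordinal \<alpha> \<Longrightarrow> (\<And>\<beta>. \<beta> \<epsilon> \<alpha> \<Longrightarrow> P \<beta>) \<Longrightarrow> P \<alpha>"
  shows "P \<alpha>"
proof (rule ccontr)
  assume "\<not> P \<alpha>"
  have S: "x \<epsilon> Sep (suc \<alpha>) (\<lambda>x. \<not> P x) \<longleftrightarrow> x \<epsilon> suc \<alpha> \<and> \<not> P x" for x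
    by (rule mem_Sep) (intro df assms(1))
  obtain \<delta> where d: "\<delta> \<epsilon> suc \<alpha>" "\<not> P \<delta>" "\<And>z. z \<epsilon> \<delta> \<Longrightarrow> z \<epsilon> suc \<alpha> \<Longrightarrow> P z"
    using mem_minimal[of \<alpha> "Sep (suc \<alpha>) (\<lambda>x. \<not> P x)"] S \<open>\<not> P \<alpha>\<close> by auto
  have "P \<delta>"
    by (rule step) (use d assms(2) ordinal_suc ordinal_elem ordinal_trans in blast)+
  with d show False by blast
qed

lemma ordinal_least:
  assumes "Df (\<lambda>s. P (s 0))" "ordinal \<alpha>" "P \<alpha>"
  shows "\<exists>\<beta>. (\<beta> \<epsilon> \<alpha> \<or> \<beta> = \<alpha>) \<and> P \<beta> \<and> (\<forall>\<gamma>. \<gamma> \<epsilon> \<beta> \<longrightarrow> \<not> P \<gamma>)"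
proof (rule ccontr)
  assume *: "\<not> ?thesis"
  have "\<beta> \<epsilon> \<alpha> \<or> \<beta> = \<alpha> \<longrightarrow> \<not> P \<beta>" if "ordinal \<beta>" for \<beta>
  proof (rule ordinal_induct[where P = "\<lambda>\<beta>. \<beta> \<epsilon> \<alpha> \<or> \<beta> = \<alpha> \<longrightarrow> \<not> P \<beta>", OF _ that])
    show "Df (\<lambda>s. s 0 \<epsilon> \<alpha> \<or> s 0 = \<alpha> \<longrightarrow> \<not> P (s 0))" by (intro df assms(1))
  qed (use * assms(2) ordinal_trans in blast)
  with assms show False by blast
qed

section \<open>Functions as sets of pairs\<close>

lemma function_on_iff:
  "function_on f D \<longleftrightarrow>
    (\<forall>p. p \<epsilon> f \<longrightarrow> (\<exists>x\<in>D. \<exists>y. p = pr x y)) \<and> (\<forall>x\<in>D. \<exists>!y. related f x y)"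
  unfolding function_on_def opair_iff by simp

lemma function_on_unique:
  assumes "function_on f D"
  shows "related f x y \<longleftrightarrow> x \<in> D \<and> y = app f x"
proof
  assume r: "related f x y"
  then have x: "x \<in> D" using assms unfolding function_on_iff related_iff by fastforce
  then have "y' = y" if "related f x y'" for y'
    using assms r that unfolding function_on_def by auto
  with r x show "x \<in> D \<and> y = app f x" using app_eq by metis
next
  assume *: "x \<in> D \<and> y = app f x"
  then have "\<exists>!y. related f x y" using assms unfolding function_on_def by auto
  from the1I[OF this] * show "related f x y" by (simp add: app_def)
qed

lemma function_on_eqI:
  assumes "function_on f D" "function_on g D" "\<And>x. x \<in> D \<Longrightarrow> app f x = app g x"
  shows "f = g"
proof (rule ext)
  fix p
  have *: "p \<epsilon> h \<longleftrightarrow> (\<exists>x\<in>D. p = pr x (app h x))" if h: "function_on h D" for h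
  proof
    assume "p \<epsilon> h"
    then obtain x y where "p = pr x y" using h unfolding function_on_iff by blast
    with \<open>p \<epsilon> h\<close> function_on_unique[OF h, of x y] show "\<exists>x\<in>D. p = pr x (app h x)"
      by (auto simp: related_iff)
  next
    assume "\<exists>x\<in>D. p = pr x (app h x)"
    then show "p \<epsilon> h" using function_on_unique[OF h] by (auto simp: related_iff)
  qed
  show "p \<epsilon> f \<longleftrightarrow> p \<epsilon> g" using *[OF assms(1)] *[OF assms(2)] assms(3) by auto
qed

lemma function_on_vlam: "Tm (\<lambda>s. F (s 0)) \<Longrightarrow> function_on (vlam a F) (elts a)"
  unfolding function_on_def by (auto simp: opair_iff related_iff mem_vlam)

lemma vlam_cong:
  assumes "Tm (\<lambda>s. F (s 0))" "Tm (\<lambda>s. G (s 0))" "\<And>x. x \<epsilon> a \<Longrightarrow> F x = G x"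
  shows "vlam a F = vlam a G"
  by (rule ext) (use assms in \<open>auto simp: mem_vlam\<close>)

lemma dom_vlam [simp]: "Tm (\<lambda>s. F (s 0)) \<Longrightarrow> dom (vlam a F) = a"
  by (rule ext) (auto simp: dom_iff related_iff mem_vlam)

section \<open>Transfinite recursion\<close>

definition rec_on :: "('v \<Rightarrow> 'v) \<Rightarrow> 'v \<Rightarrow> 'v \<Rightarrow> bool" where
  "rec_on G \<alpha> f \<longleftrightarrow> function_on f (elts \<alpha>) \<and> (\<forall>\<beta>. \<beta> \<epsilon> \<alpha> \<longrightarrow> app f \<beta> = G (vlam \<beta> (app f)))"

text \<open>\<open>G\<close> receives the table of all earlier values as a set. The value at
  \<open>\<alpha>\<close> is read off an attempt on the elements of \<open>\<alpha>\<close> only, so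
  no table has to be extended to a successor.\<close>

definition recur :: "('v \<Rightarrow> 'v) \<Rightarrow> 'v \<Rightarrow> 'v" where
  "recur G \<alpha> = the1 (\<lambda>y. \<exists>f. rec_on G \<alpha> f \<and> y = G f)"

lemma Df_function_on [df]:
  assumes "Tm f" "Tm a"
  shows "Df (\<lambda>s. function_on (f s) (elts (a s)))"
  by (rule Df_2[where P = "\<lambda>f a. function_on f (elts a)"], unfold function_on_def) (intro df assms)+

lemma Df_rec_on:
  assumes "Tm (\<lambda>s. G (s 0))" "Tm a" "Tm f"
  shows "Df (\<lambda>s. rec_on G (a s) (f s))"
  by (rule Df_2[where P = "rec_on G"], unfold rec_on_def) (intro df assms Tm_1[OF assms(1)])+

lemma Tm_recur:
  assumes "Tm (\<lambda>s. G (s 0))" "Tm a"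
  shows "Tm (\<lambda>s. recur G (a s))"
  by (rule Tm_1[where F = "recur G"], unfold recur_def) (intro df assms Tm_1[OF assms(1)] Df_rec_on)+

lemma rec_on_unique:
  assumes G: "Tm (\<lambda>s. G (s 0))" and "rec_on G \<alpha> f" "rec_on G \<beta> g" "ordinal \<alpha>" "ordinal \<beta>"
    and "\<gamma> \<epsilon> \<alpha>" "\<gamma> \<epsilon> \<beta>"
  shows "app f \<gamma> = app g \<gamma>"
proof -
  have "\<gamma> \<epsilon> \<alpha> \<longrightarrow> \<gamma> \<epsilon> \<beta> \<longrightarrow> app f \<gamma> = app g \<gamma>" (is "?P \<gamma>")
  proof (rule ordinal_induct[of ?P])
    show "Df (\<lambda>s. ?P (s 0))" by (intro df)
    show "ordinal \<gamma>" using assms ordinal_elem by blast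
  next
    fix \<gamma> assume IH: "\<And>\<delta>. \<delta> \<epsilon> \<gamma> \<Longrightarrow> ?P \<delta>"
    show "?P \<gamma>"
    proof (intro impI)
      assume g: "\<gamma> \<epsilon> \<alpha>" "\<gamma> \<epsilon> \<beta>"
      have "vlam \<gamma> (app f) = vlam \<gamma> (app g)"
        by (rule vlam_cong[OF Tm_app1 Tm_app1]) (use IH g assms ordinal_trans in blast)
      then show "app f \<gamma> = app g \<gamma>" using assms(2,3) g unfolding rec_on_def by simp
    qed
  qed
  with assms show ?thesis by blast
qed

lemma recur_rec_on:
  assumes G: "Tm (\<lambda>s. G (s 0))" and "ordinal \<alpha>" "rec_on G \<alpha> f"
  shows "recur G \<alpha> = G f"
  unfolding recur_def
proof (rule the1_equality)
  fix y assume "\<exists>f. rec_on G \<alpha> f \<and> y = G f"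
  then obtain g where g: "rec_on G \<alpha> g" "y = G g" by blast
  have "g = f"
    by (rule function_on_eqI[of _ "elts \<alpha>"])
      (use g assms rec_on_unique[OF G g(1) assms(3)] in \<open>auto simp: rec_on_def\<close>)
  with g show "y = G f" by simp
qed (use assms in blast)

text \<open>The table of \<open>recur G\<close> below \<open>\<alpha>\<close> is itself the attempt:
  by induction the shorter tables are attempts, and \<open>recur_rec_on\<close> computes
  \<open>recur G\<close> from them.\<close>

lemma ex_rec_on:
  assumes G: "Tm (\<lambda>s. G (s 0))" and "ordinal \<alpha>"
  shows "rec_on G \<alpha> (vlam \<alpha> (recur G))"
proof (rule ordinal_induct[of "\<lambda>\<alpha>. rec_on G \<alpha> (vlam \<alpha> (recur G))"])
  show "Df (\<lambda>s. rec_on G (s 0) (vlam (s 0) (recur G)))"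
    by (intro df Df_rec_on Tm_recur G)
  note [simp] = function_on_vlam[of "recur G"] app_vlam[of "recur G"] Tm_recur[OF G] Tm_var
  fix \<alpha> assume o: "ordinal \<alpha>" and IH: "\<And>\<beta>. \<beta> \<epsilon> \<alpha> \<Longrightarrow> rec_on G \<beta> (vlam \<beta> (recur G))"
  show "rec_on G \<alpha> (vlam \<alpha> (recur G))"
    unfolding rec_on_def
  proof (intro conjI allI impI)
    fix \<beta> assume b: "\<beta> \<epsilon> \<alpha>"
    then have "recur G \<beta> = G (vlam \<beta> (recur G))"
      using recur_rec_on[OF G ordinal_elem[OF o] IH] by blast
    moreover have "vlam \<beta> (recur G) = vlam \<beta> (app (vlam \<alpha> (recur G)))"
      by (rule vlam_cong) (use o b ordinal_trans in auto)
    ultimately show "app (vlam \<alpha> (recur G)) \<beta> = G (vlam \<beta> (app (vlam \<alpha> (recur G))))"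
      using b by simp
  qed simp
qed fact

lemma recur_eq:
  assumes "Tm (\<lambda>s. G (s 0))" "ordinal \<alpha>"
  shows "recur G \<alpha> = G (vlam \<alpha> (recur G))"
  by (rule recur_rec_on[OF assms ex_rec_on[OF assms]])

subsection \<open>The cumulative hierarchy\<close>

text \<open>The step function sees only the table of earlier levels and recovers the ordinal as its
  domain. As a definable term, \<open>HV\<close> may occur in inductions and set formation;
  \<open>V_eq\<close> links it to the description \<open>V\<close>.\<close>

definition HV :: "'v \<Rightarrow> 'v" where
  "HV = recur (\<lambda>f. vunion (Repl (dom f) (\<lambda>\<gamma>. vpow (app f \<gamma>))))"

lemma Tm_HV [df]: "Tm a \<Longrightarrow> Tm (\<lambda>s. HV (a s))"
  unfolding HV_def by (intro Tm_recur df)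

lemma mem_HV:
  assumes "ordinal \<alpha>"
  shows "x \<epsilon> HV \<alpha> \<longleftrightarrow> (\<exists>\<beta>. \<beta> \<epsilon> \<alpha> \<and> (\<forall>y. y \<epsilon> x \<longrightarrow> y \<epsilon> HV \<beta>))"
proof -
  have *: "Tm (\<lambda>s. vunion (Repl (dom (s 0)) (\<lambda>\<gamma>. vpow (app (s 0) \<gamma>))))" by (intro df)
  have T: "Tm (\<lambda>s. HV (s 0))" by (intro df)
  have R: "y \<epsilon> Repl a (\<lambda>\<gamma>. vpow (app f \<gamma>)) \<longleftrightarrow> (\<exists>x. x \<epsilon> a \<and> y = vpow (app f x))" for y a f
    by (rule mem_Repl) (intro df)
  have "HV \<alpha> = vunion (Repl (dom (vlam \<alpha> HV)) (\<lambda>\<gamma>. vpow (app (vlam \<alpha> HV) \<gamma>)))"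
    unfolding HV_def by (rule recur_eq[OF * assms])
  then show ?thesis by (auto simp: R T app_vlam[OF T])
qed

lemma HV_mono:
  assumes "ordinal \<beta>" "\<alpha> \<epsilon> \<beta>" "x \<epsilon> HV \<alpha>"
  shows "x \<epsilon> HV \<beta>"
  using assms mem_HV ordinal_elem ordinal_trans by metis

lemma HV_subset:
  assumes "ordinal \<alpha>" "x \<epsilon> HV \<alpha>" "\<And>y. y \<epsilon> z \<Longrightarrow> y \<epsilon> x"
  shows "z \<epsilon> HV \<alpha>"
  using assms mem_HV by metis

lemma HV_trans:
  assumes "ordinal \<alpha>" "x \<epsilon> HV \<alpha>" "y \<epsilon> x"
  shows "y \<epsilon> HV \<alpha>"
  using assms HV_mono mem_HV by metis

lemma HV_suc: "ordinal \<alpha> \<Longrightarrow> HV (suc \<alpha>) = vpow (HV \<alpha>)"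
  by (rule ext) (use HV_mono in \<open>auto simp: mem_HV[OF ordinal_suc]\<close>)

text \<open>An ordinal \<open>x\<close> in \<open>HV \<alpha>\<close> is a subset of some
  \<open>HV \<beta>\<close> with \<open>\<beta>\<close> below \<open>\<alpha>\<close>; by induction
  its elements are below \<open>\<beta>\<close>, so \<open>x\<close> is at most
  \<open>\<beta>\<close>.\<close>

lemma ordinal_in_HV:
  assumes "ordinal \<alpha>"
  shows "ordinal x \<and> x \<epsilon> HV \<alpha> \<longleftrightarrow> x \<epsilon> \<alpha>"
proof -
  have "\<forall>x. ordinal x \<and> x \<epsilon> HV \<alpha> \<longleftrightarrow> x \<epsilon> \<alpha>"
  proof (rule ordinal_induct[OF _ assms])
    have "Df (\<lambda>s. ordinal (s 0))" unfolding ordinal_def by (intro df)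
    note [df] = Df_1[where P = ordinal, OF this]
    show "Df (\<lambda>s. \<forall>x. ordinal x \<and> x \<epsilon> HV (s 0) \<longleftrightarrow> x \<epsilon> s 0)"
      by (intro df)
    fix \<alpha> assume o: "ordinal \<alpha>" and IH: "\<And>\<beta>. \<beta> \<epsilon> \<alpha> \<Longrightarrow> \<forall>x. ordinal x \<and> x \<epsilon> HV \<beta> \<longleftrightarrow> x \<epsilon> \<beta>"
    show "\<forall>x. ordinal x \<and> x \<epsilon> HV \<alpha> \<longleftrightarrow> x \<epsilon> \<alpha>"
    proof (intro allI iffI)
      fix x assume x: "ordinal x \<and> x \<epsilon> HV \<alpha>"
      then obtain \<beta> where b: "\<beta> \<epsilon> \<alpha>" "\<forall>y. y \<epsilon> x \<longrightarrow> y \<epsilon> HV \<beta>" using mem_HV[OF o] by blast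
      then have "y \<epsilon> \<beta>" if "y \<epsilon> x" for y using that x ordinal_elem IH by blast
      then have "x = \<beta> \<or> x \<epsilon> \<beta>"
        using ordinal_subset[OF ordinal_elem[OF o b(1)], of x] x ordinal_trans by blast
      then show "x \<epsilon> \<alpha>" using b o ordinal_trans by blast
    next
      fix x assume "x \<epsilon> \<alpha>"
      then show "ordinal x \<and> x \<epsilon> HV \<alpha>"
        using IH[of x] ordinal_elem[OF o] unfolding mem_HV[OF o] by blast
    qed
  qed
  then show ?thesis by blast
qed

text \<open>\<open>V\<close> describes the level through a witnessing sequence. The table of
  \<open>HV\<close> is such a sequence, and by induction any other has the same values; this gives
  existence and uniqueness.\<close>

lemma V_eq:
  assumes o: "ordinal \<alpha>"
  shows "V \<alpha> = HV \<alpha>"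
proof -
  have T: "Tm (\<lambda>s. HV (s 0))" by (intro df)
  have fn: "function_on (vlam a HV) (elts a)" for a by (rule function_on_vlam[OF T])
  have sub: "subsets_of_values f \<beta> = elts (HV \<beta>)"
    if "function_on f (elts \<gamma>)" "\<And>\<delta>. \<delta> \<epsilon> \<beta> \<Longrightarrow> \<delta> \<epsilon> \<gamma> \<and> app f \<delta> = HV \<delta>" "ordinal \<beta>" for f \<gamma> \<beta>
    using that unfolding subsets_of_values_def
    by (auto simp: mem_HV function_on_unique[OF that(1)] subset_iff)
  have "is_V \<alpha> (HV \<alpha>)"
    unfolding is_V_def
  proof (intro bexI[of _ "vlam \<alpha> HV"] conjI ballI impI)
    fix \<beta> w assume "\<beta> \<in> elts \<alpha>" and r: "related (vlam \<alpha> HV) \<beta> w"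
    then have b: "\<beta> \<epsilon> \<alpha>" by simp
    have "subsets_of_values (vlam \<alpha> HV) \<beta> = elts (HV \<beta>)"
      by (rule sub[OF fn]) (simp_all add: ordinal_trans[OF o b] app_vlam[OF T] ordinal_elem[OF o b])
    then show "elts w = subsets_of_values (vlam \<alpha> HV) \<beta>"
      using r b by (auto simp: function_on_unique[OF fn] app_vlam[OF T])
  next
    show "elts (HV \<alpha>) = subsets_of_values (vlam \<alpha> HV) \<alpha>"
      by (rule sub[OF fn, symmetric]) (simp_all add: app_vlam[OF T] o)
  qed (auto simp: fn)
  moreover have "v = HV \<alpha>" if v: "is_V \<alpha> v" for v
  proof -
    obtain f where f: "function_on f (elts \<alpha>)"
      "\<forall>\<beta>\<in>elts \<alpha>. \<forall>w\<in>UNIV. related f \<beta> w \<longrightarrow> elts w = subsets_of_values f \<beta>"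
      "elts v = subsets_of_values f \<alpha>"
      using v unfolding is_V_def by blast
    have "\<beta> \<epsilon> \<alpha> \<longrightarrow> app f \<beta> = HV \<beta>" if "ordinal \<beta>" for \<beta>
    proof (rule ordinal_induct[where P = "\<lambda>\<beta>. \<beta> \<epsilon> \<alpha> \<longrightarrow> app f \<beta> = HV \<beta>", OF _ that])
      show "Df (\<lambda>s. s 0 \<epsilon> \<alpha> \<longrightarrow> app f (s 0) = HV (s 0))" by (intro df)
      fix \<beta> assume "ordinal \<beta>" and IH: "\<And>\<gamma>. \<gamma> \<epsilon> \<beta> \<Longrightarrow> \<gamma> \<epsilon> \<alpha> \<longrightarrow> app f \<gamma> = HV \<gamma>"
      show "\<beta> \<epsilon> \<alpha> \<longrightarrow> app f \<beta> = HV \<beta>"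
      proof
        assume b: "\<beta> \<epsilon> \<alpha>"
        then have "subsets_of_values f \<beta> = elts (HV \<beta>)"
          by (intro sub[OF f(1)]) (use IH o ordinal_trans ordinal_elem in blast)+
        moreover have "related f \<beta> (app f \<beta>)" using b function_on_unique[OF f(1)] by simp
        ultimately have "elts (app f \<beta>) = elts (HV \<beta>)" using f(2) b by simp
        then show "app f \<beta> = HV \<beta>" by simp
      qed
    qed
    then have "subsets_of_values f \<alpha> = elts (HV \<alpha>)"
      by (intro sub[OF f(1)]) (use o ordinal_elem in blast)+
    then show ?thesis using f(3) by simp
  qed
  ultimately show ?thesis unfolding V_def by blast
qed

subsection \<open>Cardinality\<close>

lemma Df_ordinal [df]: "Tm x \<Longrightarrow> Df (\<lambda>s. ordinal (x s))"
  by (rule Df_1[where P = ordinal], unfold ordinal_def) (intro df)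

lemma Df_function_from_to [df]: "Tm f \<Longrightarrow> Tm a \<Longrightarrow> Tm b \<Longrightarrow> Df (\<lambda>s. function_from_to (f s) (a s) (b s))"
  by (rule Df_3[where P = function_from_to], unfold function_from_to_def) (intro df)

lemma Df_bijection [df]: "Tm f \<Longrightarrow> Tm a \<Longrightarrow> Tm b \<Longrightarrow> Df (\<lambda>s. bijection (f s) (a s) (b s))"
  by (rule Df_3[where P = bijection], unfold bijection_def) (intro df)

lemma Df_equipotent [df]: "Tm a \<Longrightarrow> Tm b \<Longrightarrow> Df (\<lambda>s. equipotent (a s) (b s))"
  by (rule Df_2[where P = equipotent], unfold equipotent_def) (intro df)

lemma Df_cardinal [df]: "Tm a \<Longrightarrow> Df (\<lambda>s. cardinal (a s))"
  by (rule Df_1[where P = cardinal], unfold cardinal_def) (intro df)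

lemma Df_card_less [df]: "Tm a \<Longrightarrow> Tm b \<Longrightarrow> Df (\<lambda>s. card_less (a s) (b s))"
  by (rule Df_2[where P = card_less], unfold card_less_def) (intro df)

lemma Cl_Pk [df]: "Tm \<kappa> \<Longrightarrow> Tm X \<Longrightarrow> Cl (\<lambda>s. Pk (\<kappa> s) (X s))"
  unfolding Pk_def by (intro df Tm_shift)

lemma bijection_iff:
  "bijection f a b \<longleftrightarrow> function_on f (elts a) \<and> bij_betw (app f) (elts a) (elts b)"
proof (cases "function_on f (elts a)")
  case True
  have r: "related f x y \<longleftrightarrow> x \<epsilon> a \<and> app f x = y" for x y
    using function_on_unique[OF True] by auto
  have 1: "function_from_to f a b \<longleftrightarrow> (\<forall>x. x \<epsilon> a \<longrightarrow> app f x \<epsilon> b)"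
    using True by (simp add: function_from_to_def r)
  have 2: "bijection f a b \<longleftrightarrow>
      (\<forall>x. x \<epsilon> a \<longrightarrow> app f x \<epsilon> b) \<and> (\<forall>y. y \<epsilon> b \<longrightarrow> (\<exists>!x. x \<epsilon> a \<and> app f x = y))"
    unfolding bijection_def 1 by (simp add: r)
  have "bij_betw (app f) (elts a) (elts b) \<longleftrightarrow> bijection f a b"
  proof
    assume "bij_betw (app f) (elts a) (elts b)"
    then have inj: "inj_on (app f) (elts a)" and im: "app f ` elts a = elts b"
      by (simp_all add: bij_betw_def)
    have "\<exists>!x. x \<epsilon> a \<and> app f x = y" if "y \<epsilon> b" for y
    proof -
      have "y \<in> app f ` elts a" using that im by simp
      then obtain x where "x \<epsilon> a" "app f x = y" by auto
      then show ?thesis using inj_onD[OF inj] by (intro ex1I[of _ x]) auto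
    qed
    moreover have "app f x \<epsilon> b" if "x \<epsilon> a" for x
      using that im by (metis image_eqI mem_elts)
    ultimately show "bijection f a b" unfolding 2 by blast
  next
    assume "bijection f a b"
    note * = this[unfolded 2]
    have i: "app f x \<epsilon> b" if "x \<epsilon> a" for x using * that by blast
    have j: "\<exists>x. x \<epsilon> a \<and> app f x = y" if "y \<epsilon> b" for y using * that by blast
    have "inj_on (app f) (elts a)"
      by (rule inj_onI) (use * in \<open>unfold mem_elts, metis\<close>)
    moreover have "app f ` elts a = elts b"
    proof (intro set_eqI iffI)
      fix y assume "y \<in> elts b"
      then obtain x where "x \<epsilon> a" "app f x = y" using j by auto
      then show "y \<in> app f ` elts a" by auto
    qed (use i in auto)
    ultimately show "bij_betw (app f) (elts a) (elts b)" by (simp add: bij_betw_def)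
  qed
  then show ?thesis using True by simp
qed (simp add: bijection_def function_from_to_def)

text \<open>By replacement, a HOL bijection given by a definable term is the graph of a bijection
  inside the model.\<close>

lemma equipotentI:
  assumes "Tm (\<lambda>s. H (s 0))" "bij_betw H (elts a) (elts b)"
  shows "equipotent a b"
proof -
  have "bij_betw (app (vlam a H)) (elts a) (elts b)"
    using assms(2) by (subst bij_betw_cong[where g = H]) (auto simp: app_vlam[OF assms(1)])
  then have "bijection (vlam a H) a b"
    by (simp add: bijection_iff function_on_vlam[OF assms(1)])
  then show ?thesis unfolding equipotent_def by blast
qed

lemma equipotentE:
  assumes "equipotent a b"
  obtains f where "bij_betw (app f) (elts a) (elts b)"
  using assms unfolding equipotent_def bijection_iff by blast

text \<open>HOL's \<open>inv_into\<close> is not known to be definable, whereas the description of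
  the preimage is.\<close>

definition vinv :: "'v \<Rightarrow> 'v \<Rightarrow> 'v \<Rightarrow> 'v" where
  "vinv f a y = the1 (\<lambda>x. x \<epsilon> a \<and> app f x = y)"

lemma Tm_vinv [df]: "Tm f \<Longrightarrow> Tm a \<Longrightarrow> Tm y \<Longrightarrow> Tm (\<lambda>s. vinv (f s) (a s) (y s))"
  by (rule Tm_3[where F = vinv], unfold vinv_def) (intro df)

lemma vinv_app:
  assumes "inj_on (app f) (elts a)" "x \<epsilon> a"
  shows "vinv f a (app f x) = x"
  unfolding vinv_def by (rule the1_equality) (use assms in \<open>auto dest: inj_onD\<close>)

lemma bij_betw_vinv:
  assumes "bij_betw (app f) (elts a) (elts b)"
  shows "bij_betw (vinv f a) (elts b) (elts a)"
proof -
  have inj: "inj_on (app f) (elts a)" and im: "elts b = app f ` elts a"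
    using assms by (simp_all add: bij_betw_def)
  have v: "vinv f a (app f x) = x" if "x \<in> elts a" for x
    using vinv_app[OF inj] that by simp
  show ?thesis
    by (rule bij_betw_byWitness[where f' = "app f"]) (use v in \<open>auto simp: im simp del: mem_elts\<close>)
qed

lemma equipotent_refl: "equipotent a a"
  by (rule equipotentI[of "\<lambda>x. x"]) (auto simp: bij_betw_def intro: df)

lemma equipotent_sym:
  assumes "equipotent a b"
  shows "equipotent b a"
proof -
  obtain f where f: "bij_betw (app f) (elts a) (elts b)" using assms by (rule equipotentE)
  show ?thesis by (rule equipotentI[OF _ bij_betw_vinv[OF f]]) (intro df)
qed

lemma equipotent_trans:
  assumes "equipotent a b" "equipotent b c"
  shows "equipotent a c"
proof -
  obtain f where f: "bij_betw (app f) (elts a) (elts b)" using assms(1) by (rule equipotentE)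
  obtain g where g: "bij_betw (app g) (elts b) (elts c)" using assms(2) by (rule equipotentE)
  have "bij_betw (\<lambda>x. app g (app f x)) (elts a) (elts c)"
    using bij_betw_trans[OF f g] by (simp add: o_def)
  then show ?thesis by (rule equipotentI[rotated]) (intro df)
qed

lemma ex_cardinal_le:
  assumes "ordinal \<alpha>"
  shows "\<exists>\<mu>. (\<mu> \<epsilon> \<alpha> \<or> \<mu> = \<alpha>) \<and> cardinal \<mu> \<and> equipotent \<alpha> \<mu>"
proof -
  have "\<exists>\<mu>. (\<mu> \<epsilon> \<alpha> \<or> \<mu> = \<alpha>) \<and> equipotent \<alpha> \<mu> \<and> (\<forall>\<gamma>. \<gamma> \<epsilon> \<mu> \<longrightarrow> \<not> equipotent \<alpha> \<gamma>)"
    by (rule ordinal_least) (auto intro: df assms equipotent_refl)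
  then show ?thesis
    unfolding cardinal_def using assms ordinal_elem equipotent_sym equipotent_trans
    by (metis mem_elts)
qed

lemma card_less_ordinal:
  assumes "ordinal \<kappa>" "\<alpha> \<epsilon> \<kappa>"
  shows "card_less \<alpha> \<kappa>"
  using ex_cardinal_le[OF ordinal_elem[OF assms]] assms ordinal_trans
  unfolding card_less_def by auto

lemma card_less_mono:
  assumes "ordinal \<kappa>" "\<mu> \<epsilon> \<kappa>" "card_less a \<mu>"
  shows "card_less a \<kappa>"
  using assms ordinal_trans unfolding card_less_def by auto

text \<open>The order type of \<open>T \<inter> \<alpha>\<close>.\<close>

definition collapse :: "'v \<Rightarrow> 'v \<Rightarrow> 'v" where
  "collapse T = recur (\<lambda>f. Repl (Sep (dom f) (\<lambda>\<gamma>. \<gamma> \<epsilon> T)) (app f))"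

lemma Tm_collapse [df]: "Tm a \<Longrightarrow> Tm (\<lambda>s. collapse T (a s))"
  unfolding collapse_def by (intro Tm_recur df)

lemma mem_collapse:
  assumes "ordinal \<alpha>"
  shows "x \<epsilon> collapse T \<alpha> \<longleftrightarrow> (\<exists>\<gamma>. \<gamma> \<epsilon> \<alpha> \<and> \<gamma> \<epsilon> T \<and> x = collapse T \<gamma>)"
proof -
  have *: "Tm (\<lambda>s. Repl (Sep (dom (s 0)) (\<lambda>\<gamma>. \<gamma> \<epsilon> T)) (app (s 0)))" by (intro df)
  have T: "Tm (\<lambda>s. collapse T (s 0))" by (intro df)
  have S: "x \<epsilon> Sep a (\<lambda>\<gamma>. \<gamma> \<epsilon> T) \<longleftrightarrow> x \<epsilon> a \<and> x \<epsilon> T" for x a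
    by (rule mem_Sep) (intro df)
  have "collapse T \<alpha> = Repl (Sep (dom (vlam \<alpha> (collapse T))) (\<lambda>\<gamma>. \<gamma> \<epsilon> T)) (app (vlam \<alpha> (collapse T)))"
    unfolding collapse_def by (rule recur_eq[OF * assms])
  then show ?thesis by (auto simp: mem_Repl T S app_vlam[OF T])
qed

text \<open>By induction the values at elements of \<open>\<alpha>\<close> are at most their
  arguments, so they form a subset of \<open>\<alpha>\<close>; it is transitive, and
  \<open>ordinal_subset\<close> applies.\<close>

lemma collapse_le:
  assumes "ordinal \<alpha>"
  shows "collapse T \<alpha> = \<alpha> \<or> collapse T \<alpha> \<epsilon> \<alpha>"
proof (rule ordinal_induct[OF _ assms])
  show "Df (\<lambda>s. collapse T (s 0) = s 0 \<or> collapse T (s 0) \<epsilon> s 0)" by (intro df)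
  fix \<alpha> assume o: "ordinal \<alpha>"
    and IH: "\<And>\<beta>. \<beta> \<epsilon> \<alpha> \<Longrightarrow> collapse T \<beta> = \<beta> \<or> collapse T \<beta> \<epsilon> \<beta>"
  note m = mem_collapse[OF o] mem_collapse[OF ordinal_elem[OF o]]
  show "collapse T \<alpha> = \<alpha> \<or> collapse T \<alpha> \<epsilon> \<alpha>"
  proof (rule ordinal_subset[OF o])
    show "x \<epsilon> \<alpha>" if "x \<epsilon> collapse T \<alpha>" for x using that m(1) IH o ordinal_trans by metis
    show "y \<epsilon> collapse T \<alpha>" if "x \<epsilon> collapse T \<alpha>" "y \<epsilon> x" for x y
      using that m o ordinal_trans by metis
  qed
qed

text \<open>A cardinal \<open>\<mu>\<close> below \<open>\<kappa>\<close> indexes a set covering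
  \<open>b\<close>. Taking least indices, and then the order type of the set of these, gives a
  bijection of \<open>b\<close> with an ordinal \<open>\<eta>\<close> at most \<open>\<mu>\<close>;
  a cardinal equipotent with \<open>\<eta>\<close> is below \<open>\<kappa>\<close>.\<close>

lemma card_less_image:
  assumes \<kappa>: "ordinal \<kappa>" and "card_less a \<kappa>" and F: "Tm (\<lambda>s. F (s 0))"
    and sub: "elts b \<subseteq> F ` elts a"
  shows "card_less b \<kappa>"
proof -
  obtain \<mu> h where mu: "\<mu> \<epsilon> \<kappa>" and h: "bij_betw (app h) (elts a) (elts \<mu>)"
    using assms(2) equipotentE unfolding card_less_def by (metis mem_elts)
  have o: "ordinal \<mu>" using \<kappa> mu ordinal_elem by blast
  define G where "G \<beta> = F (vinv h a \<beta>)" for \<beta>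
  have G: "Tm x \<Longrightarrow> Tm (\<lambda>s. G (x s))" for x unfolding G_def by (intro df Tm_1[OF F])
  have surj: "\<exists>\<beta>. \<beta> \<epsilon> \<mu> \<and> G \<beta> = y" if y: "y \<epsilon> b" for y
  proof -
    obtain x where x: "x \<epsilon> a" "y = F x" using sub y by auto
    then have "vinv h a (app h x) = x" using h vinv_app by (simp add: bij_betw_def)
    moreover have "app h x \<epsilon> \<mu>" using h x by (auto simp: bij_betw_def)
    ultimately show ?thesis using x unfolding G_def by metis
  qed
  define m where "m y = the1 (\<lambda>\<beta>. \<beta> \<epsilon> \<mu> \<and> G \<beta> = y \<and> (\<forall>\<gamma>. \<gamma> \<epsilon> \<beta> \<longrightarrow> G \<gamma> \<noteq> y))" for y
  have Tm_m: "Tm x \<Longrightarrow> Tm (\<lambda>s. m (x s))" for x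
    unfolding m_def by (intro df G Tm_shift)
  have m: "m y \<epsilon> \<mu> \<and> G (m y) = y" if y: "y \<epsilon> b" for y
  proof -
    obtain \<beta> where b: "\<beta> \<epsilon> \<mu>" "G \<beta> = y" using surj[OF y] by blast
    have "\<exists>\<gamma>. (\<gamma> \<epsilon> \<beta> \<or> \<gamma> = \<beta>) \<and> G \<gamma> = y \<and> (\<forall>\<delta>. \<delta> \<epsilon> \<gamma> \<longrightarrow> G \<delta> \<noteq> y)"
    proof (rule ordinal_least)
      show "Df (\<lambda>s. G (s 0) = y)" by (intro df G)
      show "ordinal \<beta>" by (rule ordinal_elem[OF o b(1)])
    qed fact
    then obtain \<gamma> where g: "\<gamma> \<epsilon> \<mu>" "G \<gamma> = y" "\<forall>\<delta>. \<delta> \<epsilon> \<gamma> \<longrightarrow> G \<delta> \<noteq> y"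
      using b o ordinal_trans by metis
    have "m y = \<gamma>"
      unfolding m_def
      by (rule the1_equality) (use g ordinal_linear o ordinal_elem in \<open>blast+\<close>)
    with g show ?thesis by simp
  qed
  define T where "T = Repl b m"
  have T: "z \<epsilon> T \<longleftrightarrow> (\<exists>y. y \<epsilon> b \<and> z = m y)" for z
    unfolding T_def by (rule mem_Repl) (intro Tm_m df)
  let ?c = "\<lambda>y. collapse T (m y)"
  define \<eta> where "\<eta> = collapse T \<mu>"
  have e: "\<eta> = \<mu> \<or> \<eta> \<epsilon> \<mu>" unfolding \<eta>_def by (rule collapse_le[OF o])
  have lt: "collapse T \<gamma> \<epsilon> collapse T \<delta>" if "\<gamma> \<epsilon> T" "\<delta> \<epsilon> \<mu>" "\<gamma> \<epsilon> \<delta>" for \<gamma> \<delta>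
    using that mem_collapse[OF ordinal_elem[OF o]] by blast
  have inj: "y = z" if y: "y \<epsilon> b" and z: "z \<epsilon> b" and eq: "?c y = ?c z" for y z
  proof -
    have "m y \<epsilon> m z \<or> m y = m z \<or> m z \<epsilon> m y"
      using m y z o ordinal_comparable by blast
    then have "m y = m z"
      using lt[of "m y" "m z"] lt[of "m z" "m y"] T m y z eq by auto
    then show ?thesis using m y z by metis
  qed
  have "x \<epsilon> \<eta> \<longleftrightarrow> (\<exists>y. y \<epsilon> b \<and> x = ?c y)" for x
    unfolding \<eta>_def mem_collapse[OF o] T using m by blast
  then have "bij_betw ?c (elts b) (elts \<eta>)"
    unfolding bij_betw_def inj_on_def using inj by (auto simp: set_eq_iff image_iff)
  then have "equipotent b \<eta>"
    by (rule equipotentI[rotated]) (intro df Tm_m)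
  moreover have eo: "\<eta> \<epsilon> \<kappa>" using e mu \<kappa> ordinal_trans by blast
  moreover obtain \<nu> where "\<nu> \<epsilon> \<eta> \<or> \<nu> = \<eta>" "cardinal \<nu>" "equipotent \<eta> \<nu>"
    using ex_cardinal_le[OF ordinal_elem[OF \<kappa> eo]] by blast
  ultimately show ?thesis
    unfolding card_less_def using equipotent_trans \<kappa> ordinal_trans by (metis mem_elts)
qed

lemma card_less_subset:
  assumes "ordinal \<kappa>" "card_less a \<kappa>" "\<And>x. x \<epsilon> b \<Longrightarrow> x \<epsilon> a"
  shows "card_less b \<kappa>"
  by (rule card_less_image[where F = "\<lambda>x. x", OF assms(1,2)]) (use assms(3) in \<open>auto intro: df\<close>)

lemma not_card_less_self:
  assumes "cardinal \<kappa>"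
  shows "\<not> card_less \<kappa> \<kappa>"
  using assms equipotent_sym unfolding card_less_def cardinal_def by auto

subsection \<open>Choice functions\<close>

text \<open>The axiom selects from disjoint families, so each nonempty subset \<open>x\<close> of
  \<open>b\<close> is replaced by the product of {x} with \<open>x\<close>; the selected pair then
  records the set for which it was chosen.\<close>

lemma ex_choice:
  "\<exists>c. \<forall>x. (\<forall>y. y \<epsilon> x \<longrightarrow> y \<epsilon> b) \<longrightarrow> (\<exists>y. y \<epsilon> x) \<longrightarrow> app c x \<epsilon> x"
proof -
  define N where "N = Sep (vpow b) (\<lambda>x. \<exists>y. y \<epsilon> x)"
  have N: "x \<epsilon> N \<longleftrightarrow> (\<forall>y. y \<epsilon> x \<longrightarrow> y \<epsilon> b) \<and> (\<exists>y. y \<epsilon> x)" for x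
    unfolding N_def by (subst mem_Sep) (intro df, simp)
  define a where "a = Repl N (\<lambda>x. cart (upair x x) x)"
  have a: "z \<epsilon> a \<longleftrightarrow> (\<exists>x. x \<epsilon> N \<and> z = cart (upair x x) x)" for z
    unfolding a_def by (rule mem_Repl) (intro df)
  obtain C where C: "\<And>x. x \<epsilon> a \<Longrightarrow> \<exists>!z. z \<epsilon> x \<and> z \<epsilon> C"
  proof -
    have "\<exists>z. z \<epsilon> x" if "x \<epsilon> a" for x
    proof -
      obtain u y where "x = cart (upair u u) u" "y \<epsilon> u" using \<open>x \<epsilon> a\<close> a N by blast
      then have "pr u y \<epsilon> x" by simp
      then show ?thesis ..
    qed
    moreover have "x = y" if "x \<epsilon> a" "y \<epsilon> a" "z \<epsilon> x" "z \<epsilon> y" for x y z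
      using that unfolding a by auto
    ultimately have "\<exists>c. \<forall>x. x \<epsilon> a \<longrightarrow> (\<exists>!z. z \<epsilon> x \<and> z \<epsilon> c)"
      using choice[of a] by blast
    with that show ?thesis by blast
  qed
  define c where "c = vlam N (\<lambda>x. the1 (\<lambda>y. y \<epsilon> x \<and> pr x y \<epsilon> C))"
  have "app c x \<epsilon> x" if x: "x \<epsilon> N" for x
  proof -
    have "\<exists>!z. z \<epsilon> cart (upair x x) x \<and> z \<epsilon> C" using C a x by blast
    then obtain z where z: "z \<epsilon> cart (upair x x) x" "z \<epsilon> C"
      and un: "\<And>w. w \<epsilon> cart (upair x x) x \<Longrightarrow> w \<epsilon> C \<Longrightarrow> w = z" by blast
    obtain y where y: "y \<epsilon> x" "z = pr x y" using z(1) by auto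
    have "\<exists>!y. y \<epsilon> x \<and> pr x y \<epsilon> C"
    proof (rule ex1I[of _ y])
      fix w assume "w \<epsilon> x \<and> pr x w \<epsilon> C"
      then have "pr x w = z" by (intro un) auto
      then show "w = y" by (simp add: y)
    qed (use y z in simp)
    from the1I[OF this] have "the1 (\<lambda>y. y \<epsilon> x \<and> pr x y \<epsilon> C) \<epsilon> x" by blast
    moreover have "app c x = the1 (\<lambda>y. y \<epsilon> x \<and> pr x y \<epsilon> C)"
      unfolding c_def by (rule app_vlam[OF _ x]) (intro df)
    ultimately show ?thesis by simp
  qed
  then show ?thesis using N by blast
qed

text \<open>The \<open>SOME\<close> is taken once, of a choice function that is an object of the
  model. This object is a fixed parameter, so \<open>pick b\<close> remains a definable
  term.\<close>

definition pick :: "'v \<Rightarrow> 'v \<Rightarrow> 'v" where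
  "pick b = app (SOME c. \<forall>x. (\<forall>y. y \<epsilon> x \<longrightarrow> y \<epsilon> b) \<longrightarrow> (\<exists>y. y \<epsilon> x) \<longrightarrow> app c x \<epsilon> x)"

lemma Tm_pick [df]: "Tm x \<Longrightarrow> Tm (\<lambda>s. pick b (x s))"
  unfolding pick_def by (intro df)

lemma pick_mem: "(\<And>y. y \<epsilon> x \<Longrightarrow> y \<epsilon> b) \<Longrightarrow> y \<epsilon> x \<Longrightarrow> pick b x \<epsilon> x"
  unfolding pick_def using someI_ex[OF ex_choice[of b]] by blast

lemma pick_Sep:
  assumes "Df (\<lambda>s. P (s 0))" "y \<epsilon> a" "P y" "\<And>y. y \<epsilon> a \<Longrightarrow> y \<epsilon> b"
  shows "pick b (Sep a P) \<epsilon> a \<and> P (pick b (Sep a P))"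
proof -
  have "pick b (Sep a P) \<epsilon> Sep a P"
    by (rule pick_mem[of _ _ y]) (use assms in \<open>auto simp: mem_Sep\<close>)
  then show ?thesis by (simp add: mem_Sep assms(1))
qed

lemma pick_SepD:
  assumes "c = pick a (Sep a P)" "Df (\<lambda>s. P (s 0))" "y \<epsilon> a" "P y"
  shows "c \<epsilon> a" "P c"
  using pick_Sep[OF assms(2-4)] assms(1) by blast+

subsection \<open>Ultrafilter quantifiers\<close>

text \<open>The ground set of the ultrafilter \<open>U\<close> is its largest element \<open>\<Union>U\<close>.\<close>

definition most :: "'v \<Rightarrow> ('v \<Rightarrow> bool) \<Rightarrow> bool" where
  "most U Q \<longleftrightarrow> Sep (vunion U) Q \<epsilon> U"

lemma Df_most [df]:
  "Tm U \<Longrightarrow> Df (\<lambda>s. Q (s 0) (\<lambda>n. s (Suc n))) \<Longrightarrow> Df (\<lambda>s. most (U s) (\<lambda>A. Q A s))"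
  unfolding most_def by (intro df)

context
  fixes P U assumes U: "ultrafilter_on P U"
begin

lemma ultrafilter_onD:
  shows "\<forall>A\<in>elts U. elts A \<subseteq> P" "\<exists>A\<in>elts U. elts A = P" "\<forall>A\<in>elts U. elts A \<noteq> {}"
    "\<forall>A\<in>elts U. \<forall>B\<in>UNIV. elts A \<subseteq> elts B \<and> elts B \<subseteq> P \<longrightarrow> B \<in> elts U"
    "\<forall>A\<in>elts U. \<forall>B\<in>elts U. \<exists>C\<in>elts U. elts C = elts A \<inter> elts B"
    "\<forall>A\<in>UNIV. elts A \<subseteq> P \<longrightarrow> A \<in> elts U \<or> (\<exists>B\<in>elts U. elts B = P - elts A)"
  using U unfolding ultrafilter_on_def by argo+

lemma ultrafilter_in_ground:
  assumes "B \<epsilon> U" "A \<epsilon> B" shows "A \<in> P"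
  using bspec[OF ultrafilter_onD(1), of B] assms by (auto simp: subset_iff)

lemma ultrafilter_ex_ground: "\<exists>B. B \<epsilon> U \<and> elts B = P"
  using ultrafilter_onD(2) by simp

lemma ultrafilter_ground: "x \<epsilon> vunion U \<longleftrightarrow> x \<in> P"
proof
  assume "x \<in> P"
  moreover obtain B where "B \<epsilon> U" "elts B = P" using ultrafilter_ex_ground by blast
  ultimately show "x \<epsilon> vunion U" by auto
qed (auto intro: ultrafilter_in_ground)

lemma ultrafilter_superset:
  assumes "B \<epsilon> U" "\<And>A. A \<epsilon> B \<Longrightarrow> A \<epsilon> C" "\<And>A. A \<epsilon> C \<Longrightarrow> A \<in> P"
  shows "C \<epsilon> U"
proof -
  have "elts B \<subseteq> elts C" "elts C \<subseteq> P" using assms(2,3) by auto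
  then have "C \<in> elts U" using bspec[OF bspec[OF ultrafilter_onD(4), of B], of C] assms(1) by simp
  then show ?thesis by simp
qed

lemma ultrafilter_inter:
  assumes "A \<epsilon> U" "B \<epsilon> U" shows "\<exists>C. C \<epsilon> U \<and> elts C = elts A \<inter> elts B"
  using bspec[OF bspec[OF ultrafilter_onD(5), of A], of B] assms by simp

lemma ultrafilter_diff:
  assumes "elts A \<subseteq> P" "\<not> A \<epsilon> U" shows "\<exists>B. B \<epsilon> U \<and> elts B = P - elts A"
  using bspec[OF ultrafilter_onD(6), of A] assms by simp

lemma ultrafilter_nonempty:
  assumes "B \<epsilon> U" shows "elts B \<noteq> {}"
  using bspec[OF ultrafilter_onD(3), of B] assms by simp

lemma mem_Sep_ground: "Df (\<lambda>s. Q (s 0)) \<Longrightarrow> x \<epsilon> Sep (vunion U) Q \<longleftrightarrow> x \<in> P \<and> Q x"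
  using mem_Sep[of Q x "vunion U"] ultrafilter_ground by blast

lemma mostI:
  assumes "Df (\<lambda>s. Q (s 0))" "B \<epsilon> U" "\<And>A. A \<epsilon> B \<Longrightarrow> Q A"
  shows "most U Q"
  unfolding most_def
  by (rule ultrafilter_superset[OF assms(2)])
    (use assms ultrafilter_in_ground mem_Sep_ground in blast)+

lemma most_mono:
  assumes "most U Q" "\<And>A. A \<in> P \<Longrightarrow> Q A \<Longrightarrow> R A" "Df (\<lambda>s. Q (s 0))" "Df (\<lambda>s. R (s 0))"
  shows "most U R"
  by (rule mostI[OF assms(4) assms(1)[unfolded most_def]])
    (use assms(2,3) mem_Sep_ground in blast)

lemma most_always:
  assumes "Df (\<lambda>s. Q (s 0))" "\<And>A. A \<in> P \<Longrightarrow> Q A"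
  shows "most U Q"
proof -
  obtain B where "B \<epsilon> U" using ultrafilter_ex_ground by blast
  then show ?thesis by (rule mostI[OF assms(1)]) (use assms(2) ultrafilter_in_ground \<open>B \<epsilon> U\<close> in blast)
qed

lemma most_conj:
  assumes "most U Q" "most U R" "Df (\<lambda>s. Q (s 0))" "Df (\<lambda>s. R (s 0))"
  shows "most U (\<lambda>A. Q A \<and> R A)"
proof -
  obtain C where "C \<epsilon> U" "elts C = elts (Sep (vunion U) Q) \<inter> elts (Sep (vunion U) R)"
    using ultrafilter_inter assms(1,2) unfolding most_def by blast
  then show ?thesis
    by (intro mostI[of "\<lambda>A. Q A \<and> R A" C])
      (use assms(3,4) in \<open>auto simp: set_eq_iff mem_Sep_ground intro: df\<close>)
qed

lemma most_mp:
  assumes "most U Q" "most U R" "\<And>A. A \<in> P \<Longrightarrow> Q A \<Longrightarrow> R A \<Longrightarrow> S A"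
    "Df (\<lambda>s. Q (s 0))" "Df (\<lambda>s. R (s 0))" "Df (\<lambda>s. S (s 0))"
  shows "most U S"
  by (rule most_mono[OF most_conj[OF assms(1,2,4,5)]]) (use assms in \<open>auto intro: df\<close>)

lemma most_ex:
  assumes "most U Q" "Df (\<lambda>s. Q (s 0))"
  shows "\<exists>A\<in>P. Q A"
proof -
  have "elts (Sep (vunion U) Q) \<noteq> {}"
    using ultrafilter_nonempty assms(1) unfolding most_def by blast
  then show ?thesis using mem_Sep_ground[OF assms(2)] by (auto simp: set_eq_iff)
qed

lemma most_not:
  assumes "\<not> most U Q" "Df (\<lambda>s. Q (s 0))"
  shows "most U (\<lambda>A. \<not> Q A)"
proof -
  let ?A = "Sep (vunion U) Q"
  have "elts ?A \<subseteq> P" using mem_Sep_ground[OF assms(2)] by auto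
  then obtain B where "B \<epsilon> U" "elts B = P - elts ?A"
    using ultrafilter_diff assms(1) unfolding most_def by blast
  then show ?thesis
    by (intro mostI[of "\<lambda>A. \<not> Q A" B])
      (use assms(2) in \<open>auto simp: set_eq_iff mem_Sep_ground intro: df\<close>)
qed

text \<open>This is completeness in quantifier form. The sets \<open>Sep (vunion U) (Q z)\<close>
  form an image of \<open>I\<close>, so there are fewer than \<open>\<kappa>\<close> of them by
  \<open>card_less_image\<close>.\<close>

lemma most_all:
  assumes "complete \<kappa> U" "ordinal \<kappa>" "card_less I \<kappa>" and Q: "Df (\<lambda>s. Q (s 0) (s 1))"
    and m: "\<And>z. z \<epsilon> I \<Longrightarrow> most U (Q z)"
  shows "most U (\<lambda>A. \<forall>z. z \<epsilon> I \<longrightarrow> Q z A)"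
proof -
  note [df] = Df_2[where P = Q, OF Q]
  have D: "Df (\<lambda>s. \<forall>z. z \<epsilon> I \<longrightarrow> Q z (s 0))" "\<And>z. Df (\<lambda>s. Q z (s 0))"
    "Tm (\<lambda>s. Sep (vunion U) (Q (s 0)))" by (intro df)+
  show ?thesis
  proof (cases "\<exists>z. z \<epsilon> I")
    \<comment> \<open>\<open>complete\<close> speaks of nonempty families, so the empty index set is
      treated apart.\<close>
    case False
    then show ?thesis by (intro most_always D) blast
  next
    case True
    define F where "F = Repl I (\<lambda>z. Sep (vunion U) (Q z))"
    have F: "B \<epsilon> F \<longleftrightarrow> (\<exists>z. z \<epsilon> I \<and> B = Sep (vunion U) (Q z))" for B
      unfolding F_def by (rule mem_Repl[OF D(3)])
    have "card_less F \<kappa>"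
      by (rule card_less_image[OF assms(2,3) D(3)]) (auto simp: F)
    moreover have "elts F \<subseteq> elts U" "elts F \<noteq> {}"
      using True m F by (auto simp: most_def set_eq_iff)
    ultimately obtain B where B: "B \<in> elts U" "elts B = (\<Inter>A\<in>elts F. elts A)"
      using bspec[OF assms(1)[unfolded complete_def] UNIV_I, of F] by blast
    have "Q z A" if "A \<epsilon> B" "z \<epsilon> I" for z A
    proof -
      have "A \<in> elts B" "Sep (vunion U) (Q z) \<in> elts F" using that F by auto
      then have "A \<epsilon> Sep (vunion U) (Q z)" unfolding B(2) by auto
      then show ?thesis using mem_Sep_ground[OF D(2)] by blast
    qed
    then show ?thesis using B(1) by (intro mostI[OF D(1), of B]) auto
  qed
qed

text \<open>Normality acts as an exchange of quantifiers: a witness inside \<open>A\<close>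
  depending on \<open>A\<close> can be replaced by a fixed one. \<open>pick\<close> turns the
  existence of witnesses into a choice function that belongs to the model.\<close>

lemma most_normal:
  assumes "normal U" and R: "Df (\<lambda>s. R (s 0) (s 1))"
    and m: "most U (\<lambda>A. \<exists>z. z \<epsilon> A \<and> R A z)"
  shows "\<exists>c. most U (\<lambda>A. c \<epsilon> A \<and> R A c)"
proof -
  note [df] = Df_2[where P = R, OF R]
  \<comment> \<open>Every element of a set in the ground of \<open>U\<close> lies in
    \<open>b\<close>, so one choice function serves all \<open>A\<close>.\<close>
  define b where "b = vunion (vunion U)"
  define D where "D = Sep (vunion U) (\<lambda>A. \<exists>z. z \<epsilon> A \<and> R A z)"
  have D: "A \<epsilon> D \<longleftrightarrow> A \<in> P \<and> (\<exists>z. z \<epsilon> A \<and> R A z)" for A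
    unfolding D_def by (rule mem_Sep_ground) (intro df)
  define F where "F A = pick b (Sep A (R A))" for A
  have TF: "Tm (\<lambda>s. F (s 0))" unfolding F_def by (intro df)
  have F: "F A \<epsilon> A \<and> R A (F A)" if A: "A \<epsilon> D" for A
  proof -
    have *: "Df (\<lambda>s. R A (s 0))" by (intro df)
    obtain z where z: "z \<epsilon> A" "R A z" "A \<in> P" using A D by blast
    have "A \<epsilon> vunion U" using z(3) by (simp only: ultrafilter_ground)
    then have "y \<epsilon> b" if "y \<epsilon> A" for y
      using that unfolding b_def mem_vunion[of y "vunion U"] by blast
    from pick_Sep[OF * z(1,2) this] show ?thesis unfolding F_def .
  qed
  define f where "f = vlam D F"
  have fn: "function_on f (elts D)" unfolding f_def by (rule function_on_vlam[OF TF])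
  have r: "related f A y \<longleftrightarrow> A \<epsilon> D \<and> y = F A" for A y
    using function_on_unique[OF fn, of A y] by (auto simp: f_def app_vlam[OF TF])
  have "choice_function_on f D"
    unfolding choice_function_on_def using fn F by (auto simp: r)
  moreover have "D \<epsilon> U" using m unfolding D_def most_def .
  ultimately have "\<exists>B. B \<epsilon> U \<and> (\<exists>c. \<forall>A. A \<epsilon> B \<longrightarrow> related f A c)"
    using assms(1) by (simp add: normal_def)
  then obtain B c where B: "B \<epsilon> U" "\<And>A. A \<epsilon> B \<Longrightarrow> related f A c" by blast
  have "most U (\<lambda>A. c \<epsilon> A \<and> R A c)"
  proof (rule mostI[OF _ B(1)])
    show "Df (\<lambda>s. c \<epsilon> s 0 \<and> R (s 0) c)" by (intro df)
    fix A assume "A \<epsilon> B"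
    then have "A \<epsilon> D" "c = F A" using B(2) r by simp_all
    then show "c \<epsilon> A \<and> R A c" using F by simp
  qed
  then show ?thesis ..
qed

end

lemma most_fine:
  assumes U: "ultrafilter_on (Pk \<kappa> X) U" and "fine \<kappa> X U" "x \<epsilon> X"
  shows "most U (\<lambda>A. x \<epsilon> A)"
proof -
  obtain B where "B \<epsilon> U" "elts B = {A \<in> Pk \<kappa> X. x \<epsilon> A}"
    using assms(2,3) unfolding fine_def by auto
  then show ?thesis by (intro mostI[OF U _ \<open>B \<epsilon> U\<close>]) (auto simp: set_eq_iff intro: df)
qed

end

subsection \<open>Absoluteness for levels of the hierarchy\<close>

text \<open>These closure properties of a limit level carry the absoluteness proofs. Closure under
  subsets is the strong one: all subsets of a set of the level, and with products all bijections
  between two such sets, belong to the level.\<close>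

locale zfc_level = zfc_model mem for mem :: "'v \<Rightarrow> 'v \<Rightarrow> bool" (infix "\<epsilon>" 50) +
  fixes M :: 'v
  assumes M_trans: "x \<epsilon> M \<Longrightarrow> y \<epsilon> x \<Longrightarrow> y \<epsilon> M"
    and M_subset: "x \<epsilon> M \<Longrightarrow> (\<And>y. y \<epsilon> z \<Longrightarrow> y \<epsilon> x) \<Longrightarrow> z \<epsilon> M"
    and M_upair: "x \<epsilon> M \<Longrightarrow> y \<epsilon> M \<Longrightarrow> upair x y \<epsilon> M"
    and M_cart: "x \<epsilon> M \<Longrightarrow> y \<epsilon> M \<Longrightarrow> cart x y \<epsilon> M"
begin

lemma M_subset':
  assumes "x \<epsilon> M" "elts z \<subseteq> elts x" shows "z \<epsilon> M"
  by (rule M_subset[OF assms(1)]) (use assms(2) in auto)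

sublocale L: set_structure "elts M" mem .

lemma L_elts: "(\<And>x. x \<epsilon> a \<Longrightarrow> x \<epsilon> M) \<Longrightarrow> L.elts a = elts a"
  by (auto simp: L.elts_def)

lemma L_elts_M [simp]: "a \<epsilon> M \<Longrightarrow> L.elts a = elts a"
  by (rule L_elts) (rule M_trans)

lemma pr_in_M: "pr x y \<epsilon> M \<longleftrightarrow> x \<epsilon> M \<and> y \<epsilon> M"
proof
  assume *: "pr x y \<epsilon> M"
  have "upair x y \<epsilon> M" by (rule M_trans[OF *]) (simp add: pr_def)
  from M_trans[OF this] show "x \<epsilon> M \<and> y \<epsilon> M" by simp
qed (auto simp: pr_def intro: M_upair)

lemma L_opair:
  assumes "p \<epsilon> M"
  shows "L.opair p x y \<longleftrightarrow> opair p x y"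
proof
  assume "L.opair p x y"
  then obtain s d where "s \<epsilon> M" "d \<epsilon> M" "L.elts s = {x}" "L.elts d = {x, y}" "L.elts p = {s, d}"
    unfolding L.opair_def by auto
  then show "opair p x y"
    unfolding opair_def using assms by (intro bexI[of _ s] bexI[of _ d]) simp_all
next
  assume "opair p x y"
  then obtain s d where *: "elts s = {x}" "elts d = {x, y}" "elts p = {s, d}"
    unfolding opair_def by auto
  then have "s \<in> elts p" "d \<in> elts p" by simp_all
  then have "s \<epsilon> M" "d \<epsilon> M" using M_trans[OF assms] by simp_all
  then show "L.opair p x y"
    unfolding L.opair_def using assms * by (intro bexI[of _ s] bexI[of _ d]) simp_all
qed

text \<open>The hypothesis concerns the elements of \<open>r\<close> and not \<open>r\<close>,
  because the sequence of graphs in SWVP is a class, a subset of \<open>M\<close> that need not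
  belong to \<open>M\<close>.\<close>

lemma L_related:
  assumes "\<And>p. p \<epsilon> r \<Longrightarrow> p \<epsilon> M"
  shows "L.related r x y \<longleftrightarrow> related r x y"
  unfolding L.related_def related_def using assms by (auto simp: L_elts L_opair)

lemma L_related_M [simp]: "r \<epsilon> M \<Longrightarrow> L.related r x y \<longleftrightarrow> related r x y"
  by (rule L_related) (rule M_trans)

lemma related_in_M: "r \<epsilon> M \<Longrightarrow> related r x y \<Longrightarrow> x \<epsilon> M \<and> y \<epsilon> M"
  using M_trans unfolding related_iff pr_in_M[symmetric] .

lemma L_function_on:
  assumes "\<And>p. p \<epsilon> f \<Longrightarrow> p \<epsilon> M"
  shows "L.function_on f D \<longleftrightarrow> function_on f D"
proof -
  have 1: "y \<epsilon> M" if "related f x y" for x y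
    using assms that unfolding related_iff using pr_in_M by blast
  have 2: "opair p x y \<Longrightarrow> p \<epsilon> f \<Longrightarrow> y \<epsilon> M" for p x y
    using assms unfolding opair_iff using pr_in_M by blast
  have "(\<exists>!y. y \<epsilon> M \<and> related f x y) \<longleftrightarrow> (\<exists>!y. related f x y)" for x
    using 1 by blast
  moreover have "(\<exists>x\<in>D. \<exists>y. y \<epsilon> M \<and> L.opair p x y) \<longleftrightarrow> (\<exists>x\<in>D. \<exists>y. opair p x y)" if "p \<epsilon> f" for p
    using L_opair[OF assms[OF that]] 2 that by blast
  moreover have "L.elts f = elts f" by (rule L_elts) (rule assms)
  moreover have "L.related f x y \<longleftrightarrow> related f x y" for x y by (rule L_related) (rule assms)
  ultimately show ?thesis
    unfolding L.function_on_def function_on_def by simp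
qed

lemma L_function_on_M [simp]: "f \<epsilon> M \<Longrightarrow> L.function_on f D \<longleftrightarrow> function_on f D"
  by (rule L_function_on) (rule M_trans)

lemma L_function_from_to [simp]:
  assumes "f \<epsilon> M" "a \<epsilon> M" "b \<epsilon> M"
  shows "L.function_from_to f a b \<longleftrightarrow> function_from_to f a b"
  unfolding L.function_from_to_def function_from_to_def
  using assms related_in_M[OF assms(1)] by simp blast

lemma L_bijection [simp]:
  assumes "f \<epsilon> M" "a \<epsilon> M" "b \<epsilon> M"
  shows "L.bijection f a b \<longleftrightarrow> bijection f a b"
  unfolding L.bijection_def bijection_def using assms by simp

text \<open>A bijection is a subset of the product, hence a set of the level. This makes equipotence
  absolute, and with it cardinals and \<open>card_less\<close>.\<close>

lemma bijection_in_M: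
  assumes "a \<epsilon> M" "b \<epsilon> M" "bijection f a b"
  shows "f \<epsilon> M"
proof (rule M_subset[OF M_cart[OF assms(1,2)]])
  fix p assume "p \<epsilon> f"
  then show "p \<epsilon> cart a b"
    using assms(3) unfolding bijection_def function_from_to_def function_on_iff
    by (auto simp: related_iff)
qed

lemma L_equipotent [simp]:
  assumes "a \<epsilon> M" "b \<epsilon> M"
  shows "L.equipotent a b \<longleftrightarrow> equipotent a b"
proof -
  have "f \<epsilon> M \<and> L.bijection f a b \<longleftrightarrow> bijection f a b" for f
    using bijection_in_M[OF assms, of f] L_bijection[OF _ assms, of f] by blast
  then show ?thesis unfolding L.equipotent_def equipotent_def by simp
qed

lemma L_ordinal [simp]: "a \<epsilon> M \<Longrightarrow> L.ordinal a \<longleftrightarrow> ordinal a"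
  using M_trans[of a] unfolding L.ordinal_def ordinal_def by (simp add: subset_iff)

lemma L_limit_ordinal [simp]: "a \<epsilon> M \<Longrightarrow> L.limit_ordinal a \<longleftrightarrow> limit_ordinal a"
  unfolding L.limit_ordinal_def limit_ordinal_def by simp

lemma L_is_omega [simp]: "a \<epsilon> M \<Longrightarrow> L.is_omega a \<longleftrightarrow> is_omega a"
  using M_trans[of a] unfolding L.is_omega_def is_omega_def by simp

lemma L_cardinal [simp]: "a \<epsilon> M \<Longrightarrow> L.cardinal a \<longleftrightarrow> cardinal a"
  using M_trans[of a] unfolding L.cardinal_def cardinal_def by simp

lemma L_uncountable_cardinal [simp]: "a \<epsilon> M \<Longrightarrow> L.uncountable_cardinal a \<longleftrightarrow> uncountable_cardinal a"
  using M_trans[of a] unfolding L.uncountable_cardinal_def uncountable_cardinal_def by (simp cong: conj_cong)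

lemma L_card_less [simp]:
  assumes "a \<epsilon> M" "k \<epsilon> M"
  shows "L.card_less a k \<longleftrightarrow> card_less a k"
  unfolding L.card_less_def card_less_def using assms M_trans[OF assms(2)] by auto

lemma L_Pk:
  assumes "k \<epsilon> M" "X \<epsilon> M"
  shows "L.Pk k X = Pk k X"
proof -
  have "A \<in> L.Pk k X \<longleftrightarrow> A \<in> Pk k X" for A
    unfolding L.Pk_def Pk_def using assms M_subset'[OF assms(2), of A] by (cases "A \<epsilon> M") auto
  then show ?thesis by blast
qed

text \<open>The ground \<open>P\<close> is the extension of an element of \<open>U\<close>, thus of
  a set of the level, so all subsets of \<open>P\<close> are in the level; quantifiers over them
  range over the same sets in the universe.\<close>

lemma L_ultrafilter_on:
  assumes "U \<epsilon> M" "L.ultrafilter_on P U"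
  shows "ultrafilter_on P U"
proof -
  have U: "L.elts U = elts U" and A: "\<And>A. A \<epsilon> U \<Longrightarrow> L.elts A = elts A"
    using assms(1) M_trans[OF assms(1)] by simp_all
  have R: "\<forall>A\<in>elts U. L.elts A \<subseteq> P" "\<exists>A\<in>elts U. L.elts A = P" "\<forall>A\<in>elts U. L.elts A \<noteq> {}"
    "\<forall>A\<in>elts U. \<forall>B\<in>elts M. L.elts A \<subseteq> L.elts B \<and> L.elts B \<subseteq> P \<longrightarrow> B \<in> elts U"
    "\<forall>A\<in>elts U. \<forall>B\<in>elts U. \<exists>C\<in>elts U. L.elts C = L.elts A \<inter> L.elts B"
    "\<forall>A\<in>elts M. L.elts A \<subseteq> P \<longrightarrow> A \<in> elts U \<or> (\<exists>B\<in>elts U. L.elts B = P - L.elts A)"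
    using assms(2) unfolding L.ultrafilter_on_def U by argo+
  have m: "\<And>A. A \<epsilon> M \<Longrightarrow> L.elts A = elts A" by simp
  have D: "\<forall>A\<in>elts U. elts A \<subseteq> P" "\<exists>A\<in>elts U. elts A = P" "\<forall>A\<in>elts U. elts A \<noteq> {}"
    "\<forall>A\<in>elts U. \<forall>B\<in>elts M. elts A \<subseteq> elts B \<and> elts B \<subseteq> P \<longrightarrow> B \<in> elts U"
    "\<forall>A\<in>elts U. \<forall>B\<in>elts U. \<exists>C\<in>elts U. elts C = elts A \<inter> elts B"
    "\<forall>A\<in>elts M. elts A \<subseteq> P \<longrightarrow> A \<in> elts U \<or> (\<exists>B\<in>elts U. elts B = P - elts A)"
    using R(1) A apply simp
    using R(2) A apply auto[1]
    using R(3) A apply simp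
    using R(4) A m apply simp
    using R(5) A apply simp
    using R(6) A m apply simp
    done
  obtain G where G: "G \<epsilon> U" "elts G = P" using D(2) by auto
  have sub: "B \<in> elts M" if "elts B \<subseteq> P" for B
    using M_subset'[OF M_trans[OF assms(1) G(1)], of B] that G(2) by simp
  have 4: "\<forall>A\<in>elts U. \<forall>B\<in>UNIV. elts A \<subseteq> elts B \<and> elts B \<subseteq> P \<longrightarrow> B \<in> elts U"
  proof (intro ballI impI)
    fix A B assume "A \<in> elts U" "elts A \<subseteq> elts B \<and> elts B \<subseteq> P"
    then show "B \<in> elts U" using bspec[OF bspec[OF D(4), of A] sub[of B]] by simp
  qed
  have 6: "\<forall>A\<in>UNIV. elts A \<subseteq> P \<longrightarrow> A \<in> elts U \<or> (\<exists>B\<in>elts U. elts B = P - elts A)"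
  proof (intro ballI impI)
    fix A assume "elts A \<subseteq> P"
    then show "A \<in> elts U \<or> (\<exists>B\<in>elts U. elts B = P - elts A)"
      using bspec[OF D(6) sub[of A]] by blast
  qed
  show ?thesis unfolding ultrafilter_on_def by (intro conjI D(1-3) 4 D(5) 6)
qed

lemma L_fine:
  assumes "U \<epsilon> M" "k \<epsilon> M" "X \<epsilon> M" "L.fine k X U"
  shows "fine k X U"
  using assms M_trans[OF assms(1)] unfolding L.fine_def fine_def by (simp add: L_Pk)

lemma L_complete:
  assumes "U \<epsilon> M" "k \<epsilon> M" "L.complete k U"
  shows "complete k U"
  unfolding complete_def
proof (intro ballI impI)
  fix F assume F: "elts F \<subseteq> elts U \<and> elts F \<noteq> {} \<and> card_less F k"
  then have FM: "F \<epsilon> M" using M_subset'[OF assms(1), of F] by blast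
  have i: "L.elts A = elts A" if "A \<epsilon> F \<or> A \<epsilon> U" for A
    using that M_trans[OF FM] M_trans[OF assms(1)] by auto
  have "\<exists>B\<in>L.elts U. L.elts B = (\<Inter>A\<in>L.elts F. L.elts A)"
    using assms(3) F FM assms(1,2) unfolding L.complete_def by simp
  then show "\<exists>B\<in>elts U. elts B = (\<Inter>A\<in>elts F. elts A)"
    using assms(1) FM i by simp
qed

end

section \<open>Limit levels as transitive structures\<close>

context zfc_model
begin

lemma HV_upair:
  assumes "ordinal \<gamma>" "x \<epsilon> HV \<gamma>" "y \<epsilon> HV \<gamma>"
  shows "upair x y \<epsilon> HV (suc \<gamma>)"
  using assms by (auto simp: HV_suc)

lemma HV_common:
  assumes "ordinal \<kappa>" "\<And>\<alpha>. \<alpha> \<epsilon> \<kappa> \<Longrightarrow> suc \<alpha> \<epsilon> \<kappa>" "x \<epsilon> HV \<kappa>" "y \<epsilon> HV \<kappa>"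
  obtains \<gamma> where "\<gamma> \<epsilon> \<kappa>" "x \<epsilon> HV \<gamma>" "y \<epsilon> HV \<gamma>"
proof -
  have *: "\<exists>\<gamma>. \<gamma> \<epsilon> \<kappa> \<and> x \<epsilon> HV \<gamma>" if x: "x \<epsilon> HV \<kappa>" for x
  proof -
    obtain \<beta> where b: "\<beta> \<epsilon> \<kappa>" "\<forall>y. y \<epsilon> x \<longrightarrow> y \<epsilon> HV \<beta>" using x mem_HV[OF assms(1)] by blast
    then have "x \<epsilon> HV (suc \<beta>)" using HV_suc[OF ordinal_elem[OF assms(1) b(1)]] by simp
    with assms(2)[OF b(1)] show ?thesis by blast
  qed
  obtain \<beta> \<gamma> where bg: "\<beta> \<epsilon> \<kappa>" "x \<epsilon> HV \<beta>" "\<gamma> \<epsilon> \<kappa>" "y \<epsilon> HV \<gamma>" using * assms(3,4) by blast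
  then have "\<beta> \<epsilon> \<gamma> \<or> \<beta> = \<gamma> \<or> \<gamma> \<epsilon> \<beta>" using ordinal_comparable[OF assms(1)] by blast
  then show ?thesis
    using that bg HV_mono ordinal_elem[OF assms(1)] by metis
qed

lemma zfc_level_HV:
  assumes "ordinal \<kappa>" "\<And>\<alpha>. \<alpha> \<epsilon> \<kappa> \<Longrightarrow> suc \<alpha> \<epsilon> \<kappa>"
  shows "zfc_level mem (HV \<kappa>)"
proof unfold_locales
  show "y \<epsilon> HV \<kappa>" if "x \<epsilon> HV \<kappa>" "y \<epsilon> x" for x y
    using HV_trans[OF assms(1) that] .
  show "z \<epsilon> HV \<kappa>" if "x \<epsilon> HV \<kappa>" "\<And>y. y \<epsilon> z \<Longrightarrow> y \<epsilon> x" for x z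
    using HV_subset[OF assms(1) that] .
  fix x y assume "x \<epsilon> HV \<kappa>" "y \<epsilon> HV \<kappa>"
  from HV_common[OF assms this] obtain \<gamma> where g: "\<gamma> \<epsilon> \<kappa>" "x \<epsilon> HV \<gamma>" "y \<epsilon> HV \<gamma>" .
  have o: "ordinal \<gamma>" by (rule ordinal_elem[OF assms(1) g(1)])
  note o1 = ordinal_suc[OF o] note o2 = ordinal_suc[OF o1] note o3 = ordinal_suc[OF o2]
  \<comment> \<open>Three successors make room for the rank: pairs of elements of
    \<open>HV \<gamma>\<close> are in \<open>HV (suc (suc \<gamma>))\<close>, so the product is an
    element of the next level.\<close>
  have s: "suc \<gamma> \<epsilon> \<kappa>" "suc (suc \<gamma>) \<epsilon> \<kappa>" "suc (suc (suc \<gamma>)) \<epsilon> \<kappa>" using assms(2) g(1) by blast+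
  show "upair x y \<epsilon> HV \<kappa>"
    by (rule HV_mono[OF assms(1) s(1) HV_upair[OF o g(2,3)]])
  have "cart x y \<epsilon> HV (suc (suc (suc \<gamma>)))"
    unfolding HV_suc[OF o2] mem_vpow
  proof (intro allI impI)
    fix p assume "p \<epsilon> cart x y"
    then obtain u v where p: "p = pr u v" "u \<epsilon> x" "v \<epsilon> y" by auto
    then have "u \<epsilon> HV \<gamma>" "v \<epsilon> HV \<gamma>" using HV_trans[OF o] g by blast+
    then show "p \<epsilon> HV (suc (suc \<gamma>))" unfolding p(1) pr_def by (intro HV_upair o1 o)
  qed
  then show "cart x y \<epsilon> HV \<kappa>" by (rule HV_mono[OF assms(1) s(3)])
qed

subsection \<open>Limits of fine ultrafilters\<close>

lemma Df_ultrafilter_on: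
  assumes "Tm m" "Tm x" "Tm u"
  shows "Df (\<lambda>s. ultrafilter_on (Pk (m s) (x s)) (u s))"
  by (rule Df_3[where P = "\<lambda>m x u. ultrafilter_on (Pk m x) u", OF _ assms], unfold ultrafilter_on_def)
    (intro df)

lemma Df_fine: "Tm m \<Longrightarrow> Tm x \<Longrightarrow> Tm u \<Longrightarrow> Df (\<lambda>s. fine (m s) (x s) (u s))"
  by (rule Df_3[where P = fine], unfold fine_def) (intro df)

lemma Df_complete: "Tm m \<Longrightarrow> Tm u \<Longrightarrow> Df (\<lambda>s. complete (m s) (u s))"
  by (rule Df_2[where P = complete], unfold complete_def) (intro df)

definition fine_measure :: "'v \<Rightarrow> 'v \<Rightarrow> 'v \<Rightarrow> bool" where
  "fine_measure \<mu> X W \<longleftrightarrow> ultrafilter_on (Pk \<mu> X) W \<and> fine \<mu> X W \<and> complete \<mu> W"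

lemma Df_fine_measure [df]:
  "Tm m \<Longrightarrow> Tm x \<Longrightarrow> Tm u \<Longrightarrow> Df (\<lambda>s. fine_measure (m s) (x s) (u s))"
  unfolding fine_measure_def by (intro Df_conj Df_ultrafilter_on Df_fine Df_complete)

lemma Pk_iff: "A \<in> Pk \<kappa> X \<longleftrightarrow> (\<forall>x. x \<epsilon> A \<longrightarrow> x \<epsilon> X) \<and> card_less A \<kappa>"
  by (auto simp: Pk_def)

text \<open>
  The measure is the \<open>U\<close>-limit, over \<open>A \<in> P\<^sub>\<kappa>(X)\<close>, of measures on \<open>P\<^sub>\<mu>(A)\<close>; these are copied from
  a cardinal \<open>\<nu> < \<kappa>\<close> in bijection with \<open>A\<close>.
\<close>

lemma ex_fine_measure_limit:
  assumes \<kappa>: "ordinal \<kappa>" and mu: "\<mu> \<epsilon> \<kappa>" and U: "fine_measure \<kappa> X U"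
    and M: "\<And>\<nu>. \<nu> \<epsilon> \<kappa> \<Longrightarrow> \<exists>W. W \<epsilon> M \<and> fine_measure \<mu> \<nu> W"
  shows "\<exists>W. fine_measure \<mu> X W"
proof -
  have uU: "ultrafilter_on (Pk \<kappa> X) U" and fU: "fine \<kappa> X U" and cU: "complete \<kappa> U"
    using U by (auto simp: fine_measure_def)
  have om: "ordinal \<mu>" by (rule ordinal_elem[OF \<kappa> mu])
  \<comment> \<open>Measures are supplied only on ordinals \<open>\<nu>\<close> below
    \<open>\<kappa>\<close>, whence the bijections; as sets of pairs they all lie in
    \<open>vpow (cart \<kappa> X)\<close>, so \<open>pick\<close> can choose among them.\<close>
  define b where "b A = pick (vpow (cart \<kappa> X)) (Sep (vpow (cart \<kappa> X)) (\<lambda>b. \<exists>\<nu>. \<nu> \<epsilon> \<kappa> \<and> bijection b \<nu> A))" for A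
  \<comment> \<open>The measure belongs to the same \<open>\<nu>\<close> that is the domain of
    \<open>b A\<close>. The bounding set \<open>M\<close> provides the set from which
    \<open>pick\<close> chooses.\<close>
  define w where "w A = pick M (Sep M (\<lambda>W. \<exists>\<nu>. \<nu> \<epsilon> \<kappa> \<and> bijection (b A) \<nu> A \<and> fine_measure \<mu> \<nu> W))" for A
  have Tb [df]: "Tm x \<Longrightarrow> Tm (\<lambda>s. b (x s))" for x
    by (rule Tm_1[where F = b], unfold b_def) (intro df)
  have Tw [df]: "Tm x \<Longrightarrow> Tm (\<lambda>s. w (x s))" for x
    by (rule Tm_1[where F = w], unfold w_def) (intro df)
  have bw: "\<exists>\<nu>. \<nu> \<epsilon> \<kappa> \<and> bijection (b A) \<nu> A \<and> fine_measure \<mu> \<nu> (w A)" if A: "A \<in> Pk \<kappa> X" for A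
  proof -
    obtain \<nu> where n: "\<nu> \<epsilon> \<kappa>" and "equipotent A \<nu>"
      using A unfolding Pk_iff card_less_def by auto
    then obtain h where h: "bijection h \<nu> A"
      using equipotent_sym[of A \<nu>] unfolding equipotent_def by blast
    have "h \<epsilon> vpow (cart \<kappa> X)"
      unfolding mem_vpow
    proof (intro allI impI)
      fix p assume p: "p \<epsilon> h"
      then obtain x y where xy: "x \<epsilon> \<nu>" "p = pr x y"
        using h unfolding bijection_iff function_on_iff by auto
      then have "y \<epsilon> A" using h p unfolding bijection_def function_from_to_def related_iff by auto
      then show "p \<epsilon> cart \<kappa> X" using A xy n ordinal_trans[OF \<kappa>] unfolding Pk_iff by auto
    qed
    then have "\<exists>\<nu>. \<nu> \<epsilon> \<kappa> \<and> bijection (b A) \<nu> A"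
      by (rule pick_SepD(2)[OF b_def[of A], rotated]) (use n h in blast, (intro df)+)
    then obtain \<nu> where n: "\<nu> \<epsilon> \<kappa>" and bA: "bijection (b A) \<nu> A" by blast
    obtain W where W: "W \<epsilon> M" "fine_measure \<mu> \<nu> W" using M[OF n] by blast
    show ?thesis
      by (rule pick_SepD(2)[OF w_def[of A] _ W(1)]) (intro df, use n bA W in blast)
  qed
  define img where "img A a = Repl a (app (b A))" for A a
  have Ti [df]: "Tm x \<Longrightarrow> Tm y \<Longrightarrow> Tm (\<lambda>s. img (x s) (y s))" for x y
    by (rule Tm_2[where F = img], unfold img_def) (intro df)
  have img: "y \<epsilon> img A a \<longleftrightarrow> (\<exists>x. x \<epsilon> a \<and> y = app (b A) x)" for y A a
    unfolding img_def by (rule mem_Repl) (intro df)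
  have uw: "\<exists>\<nu>. \<nu> \<epsilon> \<kappa> \<and> bij_betw (app (b A)) (elts \<nu>) (elts A) \<and>
      ultrafilter_on (Pk \<mu> \<nu>) (w A) \<and> fine \<mu> \<nu> (w A) \<and> complete \<mu> (w A) \<and>
      (\<forall>a\<in>Pk \<mu> \<nu>. img A a \<in> Pk \<mu> X)" if A: "A \<in> Pk \<kappa> X" for A
  proof -
    obtain \<nu> where n: "\<nu> \<epsilon> \<kappa>" "bijection (b A) \<nu> A" "fine_measure \<mu> \<nu> (w A)" using bw[OF A] by blast
    have bij: "bij_betw (app (b A)) (elts \<nu>) (elts A)" using n(2) bijection_iff by blast
    have "img A a \<in> Pk \<mu> X" if a: "a \<in> Pk \<mu> \<nu>" for a
    proof -
      have "card_less (img A a) \<mu>"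
        by (rule card_less_image[OF om, of a "app (b A)"]) (use a in \<open>auto simp: Pk_iff img\<close>)
      moreover have "app (b A) x \<epsilon> X" if "x \<epsilon> a" for x
      proof -
        have "x \<in> elts \<nu>" using a that by (simp add: Pk_iff)
        then have "app (b A) x \<in> elts A" by (rule bij_betwE[OF bij, rule_format])
        then show ?thesis using A by (simp add: Pk_iff)
      qed
      ultimately show ?thesis by (auto simp: Pk_iff img)
    qed
    with n bij show ?thesis unfolding fine_measure_def by blast
  qed
  define P where "P = Sep (vpow X) (\<lambda>A. A \<in> Pk \<mu> X)"
  have P: "A \<epsilon> P \<longleftrightarrow> A \<in> Pk \<mu> X" for A
    unfolding P_def by (subst mem_Sep) (intro df, auto simp: Pk_iff)
  then have eP: "elts P = Pk \<mu> X" by auto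
  \<comment> \<open>\<open>\<Psi> Q A\<close> says that \<open>Q\<close> has measure one for the
    copy of \<open>w A\<close> on \<open>Pk \<mu> X\<close>, and \<open>\<Phi> Q\<close> below that
    this holds for almost all \<open>A\<close>. The properties of an ultrafilter then follow by
    applying the rules for \<open>most\<close> twice.\<close>
  define \<Psi> where "\<Psi> Q A \<longleftrightarrow> most (w A) (\<lambda>a. Q (img A a))" for Q A
  have D1: "Df (\<lambda>s. Q (img A (s 0)))" if t: "Df (\<lambda>s. Q (s 0))" for Q A
    by (rule Df_1[OF t]) (intro df)
  have D\<Psi>: "Df (\<lambda>s. \<Psi> Q (s 0))" if t: "Df (\<lambda>s. Q (s 0))" for Q
    unfolding \<Psi>_def by (intro df Df_1[OF t])
  have \<Psi>_mono: "\<Psi> R A" if t: "\<Psi> Q A" "A \<in> Pk \<kappa> X" "\<And>a. a \<in> Pk \<mu> X \<Longrightarrow> Q a \<Longrightarrow> R a"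
    "Df (\<lambda>s. Q (s 0))" "Df (\<lambda>s. R (s 0))" for Q R A
  proof -
    obtain \<nu> where n: "ultrafilter_on (Pk \<mu> \<nu>) (w A)" "\<forall>a\<in>Pk \<mu> \<nu>. img A a \<in> Pk \<mu> X"
      using uw[OF t(2)] by blast
    show ?thesis unfolding \<Psi>_def
      by (rule most_mono[OF n(1) t(1)[unfolded \<Psi>_def]]) (use t n(2) D1 in blast)+
  qed
  have \<Psi>_not: "\<Psi> (\<lambda>a. \<not> Q a) A" if t: "\<not> \<Psi> Q A" "A \<in> Pk \<kappa> X" "Df (\<lambda>s. Q (s 0))" for Q A
  proof -
    obtain \<nu> where n: "ultrafilter_on (Pk \<mu> \<nu>) (w A)" using uw[OF t(2)] by blast
    show ?thesis unfolding \<Psi>_def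
      by (rule most_not[OF n t(1)[unfolded \<Psi>_def] D1[OF t(3)]])
  qed
  have \<Psi>_conj: "\<Psi> (\<lambda>a. Q a \<and> R a) A" if t: "\<Psi> Q A" "\<Psi> R A" "A \<in> Pk \<kappa> X"
    "Df (\<lambda>s. Q (s 0))" "Df (\<lambda>s. R (s 0))" for Q R A
  proof -
    obtain \<nu> where n: "ultrafilter_on (Pk \<mu> \<nu>) (w A)" using uw[OF t(3)] by blast
    show ?thesis unfolding \<Psi>_def
      by (rule most_conj[OF n t(1,2)[unfolded \<Psi>_def] D1[OF t(4)] D1[OF t(5)]])
  qed
  have \<Psi>_always: "\<Psi> Q A" if t: "A \<in> Pk \<kappa> X" "\<And>a. a \<in> Pk \<mu> X \<Longrightarrow> Q a" "Df (\<lambda>s. Q (s 0))" for Q A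
  proof -
    obtain \<nu> where n: "ultrafilter_on (Pk \<mu> \<nu>) (w A)" "\<forall>a\<in>Pk \<mu> \<nu>. img A a \<in> Pk \<mu> X"
      using uw[OF t(1)] by blast
    show ?thesis unfolding \<Psi>_def
      by (rule most_always[OF n(1) D1[OF t(3)]]) (use t(2) n(2) in blast)
  qed
  have \<Psi>_ex: "\<exists>a. Q a" if t: "\<Psi> Q A" "A \<in> Pk \<kappa> X" "Df (\<lambda>s. Q (s 0))" for Q A
  proof -
    obtain \<nu> where n: "ultrafilter_on (Pk \<mu> \<nu>) (w A)" using uw[OF t(2)] by blast
    show ?thesis using most_ex[OF n t(1)[unfolded \<Psi>_def] D1[OF t(3)]] by blast
  qed
  define \<Phi> where "\<Phi> Q \<longleftrightarrow> most U (\<Psi> Q)" for Q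
  have \<Phi>_mono: "\<Phi> R" if t: "\<Phi> Q" "\<And>a. a \<in> Pk \<mu> X \<Longrightarrow> Q a \<Longrightarrow> R a"
    "Df (\<lambda>s. Q (s 0))" "Df (\<lambda>s. R (s 0))" for Q R
    unfolding \<Phi>_def
    by (rule most_mono[OF uU t(1)[unfolded \<Phi>_def]]) (use t \<Psi>_mono D\<Psi> in blast)+
  have \<Phi>_not: "\<Phi> (\<lambda>a. \<not> Q a)" if t: "\<not> \<Phi> Q" "Df (\<lambda>s. Q (s 0))" for Q
    unfolding \<Phi>_def
    by (rule most_mono[OF uU most_not[OF uU t(1)[unfolded \<Phi>_def] D\<Psi>[OF t(2)]]])
      (use \<Psi>_not t(2) in blast, (intro df D\<Psi> t(2))+)
  have \<Phi>_conj: "\<Phi> (\<lambda>a. Q a \<and> R a)" if t: "\<Phi> Q" "\<Phi> R" "Df (\<lambda>s. Q (s 0))" "Df (\<lambda>s. R (s 0))" for Q R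
    unfolding \<Phi>_def
    by (rule most_mp[OF uU t(1,2)[unfolded \<Phi>_def]])
      (use \<Psi>_conj t in blast, (intro df D\<Psi> t)+)
  have \<Phi>_always: "\<Phi> Q" if t: "\<And>a. a \<in> Pk \<mu> X \<Longrightarrow> Q a" "Df (\<lambda>s. Q (s 0))" for Q
    unfolding \<Phi>_def by (rule most_always[OF uU D\<Psi>[OF t(2)]]) (use t \<Psi>_always in blast)
  have \<Phi>_ex: "\<exists>a. Q a" if t: "\<Phi> Q" "Df (\<lambda>s. Q (s 0))" for Q
    using most_ex[OF uU t(1)[unfolded \<Phi>_def] D\<Psi>[OF t(2)]] \<Psi>_ex t(2) by blast
  have DB: "Df (\<lambda>s. s 0 \<epsilon> B)" for B by (intro df)
  define W where "W = Sep (vpow P) (\<lambda>B. \<Phi> (\<lambda>a. a \<epsilon> B))"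
  have W: "B \<epsilon> W \<longleftrightarrow> (\<forall>a. a \<epsilon> B \<longrightarrow> a \<in> Pk \<mu> X) \<and> \<Phi> (\<lambda>a. a \<epsilon> B)" for B
    unfolding W_def \<Phi>_def \<Psi>_def by (subst mem_Sep) (intro df, simp add: P)
  have "ultrafilter_on (Pk \<mu> X) W"
    unfolding ultrafilter_on_def
  proof (intro conjI ballI impI)
    show "elts A \<subseteq> Pk \<mu> X" if "A \<in> elts W" for A using that W by auto
    have "\<Phi> (\<lambda>a. a \<epsilon> P)" by (rule \<Phi>_always[OF _ DB]) (simp add: P)
    then have "P \<epsilon> W" unfolding W P by blast
    with eP show "\<exists>A\<in>elts W. elts A = Pk \<mu> X" by auto
    show "elts A \<noteq> {}" if "A \<in> elts W" for A
      using that W \<Phi>_ex[OF _ DB, of A] by auto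
  next
    fix A B assume "A \<in> elts W" and B: "elts A \<subseteq> elts B \<and> elts B \<subseteq> Pk \<mu> X"
    then have "\<Phi> (\<lambda>a. a \<epsilon> A)" using W by simp
    then have "\<Phi> (\<lambda>a. a \<epsilon> B)" by (rule \<Phi>_mono) (use B DB in auto)
    then show "B \<in> elts W" using B W by auto
  next
    fix A B assume "A \<in> elts W" "B \<in> elts W"
    then have AB: "A \<epsilon> W" "B \<epsilon> W" by simp_all
    define C where "C = Sep A (\<lambda>a. a \<epsilon> B)"
    have C: "a \<epsilon> C \<longleftrightarrow> a \<epsilon> A \<and> a \<epsilon> B" for a unfolding C_def by (rule mem_Sep[OF DB])
    have "\<Phi> (\<lambda>a. a \<epsilon> A \<and> a \<epsilon> B)" by (rule \<Phi>_conj) (use AB W DB in auto)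
    then have "C \<epsilon> W" using AB unfolding W C by blast
    then show "\<exists>C\<in>elts W. elts C = elts A \<inter> elts B" using C by (intro bexI[of _ C]) auto
  next
    fix A assume A: "elts A \<subseteq> Pk \<mu> X"
    show "A \<in> elts W \<or> (\<exists>B\<in>elts W. elts B = Pk \<mu> X - elts A)"
    proof (cases "A \<epsilon> W")
      case False
      then have "\<not> \<Phi> (\<lambda>a. a \<epsilon> A)" using A W by auto
      then have *: "\<Phi> (\<lambda>a. \<not> a \<epsilon> A)" by (rule \<Phi>_not[OF _ DB])
      define B where "B = Sep P (\<lambda>a. \<not> a \<epsilon> A)"
      have B: "a \<epsilon> B \<longleftrightarrow> a \<in> Pk \<mu> X \<and> \<not> a \<epsilon> A" for a
        unfolding B_def by (subst mem_Sep) (intro df, simp add: P)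
      have "\<Phi> (\<lambda>a. a \<epsilon> B)"
        by (rule \<Phi>_mono[OF *]) (use B in blast, (intro df)+)
      then have "B \<epsilon> W" unfolding W using B by blast
      then show ?thesis using B by (intro disjI2 bexI[of _ B]) auto
    qed simp
  qed
  moreover have "fine \<mu> X W"
    unfolding fine_def
  proof
    fix x assume "x \<in> elts X"
    then have x: "x \<epsilon> X" by simp
    \<comment> \<open>Almost every \<open>A\<close> contains \<open>x\<close>, by fineness of
      \<open>U\<close>; for such \<open>A\<close>, fineness of \<open>w A\<close> applies at the
      preimage of \<open>x\<close> under \<open>b A\<close>.\<close>
    have "\<Phi> (\<lambda>a. x \<epsilon> a)"
      unfolding \<Phi>_def
    proof (rule most_mono[OF uU most_fine[OF uU fU x]])
      fix A assume A: "A \<in> Pk \<kappa> X" "x \<epsilon> A"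
      obtain \<nu> where n: "bij_betw (app (b A)) (elts \<nu>) (elts A)"
        "ultrafilter_on (Pk \<mu> \<nu>) (w A)" "fine \<mu> \<nu> (w A)" using uw[OF A(1)] by blast
      have "x \<in> app (b A) ` elts \<nu>" using n(1) A(2) by (simp add: bij_betw_def)
      then obtain z where z: "z \<epsilon> \<nu>" "x = app (b A) z" by auto
      show "\<Psi> (\<lambda>a. x \<epsilon> a) A"
        unfolding \<Psi>_def
        by (rule most_mono[OF n(2) most_fine[OF n(2,3) z(1)]]) (use z img in blast, (intro df)+)
    qed (intro df D\<Psi>)+
    define B where "B = Sep P (\<lambda>a. x \<epsilon> a)"
    have B: "a \<epsilon> B \<longleftrightarrow> a \<in> Pk \<mu> X \<and> x \<epsilon> a" for a
      unfolding B_def by (subst mem_Sep) (intro df, simp add: P)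
    have "\<Phi> (\<lambda>a. a \<epsilon> B)"
      by (rule \<Phi>_mono[OF \<open>\<Phi> (\<lambda>a. x \<epsilon> a)\<close>]) (use B in blast, (intro df)+)
    then have "B \<epsilon> W" unfolding W using B by blast
    moreover have "elts B = {A \<in> Pk \<mu> X. x \<epsilon> A}" by (simp add: set_eq_iff B)
    ultimately show "\<exists>B\<in>elts W. elts B = {A \<in> Pk \<mu> X. x \<epsilon> A}" by auto
  qed
  moreover have "complete \<mu> W"
    unfolding complete_def
  proof (intro ballI impI)
    fix F assume F: "elts F \<subseteq> elts W \<and> elts F \<noteq> {} \<and> card_less F \<mu>"
    have F': "B \<epsilon> W" if "B \<epsilon> F" for B using F that by auto
    have cF: "card_less F \<mu>" using F by blast
    \<comment> \<open>Completeness enters twice: \<open>F\<close> has fewer than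
      \<open>\<mu>\<close>, hence fewer than \<open>\<kappa>\<close> members, so the quantifier over
      \<open>F\<close> passes first through \<open>U\<close> and then through each
      \<open>w A\<close>.\<close>
    have "most U (\<lambda>A. \<forall>B. B \<epsilon> F \<longrightarrow> \<Psi> (\<lambda>a. a \<epsilon> B) A)"
    proof (rule most_all[OF uU cU \<kappa>])
      show "card_less F \<kappa>" by (rule card_less_mono[OF \<kappa> mu cF])
      show "Df (\<lambda>s. \<Psi> (\<lambda>a. a \<epsilon> s 0) (s 1))" unfolding \<Psi>_def by (intro df)
      show "most U (\<Psi> (\<lambda>a. a \<epsilon> B))" if "B \<epsilon> F" for B using F'[OF that] W \<Phi>_def by blast
    qed
    then have "\<Phi> (\<lambda>a. \<forall>B. B \<epsilon> F \<longrightarrow> a \<epsilon> B)"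
      unfolding \<Phi>_def
    proof (rule most_mono[OF uU])
      fix A assume A: "A \<in> Pk \<kappa> X" "\<forall>B. B \<epsilon> F \<longrightarrow> \<Psi> (\<lambda>a. a \<epsilon> B) A"
      obtain \<nu> where n: "ultrafilter_on (Pk \<mu> \<nu>) (w A)" "complete \<mu> (w A)" using uw[OF A(1)] by blast
      show "\<Psi> (\<lambda>a. \<forall>B. B \<epsilon> F \<longrightarrow> a \<epsilon> B) A"
        unfolding \<Psi>_def
      proof (rule most_all[OF n om cF])
        show "Df (\<lambda>s. img A (s 1) \<epsilon> s 0)" by (intro df)
        show "most (w A) (\<lambda>a. img A a \<epsilon> B)" if "B \<epsilon> F" for B
          using A(2) that unfolding \<Psi>_def by blast
      qed
    next
      show "Df (\<lambda>s. \<forall>B. B \<epsilon> F \<longrightarrow> \<Psi> (\<lambda>a. a \<epsilon> B) (s 0))" unfolding \<Psi>_def by (intro df)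
    qed (intro df D\<Psi>)
    define C where "C = Sep P (\<lambda>a. \<forall>B. B \<epsilon> F \<longrightarrow> a \<epsilon> B)"
    have C: "a \<epsilon> C \<longleftrightarrow> a \<in> Pk \<mu> X \<and> (\<forall>B. B \<epsilon> F \<longrightarrow> a \<epsilon> B)" for a
      unfolding C_def by (subst mem_Sep) (intro df, simp add: P)
    have "\<Phi> (\<lambda>a. a \<epsilon> C)"
      by (rule \<Phi>_mono[OF \<open>\<Phi> (\<lambda>a. \<forall>B. B \<epsilon> F \<longrightarrow> a \<epsilon> B)\<close>]) (use C in blast, (intro df)+)
    then have "C \<epsilon> W" unfolding W using C by blast
    \<comment> \<open>The intersection is contained in \<open>Pk \<mu> X\<close> because
      \<open>F\<close> has a member.\<close>
    moreover obtain B0 where "B0 \<epsilon> F" using F by auto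
    then have "a \<in> Pk \<mu> X" if "\<forall>B. B \<epsilon> F \<longrightarrow> a \<epsilon> B" for a
      using that F' W by blast
    then have "elts C = (\<Inter>A\<in>elts F. elts A)" using C by (auto simp: set_eq_iff)
    ultimately show "\<exists>B\<in>elts W. elts B = (\<Inter>A\<in>elts F. elts A)" by auto
  qed
  ultimately show ?thesis unfolding fine_measure_def by blast
qed

subsection \<open>Normal ultrafilters and homomorphisms of graphs\<close>

lemma most_contra:
  assumes "ultrafilter_on P U" "most U Q" "most U R" "\<And>A. A \<in> P \<Longrightarrow> Q A \<Longrightarrow> R A \<Longrightarrow> False"
    "Df (\<lambda>s. Q (s 0))" "Df (\<lambda>s. R (s 0))"
  shows False
proof -
  have "Df (\<lambda>s. Q (s 0) \<and> R (s 0))" by (intro df assms)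
  from most_ex[OF assms(1) most_conj[OF assms(1-3,5,6)] this] assms(4) show False by blast
qed

lemma most_below:
  assumes "ordinal \<kappa>" "fine_measure \<kappa> X U" "\<And>\<alpha>. \<alpha> \<epsilon> \<kappa> \<Longrightarrow> \<alpha> \<epsilon> X" "\<beta> \<epsilon> \<kappa>"
  shows "most U (\<lambda>A. \<forall>\<delta>. \<delta> \<epsilon> \<beta> \<longrightarrow> \<delta> \<epsilon> A)"
proof -
  have U: "ultrafilter_on (Pk \<kappa> X) U" "fine \<kappa> X U" "complete \<kappa> U"
    using assms(2) by (auto simp: fine_measure_def)
  show ?thesis
  proof (rule most_all[OF U(1,3) assms(1) card_less_ordinal[OF assms(1,4)]])
    show "Df (\<lambda>s. s 0 \<epsilon> s 1)" by (intro df)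
    fix \<delta> assume "\<delta> \<epsilon> \<beta>"
    then have "\<delta> \<epsilon> X" using assms(3) ordinal_trans[OF assms(1,4)] by blast
    then show "most U (\<lambda>A. \<delta> \<epsilon> A)" by (rule most_fine[OF U(1,2)])
  qed
qed

text \<open>If \<open>\<kappa>\<close> were \<open>suc \<beta>\<close>, almost every
  \<open>A\<close> would contain \<open>\<beta>\<close> and all its elements, hence all of
  \<open>\<kappa>\<close>, against |A| < \<kappa>. Closure under successor thus comes from the
  measure, without arithmetic of infinite cardinals.\<close>

lemma fine_measure_imp_limit:
  assumes "cardinal \<kappa>" "fine_measure \<kappa> X U" "\<And>\<alpha>. \<alpha> \<epsilon> \<kappa> \<Longrightarrow> \<alpha> \<epsilon> X" "\<beta> \<epsilon> \<kappa>"
  shows "suc \<beta> \<epsilon> \<kappa>"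
proof -
  have o: "ordinal \<kappa>" using assms(1) by (simp add: cardinal_def)
  have U: "ultrafilter_on (Pk \<kappa> X) U" "fine \<kappa> X U"
    using assms(2) by (auto simp: fine_measure_def)
  have "suc \<beta> \<noteq> \<kappa>"
  proof
    assume s: "suc \<beta> = \<kappa>"
    show False
    proof (rule most_contra[OF U(1) most_below[OF o assms(2,3,4)] most_fine[OF U assms(3)[OF assms(4)]]])
      show "\<alpha> \<epsilon> \<kappa>" if "\<alpha> \<epsilon> \<kappa>" for \<alpha> using that .
      fix A assume A: "A \<in> Pk \<kappa> X" "\<forall>\<delta>. \<delta> \<epsilon> \<beta> \<longrightarrow> \<delta> \<epsilon> A" "\<beta> \<epsilon> A"
      have "card_less \<kappa> \<kappa>"
        by (rule card_less_subset[OF o, of A]) (use A s[symmetric] in \<open>auto simp: Pk_iff\<close>)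
      with not_card_less_self[OF assms(1)] show False by blast
    qed (intro df)+
  qed
  with ordinal_suc_mem[OF o assms(4)] show ?thesis by blast
qed

context
  fixes \<kappa> U
  assumes \<kappa>: "cardinal \<kappa>" and U: "fine_measure \<kappa> (vpow (HV \<kappa>)) U" and normal: "normal U"
begin

lemma ord_\<kappa>: "ordinal \<kappa>"
  using \<kappa> by (simp add: cardinal_def)

lemma ultra_U: "ultrafilter_on (Pk \<kappa> (vpow (HV \<kappa>))) U" and fine_U: "fine \<kappa> (vpow (HV \<kappa>)) U"
  using U by (auto simp: fine_measure_def)

lemma HV_imp_vpow: "x \<epsilon> HV \<kappa> \<Longrightarrow> x \<epsilon> vpow (HV \<kappa>)"
  using HV_trans[OF ord_\<kappa>] by simp

lemma ordinal_imp_HV: "\<alpha> \<epsilon> \<kappa> \<Longrightarrow> \<alpha> \<epsilon> HV \<kappa>"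
  using ordinal_in_HV[OF ord_\<kappa>] by blast

lemma suc_\<kappa>: "\<beta> \<epsilon> \<kappa> \<Longrightarrow> suc \<beta> \<epsilon> \<kappa>"
  using fine_measure_imp_limit[OF \<kappa> U] HV_imp_vpow ordinal_imp_HV by blast

lemma most_subset_\<kappa>: "\<beta> \<epsilon> \<kappa> \<Longrightarrow> most U (\<lambda>A. \<forall>\<delta>. \<delta> \<epsilon> \<beta> \<longrightarrow> \<delta> \<epsilon> A)"
  using most_below[OF ord_\<kappa> U] HV_imp_vpow ordinal_imp_HV by blast

text \<open>Normality can fix only elements of \<open>A\<close>, so small sets must first be known
  to be included in almost every \<open>A\<close>. If the induction failed at
  \<open>\<beta>\<close>, normality would fix a \<open>\<gamma>\<close> below \<open>\<beta>\<close>
  such that almost every \<open>A\<close> omits some subset of \<open>HV \<gamma>\<close>. The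
  omitted sets have a limit \<open>c\<close> along \<open>U\<close>. A point where the omitted set
  differs from \<open>c\<close> lies in \<open>HV \<gamma>\<close>, hence in \<open>A\<close> by
  induction, so normality fixes it, against the definition of \<open>c\<close>.\<close>

lemma most_HV_subset:
  assumes "\<beta> \<epsilon> \<kappa>"
  shows "most U (\<lambda>A. \<forall>x. x \<epsilon> HV \<beta> \<longrightarrow> x \<epsilon> A)"
proof -
  let ?P = "\<lambda>\<beta>. \<beta> \<epsilon> \<kappa> \<longrightarrow> most U (\<lambda>A. \<forall>x. x \<epsilon> HV \<beta> \<longrightarrow> x \<epsilon> A)"
  have "?P \<beta>"
  proof (rule ordinal_induct[of ?P])
    show "Df (\<lambda>s. ?P (s 0))" by (intro df)
    show "ordinal \<beta>" using assms ord_\<kappa> ordinal_elem by blast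
    fix \<beta> assume o: "ordinal \<beta>" and IH: "\<And>\<gamma>. \<gamma> \<epsilon> \<beta> \<Longrightarrow> ?P \<gamma>"
    show "?P \<beta>"
    proof (rule impI, rule ccontr)
      assume b: "\<beta> \<epsilon> \<kappa>" and n: "\<not> most U (\<lambda>A. \<forall>x. x \<epsilon> HV \<beta> \<longrightarrow> x \<epsilon> A)"
      have n': "most U (\<lambda>A. \<not> (\<forall>x. x \<epsilon> HV \<beta> \<longrightarrow> x \<epsilon> A))"
        by (rule most_not[OF ultra_U n]) (intro df)
      have "most U (\<lambda>A. \<exists>\<gamma>. \<gamma> \<epsilon> A \<and> (\<gamma> \<epsilon> \<beta> \<and> (\<exists>x. x \<epsilon> vpow (HV \<gamma>) \<and> \<not> x \<epsilon> A)))"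
      proof (rule most_mp[OF ultra_U most_subset_\<kappa>[OF b] n'])
        fix A assume A: "\<forall>\<delta>. \<delta> \<epsilon> \<beta> \<longrightarrow> \<delta> \<epsilon> A" "\<not> (\<forall>x. x \<epsilon> HV \<beta> \<longrightarrow> x \<epsilon> A)"
        then obtain x where x: "x \<epsilon> HV \<beta>" "\<not> x \<epsilon> A" by blast
        then obtain \<gamma> where "\<gamma> \<epsilon> \<beta>" "\<forall>y. y \<epsilon> x \<longrightarrow> y \<epsilon> HV \<gamma>" using mem_HV[OF o] by blast
        then show "\<exists>\<gamma>. \<gamma> \<epsilon> A \<and> (\<gamma> \<epsilon> \<beta> \<and> (\<exists>x. x \<epsilon> vpow (HV \<gamma>) \<and> \<not> x \<epsilon> A))"
          using A(1) x(2) by (intro exI[of _ \<gamma>]) auto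
      qed (intro df)+
      then have "\<exists>\<gamma>. most U (\<lambda>A. \<gamma> \<epsilon> A \<and> (\<gamma> \<epsilon> \<beta> \<and> (\<exists>x. x \<epsilon> vpow (HV \<gamma>) \<and> \<not> x \<epsilon> A)))"
        by (rule most_normal[OF ultra_U normal, rotated]) (intro df)
      then obtain \<gamma> where g: "most U (\<lambda>A. \<gamma> \<epsilon> A \<and> (\<gamma> \<epsilon> \<beta> \<and> (\<exists>x. x \<epsilon> vpow (HV \<gamma>) \<and> \<not> x \<epsilon> A)))" ..
      have "\<exists>A\<in>Pk \<kappa> (vpow (HV \<kappa>)). \<gamma> \<epsilon> A \<and> (\<gamma> \<epsilon> \<beta> \<and> (\<exists>x. x \<epsilon> vpow (HV \<gamma>) \<and> \<not> x \<epsilon> A))"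
        by (rule most_ex[OF ultra_U g]) (intro df)
      then have gb: "\<gamma> \<epsilon> \<beta>" by blast
      then have gk: "\<gamma> \<epsilon> \<kappa>" using b ordinal_trans[OF ord_\<kappa>] by blast
      define z where "z A = pick (vpow (HV \<gamma>)) (Sep (vpow (HV \<gamma>)) (\<lambda>x. \<not> x \<epsilon> A))" for A
      have Tz [df]: "Tm x \<Longrightarrow> Tm (\<lambda>s. z (x s))" for x
        by (rule Tm_1[where F = z], unfold z_def) (intro df)
      have z: "most U (\<lambda>A. z A \<epsilon> vpow (HV \<gamma>) \<and> \<not> z A \<epsilon> A)"
      proof (rule most_mono[OF ultra_U g])
        fix A assume "\<gamma> \<epsilon> A \<and> (\<gamma> \<epsilon> \<beta> \<and> (\<exists>x. x \<epsilon> vpow (HV \<gamma>) \<and> \<not> x \<epsilon> A))"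
        then obtain x where x: "x \<epsilon> vpow (HV \<gamma>)" "\<not> x \<epsilon> A" by blast
        have "Df (\<lambda>s. \<not> s 0 \<epsilon> A)" by (intro df)
        from pick_SepD[OF z_def[of A] this x] show "z A \<epsilon> vpow (HV \<gamma>) \<and> \<not> z A \<epsilon> A" by blast
      qed (intro df)+
      \<comment> \<open>Fineness puts this limit of the sets \<open>z A\<close> into almost every
        \<open>A\<close>, while \<open>z A\<close> itself is almost never in \<open>A\<close>; so
        the two differ.\<close>
      define c where "c = Sep (HV \<gamma>) (\<lambda>y. most U (\<lambda>A. y \<epsilon> z A))"
      have c: "y \<epsilon> c \<longleftrightarrow> y \<epsilon> HV \<gamma> \<and> most U (\<lambda>A. y \<epsilon> z A)" for y
        unfolding c_def by (rule mem_Sep) (intro df)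
      have "c \<epsilon> vpow (HV \<kappa>)" using c HV_mono[OF ord_\<kappa> gk] by simp
      then have cA: "most U (\<lambda>A. c \<epsilon> A)" by (rule most_fine[OF ultra_U fine_U])
      have ne: "most U (\<lambda>A. z A \<epsilon> vpow (HV \<gamma>) \<and> z A \<noteq> c)"
        by (rule most_mp[OF ultra_U cA z]) (blast, (intro df)+)
      have IHg: "most U (\<lambda>A. \<forall>x. x \<epsilon> HV \<gamma> \<longrightarrow> x \<epsilon> A)" using IH gb gk by blast
      have "most U (\<lambda>A. \<exists>y. y \<epsilon> A \<and> (y \<epsilon> HV \<gamma> \<and> (y \<epsilon> z A \<longleftrightarrow> \<not> y \<epsilon> c)))"
      proof (rule most_mp[OF ultra_U ne IHg])
        fix A assume A: "z A \<epsilon> vpow (HV \<gamma>) \<and> z A \<noteq> c" "\<forall>x. x \<epsilon> HV \<gamma> \<longrightarrow> x \<epsilon> A"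
        then obtain y where y: "y \<epsilon> z A \<longleftrightarrow> \<not> y \<epsilon> c" using ext by blast
        have "y \<epsilon> HV \<gamma>" using y c[of y] A(1) by auto
        with y A(2) show "\<exists>y. y \<epsilon> A \<and> (y \<epsilon> HV \<gamma> \<and> (y \<epsilon> z A \<longleftrightarrow> \<not> y \<epsilon> c))" by blast
      qed (intro df)+
      then have "\<exists>y. most U (\<lambda>A. y \<epsilon> A \<and> (y \<epsilon> HV \<gamma> \<and> (y \<epsilon> z A \<longleftrightarrow> \<not> y \<epsilon> c)))"
        by (rule most_normal[OF ultra_U normal, rotated]) (intro df)
      then obtain y where y: "most U (\<lambda>A. y \<epsilon> A \<and> (y \<epsilon> HV \<gamma> \<and> (y \<epsilon> z A \<longleftrightarrow> \<not> y \<epsilon> c)))" ..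
      show False
      proof (cases "y \<epsilon> c")
        case True
        then have "most U (\<lambda>A. y \<epsilon> z A)" using c by blast
        from ultra_U this y show False by (rule most_contra) (use True in blast, (intro df)+)
      next
        case False
        have "\<exists>A\<in>Pk \<kappa> (vpow (HV \<kappa>)). y \<epsilon> A \<and> (y \<epsilon> HV \<gamma> \<and> (y \<epsilon> z A \<longleftrightarrow> \<not> y \<epsilon> c))"
          by (rule most_ex[OF ultra_U y]) (intro df)
        moreover have "most U (\<lambda>A. y \<epsilon> z A)"
          by (rule most_mono[OF ultra_U y]) (use False in blast, (intro df)+)
        ultimately show False using c False by blast
      qed
    qed
  qed
  with assms show ?thesis by blast
qed

lemma most_subset:
  assumes "x \<epsilon> HV \<kappa>"
  shows "most U (\<lambda>A. \<forall>y. y \<epsilon> x \<longrightarrow> y \<epsilon> A)"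
proof -
  obtain \<beta> where b: "\<beta> \<epsilon> \<kappa>" "\<forall>y. y \<epsilon> x \<longrightarrow> y \<epsilon> HV \<beta>" using assms mem_HV[OF ord_\<kappa>] by blast
  show ?thesis by (rule most_mono[OF ultra_U most_HV_subset[OF b(1)]]) (use b(2) in blast, (intro df)+)
qed

text \<open>Taking the least missing ordinal avoids showing that the ordinals below
  \<open>\<kappa>\<close> in \<open>A\<close> form an initial segment. It exists because fewer than
  \<open>\<kappa>\<close> elements cannot exhaust the cardinal \<open>\<kappa>\<close>.\<close>

definition gap :: "'v \<Rightarrow> 'v" where
  "gap A = the1 (\<lambda>\<beta>. \<beta> \<epsilon> \<kappa> \<and> \<not> \<beta> \<epsilon> A \<and> (\<forall>\<gamma>. \<gamma> \<epsilon> \<beta> \<longrightarrow> \<gamma> \<epsilon> A))"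

lemma Tm_gap: "Tm x \<Longrightarrow> Tm (\<lambda>s. gap (x s))"
  by (rule Tm_1[where F = gap], unfold gap_def) (intro df)
lemmas [df] = Tm_gap

lemma gap:
  assumes A: "A \<in> Pk \<kappa> (vpow (HV \<kappa>))"
  shows "gap A \<epsilon> \<kappa>" "\<not> gap A \<epsilon> A" "\<gamma> \<epsilon> gap A \<Longrightarrow> \<gamma> \<epsilon> A"
proof -
  have "\<exists>\<beta>. \<beta> \<epsilon> \<kappa> \<and> \<not> \<beta> \<epsilon> A"
    using card_less_subset[OF ord_\<kappa>, of A \<kappa>] A not_card_less_self[OF \<kappa>] unfolding Pk_iff by blast
  then obtain \<beta> where b: "\<beta> \<epsilon> \<kappa>" "\<not> \<beta> \<epsilon> A" by blast
  have "\<exists>\<delta>. (\<delta> \<epsilon> \<beta> \<or> \<delta> = \<beta>) \<and> \<not> \<delta> \<epsilon> A \<and> (\<forall>\<gamma>. \<gamma> \<epsilon> \<delta> \<longrightarrow> \<not> \<not> \<gamma> \<epsilon> A)"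
  proof (rule ordinal_least)
    show "Df (\<lambda>s. \<not> s 0 \<epsilon> A)" by (intro df)
    show "ordinal \<beta>" using b ord_\<kappa> ordinal_elem by blast
  qed fact
  then obtain \<delta> where d: "\<delta> \<epsilon> \<kappa>" "\<not> \<delta> \<epsilon> A" "\<And>\<gamma>. \<gamma> \<epsilon> \<delta> \<Longrightarrow> \<gamma> \<epsilon> A"
    using b(1) ordinal_trans[OF ord_\<kappa>] by blast
  have "gap A = \<delta>"
    unfolding gap_def
  proof (rule the1_equality)
    fix x assume x: "x \<epsilon> \<kappa> \<and> \<not> x \<epsilon> A \<and> (\<forall>\<gamma>. \<gamma> \<epsilon> x \<longrightarrow> \<gamma> \<epsilon> A)"
    then have "x \<epsilon> \<delta> \<or> x = \<delta> \<or> \<delta> \<epsilon> x" using ordinal_comparable[OF ord_\<kappa>] d(1) by blast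
    with x d show "x = \<delta>" by blast
  qed (use d in blast)
  with d show "gap A \<epsilon> \<kappa>" "\<not> gap A \<epsilon> A" "\<gamma> \<epsilon> gap A \<Longrightarrow> \<gamma> \<epsilon> A" by simp_all
qed

text \<open>Almost every \<open>A\<close> includes \<open>suc \<beta>\<close>, so nothing up to and
  including \<open>\<beta>\<close> is missing from it.\<close>

lemma most_gap:
  assumes "\<beta> \<epsilon> \<kappa>"
  shows "most U (\<lambda>A. \<beta> \<epsilon> gap A)"
proof (rule most_mono[OF ultra_U most_subset_\<kappa>[OF suc_\<kappa>[OF assms]]])
  fix A assume A: "A \<in> Pk \<kappa> (vpow (HV \<kappa>))" "\<forall>\<delta>. \<delta> \<epsilon> suc \<beta> \<longrightarrow> \<delta> \<epsilon> A"
  have "gap A \<epsilon> \<beta> \<or> gap A = \<beta> \<or> \<beta> \<epsilon> gap A"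
    using ordinal_comparable[OF ord_\<kappa> gap(1)[OF A(1)] assms] .
  then show "\<beta> \<epsilon> gap A" using A(2) gap(2)[OF A(1)] by auto
qed (intro df)+

text \<open>Vertex sets and edge relations are abstracted to a term \<open>N\<close> and a predicate
  \<open>E\<close>, and homomorphisms are read through \<open>app\<close>, which frees the measure
  argument from coding and relativization. The map \<open>H\<close> is delivered as a term and
  becomes a set of the level in \<open>L_hom_existsI\<close>.\<close>

lemma ex_hom_suc:
  fixes N :: "'v \<Rightarrow> 'v" and E :: "'v \<Rightarrow> 'v \<Rightarrow> 'v \<Rightarrow> bool"
  assumes N: "Tm (\<lambda>s. N (s 0))" and E: "Df (\<lambda>s. E (s 0) (s 1) (s 2))"
    and NM: "\<And>\<alpha>. \<alpha> \<epsilon> \<kappa> \<Longrightarrow> N \<alpha> \<epsilon> HV \<kappa>"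
    and hom: "\<And>\<alpha> \<alpha>'. \<alpha> \<epsilon> \<kappa> \<Longrightarrow> \<alpha>' \<epsilon> \<kappa> \<Longrightarrow> \<alpha> = \<alpha>' \<or> \<alpha> \<epsilon> \<alpha>' \<Longrightarrow>
      \<exists>h. h \<epsilon> HV \<kappa> \<and> (\<forall>v. v \<epsilon> N \<alpha>' \<longrightarrow> app h v \<epsilon> N \<alpha>) \<and>
        (\<forall>v w. v \<epsilon> N \<alpha>' \<longrightarrow> w \<epsilon> N \<alpha>' \<longrightarrow> E \<alpha>' v w \<longrightarrow> E \<alpha> (app h v) (app h w))"
  shows "\<exists>\<alpha> H. \<alpha> \<epsilon> \<kappa> \<and> Tm (\<lambda>s. H (s 0)) \<and> (\<forall>v. v \<epsilon> N \<alpha> \<longrightarrow> H v \<epsilon> N (suc \<alpha>)) \<and>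
        (\<forall>v w. v \<epsilon> N \<alpha> \<longrightarrow> w \<epsilon> N \<alpha> \<longrightarrow> E \<alpha> v w \<longrightarrow> E (suc \<alpha>) (H v) (H w))"
proof -
  interpret zfc_level mem "HV \<kappa>" by (rule zfc_level_HV[OF ord_\<kappa> suc_\<kappa>])
  note [df] = Tm_1[where F = N, OF N] Df_3[where P = E, OF E]
  define Hom where "Hom h \<alpha>' \<alpha> \<longleftrightarrow> (\<forall>v. v \<epsilon> N \<alpha>' \<longrightarrow> app h v \<epsilon> N \<alpha>) \<and>
        (\<forall>v w. v \<epsilon> N \<alpha>' \<longrightarrow> w \<epsilon> N \<alpha>' \<longrightarrow> E \<alpha>' v w \<longrightarrow> E \<alpha> (app h v) (app h w))" for h \<alpha>' \<alpha>
  have DHom [df]: "Tm x \<Longrightarrow> Tm y \<Longrightarrow> Tm z \<Longrightarrow> Df (\<lambda>s. Hom (x s) (y s) (z s))" for x y z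
    by (rule Df_3[where P = Hom], unfold Hom_def) (intro df)
  \<comment> \<open>One homomorphism is chosen for each target, independently of the vertex to be
    mapped: an edge is preserved at a coordinate because both its endpoints go through the same
    map.\<close>
  define h where "h A \<beta> = pick (HV \<kappa>) (Sep (HV \<kappa>) (\<lambda>h. Hom h (gap A) \<beta>))" for A \<beta>
  have Th [df]: "Tm x \<Longrightarrow> Tm y \<Longrightarrow> Tm (\<lambda>s. h (x s) (y s))" for x y
    by (rule Tm_2[where F = h], unfold h_def) (intro df)
  \<comment> \<open>Coordinate \<open>\<gamma>\<close> takes values in the graph of index
    \<open>suc \<gamma>\<close>, and this index is at most \<open>gap A\<close> when
    \<open>\<gamma>\<close> is below \<open>gap A\<close>.\<close>
  define p where "p A x \<gamma> = app (h A (suc \<gamma>)) x" for A x \<gamma>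
  have Tp [df]: "Tm x \<Longrightarrow> Tm y \<Longrightarrow> Tm z \<Longrightarrow> Tm (\<lambda>s. p (x s) (y s) (z s))" for x y z
    by (rule Tm_3[where F = p], unfold p_def) (intro df)
  have Hom_h: "Hom (h A (suc \<gamma>)) (gap A) (suc \<gamma>)" if A: "A \<in> Pk \<kappa> (vpow (HV \<kappa>))" and g: "\<gamma> \<epsilon> gap A" for A \<gamma>
  proof -
    note gk = gap(1)[OF A]
    have "suc \<gamma> = gap A \<or> suc \<gamma> \<epsilon> gap A" by (rule ordinal_suc_mem[OF ordinal_elem[OF ord_\<kappa> gk] g])
    moreover have "suc \<gamma> \<epsilon> \<kappa>" by (rule suc_\<kappa>[OF ordinal_trans[OF ord_\<kappa> gk g]])
    ultimately obtain f where f: "f \<epsilon> HV \<kappa>" "Hom f (gap A) (suc \<gamma>)"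
      using hom[OF _ gk, of "suc \<gamma>"] unfolding Hom_def by blast
    show ?thesis by (rule pick_SepD(2)[OF h_def _ f]) (intro df)
  qed
  have pN: "p A x \<gamma> \<epsilon> N (suc \<gamma>)" if "A \<in> Pk \<kappa> (vpow (HV \<kappa>))" "\<gamma> \<epsilon> gap A" "x \<epsilon> N (gap A)" for A x \<gamma>
    using Hom_h[OF that(1,2)] that(3) unfolding Hom_def p_def by blast
  define PG where "PG g \<longleftrightarrow> (\<forall>\<gamma>. \<gamma> \<epsilon> \<kappa> \<longrightarrow> app g \<gamma> \<epsilon> N (suc \<gamma>))" for g
  have DPG [df]: "Tm x \<Longrightarrow> Df (\<lambda>s. PG (x s))" for x
    by (rule Df_1[where P = PG], unfold PG_def) (intro df)
  have edges: "most U (\<lambda>A. \<forall>g e. g \<epsilon> A \<longrightarrow> e \<epsilon> A \<longrightarrow> (\<forall>\<gamma>. \<gamma> \<epsilon> gap A \<longrightarrow> E (suc \<gamma>) (app g \<gamma>) (app e \<gamma>)) \<longrightarrow>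
      E (suc (gap A)) (app g (gap A)) (app e (gap A)))" (is "most U ?Q")
  proof (rule ccontr)
    define Z where "Z A g e \<longleftrightarrow> (\<forall>\<gamma>. \<gamma> \<epsilon> gap A \<longrightarrow> E (suc \<gamma>) (app g \<gamma>) (app e \<gamma>)) \<and>
      \<not> E (suc (gap A)) (app g (gap A)) (app e (gap A))" for A g e
    have DZ [df]: "Tm x \<Longrightarrow> Tm y \<Longrightarrow> Tm z \<Longrightarrow> Df (\<lambda>s. Z (x s) (y s) (z s))" for x y z
      by (rule Df_3[where P = Z], unfold Z_def) (intro df)
    assume n: "\<not> most U ?Q"
    have "most U (\<lambda>A. \<not> ?Q A)" by (rule most_not[OF ultra_U n]) (intro df)
    \<comment> \<open>Both elements of a bad pair lie in \<open>A\<close>, so normality applies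
      twice and fixes first \<open>g\<close>, then \<open>e\<close>.\<close>
    then have "most U (\<lambda>A. \<exists>g. g \<epsilon> A \<and> (\<exists>e. e \<epsilon> A \<and> Z A g e))"
      by (rule most_mono[OF ultra_U]) (unfold Z_def, blast, (intro df)+)
    then have "\<exists>g. most U (\<lambda>A. g \<epsilon> A \<and> (\<exists>e. e \<epsilon> A \<and> Z A g e))"
        by (rule most_normal[OF ultra_U normal, rotated]) (intro df)
      then obtain g where "most U (\<lambda>A. g \<epsilon> A \<and> (\<exists>e. e \<epsilon> A \<and> Z A g e))" ..
    then have "most U (\<lambda>A. \<exists>e. e \<epsilon> A \<and> Z A g e)"
      by (rule most_mono[OF ultra_U]) (blast, (intro df)+)
    then have "\<exists>e. most U (\<lambda>A. e \<epsilon> A \<and> Z A g e)"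
        by (rule most_normal[OF ultra_U normal, rotated]) (intro df)
      then obtain e where e: "most U (\<lambda>A. e \<epsilon> A \<and> Z A g e)" ..
    have De: "Df (\<lambda>s. e \<epsilon> s 0 \<and> Z (s 0) g e)" by (intro df)
    \<comment> \<open>Compare this \<open>A\<close> with almost any \<open>B\<close>:
      \<open>gap A\<close> is below \<open>gap B\<close>, so \<open>Z B g e\<close> gives the edge
      at coordinate \<open>gap A\<close> that \<open>Z A g e\<close> denies.\<close>
    obtain A where A: "A \<in> Pk \<kappa> (vpow (HV \<kappa>))" "Z A g e" using most_ex[OF ultra_U e De] by blast
    show False
    proof (rule most_contra[OF ultra_U e most_gap[OF gap(1)[OF A(1)]]])
      fix B assume "e \<epsilon> B \<and> Z B g e" "gap A \<epsilon> gap B"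
      then show False using A(2) unfolding Z_def by blast
    qed (intro df)+
  qed
  have points: "most U (\<lambda>A. \<forall>x. x \<epsilon> N (gap A) \<longrightarrow>
      (\<exists>g. g \<epsilon> A \<and> PG g \<and> (\<forall>\<gamma>. \<gamma> \<epsilon> gap A \<longrightarrow> app g \<gamma> = p A x \<gamma>)))" (is "most U ?Q")
  proof (rule ccontr)
    assume n: "\<not> most U ?Q"
    define B where "B A x \<longleftrightarrow> \<not> (\<exists>g. g \<epsilon> A \<and> PG g \<and> (\<forall>\<gamma>. \<gamma> \<epsilon> gap A \<longrightarrow> app g \<gamma> = p A x \<gamma>))" for A x
    have DB [df]: "Tm x \<Longrightarrow> Tm y \<Longrightarrow> Df (\<lambda>s. B (x s) (y s))" for x y
      by (rule Df_2[where P = B], unfold B_def) (intro df)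
    \<comment> \<open>A bad vertex is chosen for each bad \<open>A\<close>; the contradiction will
      come from the limit of the sequences \<open>p A (x A)\<close> along \<open>U\<close>.\<close>
    define x where "x A = pick (HV \<kappa>) (Sep (N (gap A)) (B A))" for A
    have Tx [df]: "Tm y \<Longrightarrow> Tm (\<lambda>s. x (y s))" for y
      by (rule Tm_1[where F = x], unfold x_def) (intro df)
    have "most U (\<lambda>A. \<not> ?Q A)" by (rule most_not[OF ultra_U n]) (intro df)
    then have x: "most U (\<lambda>A. x A \<epsilon> N (gap A) \<and> B A (x A))"
    proof (rule most_mono[OF ultra_U])
      fix A assume A: "A \<in> Pk \<kappa> (vpow (HV \<kappa>))" "\<not> ?Q A"
      then obtain y where y: "y \<epsilon> N (gap A)" "B A y" unfolding B_def by blast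
      have D: "Df (\<lambda>s. B A (s 0))" by (intro df)
      show "x A \<epsilon> N (gap A) \<and> B A (x A)"
        unfolding x_def by (rule pick_Sep[OF D y M_trans[OF NM[OF gap(1)[OF A(1)]]]])
    qed (intro df)+
    \<comment> \<open>This is the almost constant value of \<open>p A (x A) \<gamma>\<close>.
      Normality provides it, since the value lies in a vertex set included in almost every
      \<open>A\<close> (\<open>most_subset\<close>); two such values agree on a common
      \<open>A\<close>, so it is unique.\<close>
    define v where "v \<gamma> = the1 (\<lambda>v. most U (\<lambda>A. v \<epsilon> A \<and> (v \<epsilon> N (suc \<gamma>) \<and> v = p A (x A) \<gamma>)))" for \<gamma>
    have Tv [df]: "Tm y \<Longrightarrow> Tm (\<lambda>s. v (y s))" for y
      by (rule Tm_1[where F = v], unfold v_def) (intro df)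
    have v: "most U (\<lambda>A. v \<gamma> \<epsilon> A \<and> (v \<gamma> \<epsilon> N (suc \<gamma>) \<and> v \<gamma> = p A (x A) \<gamma>))" if g: "\<gamma> \<epsilon> \<kappa>" for \<gamma>
    proof -
      let ?R = "\<lambda>v A. v \<epsilon> A \<and> (v \<epsilon> N (suc \<gamma>) \<and> v = p A (x A) \<gamma>)"
      have "most U (\<lambda>A. x A \<epsilon> N (gap A) \<and> \<gamma> \<epsilon> gap A)"
        by (rule most_mp[OF ultra_U x most_gap[OF g]]) (blast, (intro df)+)
      then have "most U (\<lambda>A. \<exists>v. ?R v A)"
      proof (rule most_mp[OF ultra_U _ most_subset[OF NM[OF suc_\<kappa>[OF g]]]])
        fix A assume A: "A \<in> Pk \<kappa> (vpow (HV \<kappa>))" "x A \<epsilon> N (gap A) \<and> \<gamma> \<epsilon> gap A"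
          "\<forall>y. y \<epsilon> N (suc \<gamma>) \<longrightarrow> y \<epsilon> A"
        then have "p A (x A) \<gamma> \<epsilon> N (suc \<gamma>)" using pN by blast
        then show "\<exists>v. ?R v A" using A(3) by blast
      qed (intro df)+
      then have "\<exists>u. most U (?R u)"
        by (rule most_normal[OF ultra_U normal, rotated]) (intro df)
      then obtain u where u: "most U (?R u)" ..
      have "u' = u" if u': "most U (?R u')" for u'
      proof (rule ccontr)
        assume "u' \<noteq> u"
        from ultra_U u u' show False by (rule most_contra) (use \<open>u' \<noteq> u\<close> in blast, (intro df)+)
      qed
      then have "v \<gamma> = u" unfolding v_def by (intro the1_equality u)
      with u show ?thesis by simp
    qed
    have vN: "v \<gamma> \<epsilon> N (suc \<gamma>)" if g: "\<gamma> \<epsilon> \<kappa>" for \<gamma>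
    proof -
      have "Df (\<lambda>s. v \<gamma> \<epsilon> s 0 \<and> (v \<gamma> \<epsilon> N (suc \<gamma>) \<and> v \<gamma> = p (s 0) (x (s 0)) \<gamma>))" by (intro df)
      from most_ex[OF ultra_U v[OF g] this] show ?thesis by blast
    qed
    have Tv': "Tm (\<lambda>s. v (s 0))" by (intro df)
    \<comment> \<open>The limit sequence is a subset of \<open>HV \<kappa>\<close>, so fineness puts
      it into almost every \<open>A\<close>; the measure lives over
      \<open>vpow (HV \<kappa>)\<close> to make this possible.\<close>
    define g where "g = vlam \<kappa> v"
    have g: "app g \<gamma> = v \<gamma>" if "\<gamma> \<epsilon> \<kappa>" for \<gamma>
      unfolding g_def by (rule app_vlam[OF Tv' that])
    have PG: "PG g" unfolding PG_def using g vN by simp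
    have "q \<epsilon> HV \<kappa>" if q: "q \<epsilon> g" for q
    proof -
      obtain \<gamma> where "\<gamma> \<epsilon> \<kappa>" "q = pr \<gamma> (v \<gamma>)" using q unfolding g_def mem_vlam[OF Tv'] by blast
      then show ?thesis using pr_in_M ordinal_imp_HV M_trans[OF NM[OF suc_\<kappa>] vN] by blast
    qed
    then have "g \<epsilon> vpow (HV \<kappa>)" by simp
    then have gA: "most U (\<lambda>A. g \<epsilon> A)" by (rule most_fine[OF ultra_U fine_U])
    \<comment> \<open>As \<open>x A\<close> is bad, \<open>g\<close> disagrees with its sequence at
      some coordinate below \<open>gap A\<close>. This coordinate is in \<open>A\<close>, so
      normality fixes it, and there \<open>v\<close> gives agreement almost everywhere.\<close>
    have "most U (\<lambda>A. \<exists>\<gamma>. \<gamma> \<epsilon> A \<and> (\<gamma> \<epsilon> gap A \<and> app g \<gamma> \<noteq> p A (x A) \<gamma>))"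
    proof (rule most_mp[OF ultra_U gA x])
      fix A assume A: "A \<in> Pk \<kappa> (vpow (HV \<kappa>))" "g \<epsilon> A" "x A \<epsilon> N (gap A) \<and> B A (x A)"
      then obtain \<gamma> where "\<gamma> \<epsilon> gap A" "app g \<gamma> \<noteq> p A (x A) \<gamma>" using PG unfolding B_def by blast
      then show "\<exists>\<gamma>. \<gamma> \<epsilon> A \<and> (\<gamma> \<epsilon> gap A \<and> app g \<gamma> \<noteq> p A (x A) \<gamma>)" using gap(3)[OF A(1)] by blast
    qed (intro df)+
    then have "\<exists>\<gamma>. most U (\<lambda>A. \<gamma> \<epsilon> A \<and> (\<gamma> \<epsilon> gap A \<and> app g \<gamma> \<noteq> p A (x A) \<gamma>))"
        by (rule most_normal[OF ultra_U normal, rotated]) (intro df)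
      then obtain \<gamma> where \<gamma>: "most U (\<lambda>A. \<gamma> \<epsilon> A \<and> (\<gamma> \<epsilon> gap A \<and> app g \<gamma> \<noteq> p A (x A) \<gamma>))" ..
    have "Df (\<lambda>s. \<gamma> \<epsilon> s 0 \<and> (\<gamma> \<epsilon> gap (s 0) \<and> app g \<gamma> \<noteq> p (s 0) (x (s 0)) \<gamma>))" by (intro df)
    from most_ex[OF ultra_U \<gamma> this] have "\<gamma> \<epsilon> \<kappa>" using gap(1) ordinal_trans[OF ord_\<kappa>] by blast
    show False
      by (rule most_contra[OF ultra_U \<gamma> v[OF \<open>\<gamma> \<epsilon> \<kappa>\<close>]]) (use g[OF \<open>\<gamma> \<epsilon> \<kappa>\<close>] in simp, (intro df)+)
  qed
  have "\<exists>A\<in>Pk \<kappa> (vpow (HV \<kappa>)). (\<forall>g e. g \<epsilon> A \<longrightarrow> e \<epsilon> A \<longrightarrow>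
      (\<forall>\<gamma>. \<gamma> \<epsilon> gap A \<longrightarrow> E (suc \<gamma>) (app g \<gamma>) (app e \<gamma>)) \<longrightarrow>
      E (suc (gap A)) (app g (gap A)) (app e (gap A))) \<and> (\<forall>x. x \<epsilon> N (gap A) \<longrightarrow>
      (\<exists>g. g \<epsilon> A \<and> PG g \<and> (\<forall>\<gamma>. \<gamma> \<epsilon> gap A \<longrightarrow> app g \<gamma> = p A x \<gamma>)))"
    by (rule most_ex[OF ultra_U most_conj[OF ultra_U edges points]]) (intro df)+
  then obtain A where A: "A \<in> Pk \<kappa> (vpow (HV \<kappa>))"
    and edge: "\<And>g e. g \<epsilon> A \<Longrightarrow> e \<epsilon> A \<Longrightarrow> (\<And>\<gamma>. \<gamma> \<epsilon> gap A \<Longrightarrow> E (suc \<gamma>) (app g \<gamma>) (app e \<gamma>)) \<Longrightarrow>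
      E (suc (gap A)) (app g (gap A)) (app e (gap A))"
    and point: "\<And>x. x \<epsilon> N (gap A) \<Longrightarrow> \<exists>g. g \<epsilon> A \<and> PG g \<and> (\<forall>\<gamma>. \<gamma> \<epsilon> gap A \<longrightarrow> app g \<gamma> = p A x \<gamma>)"
    by blast
  \<comment> \<open>Any extension in \<open>A\<close> will do, since \<open>edge\<close> compares
    arbitrary elements of \<open>A\<close>; picking one makes the map definable.\<close>
  define G where "G x = pick A (Sep A (\<lambda>g. PG g \<and> (\<forall>\<gamma>. \<gamma> \<epsilon> gap A \<longrightarrow> app g \<gamma> = p A x \<gamma>)))" for x
  have G: "G x \<epsilon> A \<and> PG (G x) \<and> (\<forall>\<gamma>. \<gamma> \<epsilon> gap A \<longrightarrow> app (G x) \<gamma> = p A x \<gamma>)" if x: "x \<epsilon> N (gap A)" for x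
  proof -
    obtain g where g: "g \<epsilon> A" "PG g \<and> (\<forall>\<gamma>. \<gamma> \<epsilon> gap A \<longrightarrow> app g \<gamma> = p A x \<gamma>)" using point[OF x] by blast
    have "Df (\<lambda>s. PG (s 0) \<and> (\<forall>\<gamma>. \<gamma> \<epsilon> gap A \<longrightarrow> app (s 0) \<gamma> = p A x \<gamma>))" by (intro df)
    from pick_SepD[OF G_def[of x] this g] show ?thesis by blast
  qed
  have "Tm (\<lambda>s. app (G (s 0)) (gap A))" unfolding G_def by (intro df)
  moreover have "app (G x) (gap A) \<epsilon> N (suc (gap A))" if "x \<epsilon> N (gap A)" for x
    using G[OF that] gap(1)[OF A] unfolding PG_def by blast
  moreover have "E (suc (gap A)) (app (G x) (gap A)) (app (G y) (gap A))"
    if x: "x \<epsilon> N (gap A)" and y: "y \<epsilon> N (gap A)" and xy: "E (gap A) x y" for x y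
  proof (rule edge)
    show "G x \<epsilon> A" "G y \<epsilon> A" using G x y by blast+
    fix \<gamma> assume g: "\<gamma> \<epsilon> gap A"
    have "E (suc \<gamma>) (p A x \<gamma>) (p A y \<gamma>)"
      using Hom_h[OF A g] x y xy unfolding Hom_def p_def by blast
    then show "E (suc \<gamma>) (app (G x) \<gamma>) (app (G y) \<gamma>)" using G[OF x] G[OF y] g by simp
  qed
  ultimately show ?thesis using gap(1)[OF A]
    by (intro exI[of _ "gap A"] exI[of _ "\<lambda>x. app (G x) (gap A)"]) simp
qed

end

section \<open>Graphs and their homomorphisms inside a level\<close>

definition nodes :: "'v \<Rightarrow> 'v" where
  "nodes g = the1 (\<lambda>G. \<exists>E. opair g G E)"

definition edge :: "'v \<Rightarrow> 'v \<Rightarrow> 'v \<Rightarrow> bool" where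
  "edge g v w \<longleftrightarrow> (\<exists>G E. opair g G E \<and> related E v w)"

lemma Tm_nodes [df]: "Tm g \<Longrightarrow> Tm (\<lambda>s. nodes (g s))"
  by (rule Tm_1[where F = nodes], unfold nodes_def) (intro df)

lemma Df_edge [df]: "Tm g \<Longrightarrow> Tm v \<Longrightarrow> Tm w \<Longrightarrow> Df (\<lambda>s. edge (g s) (v s) (w s))"
  by (rule Df_3[where P = edge], unfold edge_def) (intro df)

lemma nodes_pr [simp]: "nodes (pr G E) = G"
  unfolding nodes_def by (rule the1_equality) (auto simp: opair_iff)

lemma edge_pr [simp]: "edge (pr G E) v w \<longleftrightarrow> related E v w"
  by (auto simp: edge_def opair_iff)

lemma successor_eq: "successor \<alpha> = suc \<alpha>"
  unfolding successor_def
proof (rule the_equality)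
  show "suc \<alpha> \<in> UNIV \<and> elts (suc \<alpha>) = insert \<alpha> (elts \<alpha>)" by auto
  show "\<beta> = suc \<alpha>" if "\<beta> \<in> UNIV \<and> elts \<beta> = insert \<alpha> (elts \<alpha>)" for \<beta>
    using that by (intro ext) (auto simp: set_eq_iff)
qed

end

context zfc_level
begin

lemma L_is_graph: "g \<epsilon> M \<Longrightarrow> L.is_graph g G E \<longleftrightarrow> is_graph g G E"
proof -
  assume g: "g \<epsilon> M"
  show ?thesis
  proof (cases "opair g G E")
    case True
    then have "G \<epsilon> M" "E \<epsilon> M" using g by (simp_all add: opair_iff pr_in_M)
    then show ?thesis
      using g L_opair[OF M_trans[OF \<open>E \<epsilon> M\<close>]] unfolding L.is_graph_def is_graph_def
      by (simp add: L_opair)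
  qed (use g in \<open>simp add: L.is_graph_def is_graph_def L_opair\<close>)
qed

lemma L_graphE:
  assumes "g \<epsilon> M" "L.graph g"
  obtains G E where "g = pr G E" "G \<epsilon> M" "E \<epsilon> M" "is_graph g G E"
proof -
  obtain G E where *: "G \<epsilon> M" "E \<epsilon> M" "L.is_graph g G E" using assms(2) unfolding L.graph_def by auto
  then have i: "is_graph g G E" using L_is_graph[OF assms(1)] by simp
  then have "g = pr G E" by (simp add: is_graph_def opair_iff)
  then show ?thesis using that * i by blast
qed

text \<open>This brings a homomorphism of the level into the form that \<open>ex_hom_suc\<close>
  asks for.\<close>

lemma L_homomorphismD:
  assumes "h \<epsilon> M" "g \<epsilon> M" "g' \<epsilon> M" "L.homomorphism h g g'"
  shows "v \<epsilon> nodes g \<Longrightarrow> app h v \<epsilon> nodes g'"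
    and "v \<epsilon> nodes g \<Longrightarrow> w \<epsilon> nodes g \<Longrightarrow> edge g v w \<Longrightarrow> edge g' (app h v) (app h w)"
proof -
  obtain G E G' E' where M: "G \<epsilon> M" "E \<epsilon> M" "G' \<epsilon> M" "E' \<epsilon> M"
    and i: "L.is_graph g G E" "L.is_graph g' G' E'" and f: "L.function_from_to h G G'"
    and e: "\<forall>v\<in>L.elts G. \<forall>w\<in>L.elts G. \<forall>v'\<in>L.elts G'. \<forall>w'\<in>L.elts G'.
           L.related E v w \<and> L.related h v v' \<and> L.related h w w' \<longrightarrow> L.related E' v' w'"
    using assms(4) unfolding L.homomorphism_def by auto
  have g: "g = pr G E" "g' = pr G' E'"
    using i L_is_graph assms(2,3) by (simp_all add: is_graph_def opair_iff)
  have f': "function_from_to h G G'" using f M assms(1) by simp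
  then have fn: "function_on h (elts G)" by (simp add: function_from_to_def)
  have r: "related h v (app h v)" if "v \<epsilon> G" for v
    using function_on_unique[OF fn] that by simp
  have a: "app h v \<epsilon> G'" if "v \<epsilon> G" for v
    using f' r[OF that] that unfolding function_from_to_def by simp
  then show "v \<epsilon> nodes g \<Longrightarrow> app h v \<epsilon> nodes g'" by (simp add: g)
  assume "v \<epsilon> nodes g" "w \<epsilon> nodes g" "edge g v w"
  then show "edge g' (app h v) (app h w)"
    using e M assms(1) a r by (simp add: g)
qed

text \<open>A definable map on a set is a set by replacement, and it belongs to the level as a
  subset of the product of the two vertex sets.\<close>

lemma L_hom_existsI:
  assumes "g \<epsilon> M" "g' \<epsilon> M" "L.graph g" "L.graph g'" and H: "Tm (\<lambda>s. H (s 0))"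
    and N: "\<And>v. v \<epsilon> nodes g \<Longrightarrow> H v \<epsilon> nodes g'"
    and E: "\<And>v w. v \<epsilon> nodes g \<Longrightarrow> w \<epsilon> nodes g \<Longrightarrow> edge g v w \<Longrightarrow> edge g' (H v) (H w)"
  shows "L.hom_exists g g'"
proof -
  obtain G E where g: "g = pr G E" "G \<epsilon> M" "E \<epsilon> M" "is_graph g G E" by (rule L_graphE[OF assms(1,3)])
  obtain G' E' where g': "g' = pr G' E'" "G' \<epsilon> M" "E' \<epsilon> M" "is_graph g' G' E'"
    by (rule L_graphE[OF assms(2,4)])
  define h where "h = vlam G H"
  have fn: "function_on h (elts G)" unfolding h_def by (rule function_on_vlam[OF H])
  have r: "related h v v' \<longleftrightarrow> v \<epsilon> G \<and> v' = H v" for v v'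
    using function_on_unique[OF fn, of v v'] unfolding h_def by (auto simp: app_vlam[OF H])
  have HG: "H v \<epsilon> G'" if "v \<epsilon> G" for v using N[of v] that by (simp add: g(1) g'(1))
  have "h \<epsilon> M"
  proof (rule M_subset[OF M_cart[OF g(2) g'(2)]])
    fix p assume "p \<epsilon> h"
    then obtain v where "v \<epsilon> G" "p = pr v (H v)" unfolding h_def mem_vlam[OF H] by blast
    then show "p \<epsilon> cart G G'" using HG by auto
  qed
  moreover have "function_from_to h G G'"
    using fn HG by (simp add: function_from_to_def r)
  ultimately have "L.homomorphism h g g'"
    unfolding L.homomorphism_def
    using g g' E assms(1,2)
    by (intro bexI[of _ G] bexI[of _ E] bexI[of _ G'] bexI[of _ E']) (simp_all add: L_is_graph r)
  with \<open>h \<epsilon> M\<close> show ?thesis unfolding L.hom_exists_def by auto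
qed

end

section \<open>The two statements in the level of \<open>\<kappa>\<close>\<close>

context zfc_model
begin

text \<open>A counterexample \<open>F\<close> is a class of the level but a set of the universe, so
  it can serve as a parameter defining its vertex sets and edges. The contradiction arises between
  two consecutive indices given by \<open>ex_hom_suc\<close>.\<close>

lemma SWVP_HV:
  assumes \<kappa>: "cardinal \<kappa>" and U: "fine_measure \<kappa> (vpow (HV \<kappa>)) U" "normal U"
  shows "set_structure.SWVP (elts (HV \<kappa>)) mem (elts (vpow (HV \<kappa>)))"
proof -
  note o = ord_\<kappa>[OF \<kappa> U] and suc = suc_\<kappa>[OF \<kappa> U]
  interpret zfc_level mem "HV \<kappa>" by (rule zfc_level_HV[OF o suc])
  have OrdL: "L.Ord = elts \<kappa>"
  proof -
    have "\<alpha> \<in> L.Ord \<longleftrightarrow> \<alpha> \<epsilon> \<kappa>" for \<alpha>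
      unfolding L.Ord_def using ordinal_in_HV[OF o, of \<alpha>] by auto
    then show ?thesis by auto
  qed
  show ?thesis
    unfolding L.SWVP_def OrdL
  proof (rule notI, elim bexE conjE)
    fix F assume "F \<in> elts (vpow (HV \<kappa>))" and fL: "L.function_on F (elts \<kappa>)"
      and gr: "\<forall>\<alpha>\<in>elts \<kappa>. \<forall>g\<in>elts (HV \<kappa>). L.related F \<alpha> g \<longrightarrow> L.graph g"
      and hom: "\<forall>\<alpha>\<in>elts \<kappa>. \<forall>\<alpha>'\<in>elts \<kappa>. \<forall>g\<in>elts (HV \<kappa>). \<forall>g'\<in>elts (HV \<kappa>).
        L.related F \<alpha> g \<and> L.related F \<alpha>' g' \<longrightarrow>
             (\<alpha> = \<alpha>' \<or> \<alpha> \<epsilon> \<alpha>' \<longrightarrow> L.hom_exists g' g) \<and>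
             (\<alpha> \<epsilon> \<alpha>' \<longrightarrow> \<not> L.hom_exists g g')"
    then have FM: "\<And>p. p \<epsilon> F \<Longrightarrow> p \<epsilon> HV \<kappa>" by simp
    have f: "function_on F (elts \<kappa>)" using fL L_function_on[OF FM] by blast
    have rel: "L.related F \<alpha> (app F \<alpha>)" and aM: "app F \<alpha> \<epsilon> HV \<kappa>" if a: "\<alpha> \<epsilon> \<kappa>" for \<alpha>
    proof -
      have r: "related F \<alpha> (app F \<alpha>)" using function_on_unique[OF f] a by simp
      then show "L.related F \<alpha> (app F \<alpha>)" using L_related[OF FM] by blast
      show "app F \<alpha> \<epsilon> HV \<kappa>" using r FM pr_in_M unfolding related_iff by blast
    qed
    have graph: "L.graph (app F \<alpha>)" if "\<alpha> \<epsilon> \<kappa>" for \<alpha>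
      using gr rel[OF that] aM[OF that] that by simp
    have hom': "(\<alpha> = \<alpha>' \<or> \<alpha> \<epsilon> \<alpha>' \<longrightarrow> L.hom_exists (app F \<alpha>') (app F \<alpha>)) \<and>
        (\<alpha> \<epsilon> \<alpha>' \<longrightarrow> \<not> L.hom_exists (app F \<alpha>) (app F \<alpha>'))" if "\<alpha> \<epsilon> \<kappa>" "\<alpha>' \<epsilon> \<kappa>" for \<alpha> \<alpha>'
      using bspec[OF bspec[OF bspec[OF bspec[OF hom, of \<alpha>], of \<alpha>'], of "app F \<alpha>"], of "app F \<alpha>'"]
        rel aM that by simp
    have hom1: "L.hom_exists (app F \<alpha>') (app F \<alpha>)"
      if "\<alpha> \<epsilon> \<kappa>" "\<alpha>' \<epsilon> \<kappa>" "\<alpha> = \<alpha>' \<or> \<alpha> \<epsilon> \<alpha>'" for \<alpha> \<alpha>'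
      using hom' that by blast
    have hom2: "\<not> L.hom_exists (app F \<alpha>) (app F \<alpha>')"
      if "\<alpha> \<epsilon> \<kappa>" "\<alpha>' \<epsilon> \<kappa>" "\<alpha> \<epsilon> \<alpha>'" for \<alpha> \<alpha>'
      using hom' that by blast
    have "\<exists>\<alpha> H. \<alpha> \<epsilon> \<kappa> \<and> Tm (\<lambda>s. H (s 0)) \<and>
        (\<forall>v. v \<epsilon> nodes (app F \<alpha>) \<longrightarrow> H v \<epsilon> nodes (app F (suc \<alpha>))) \<and>
        (\<forall>v w. v \<epsilon> nodes (app F \<alpha>) \<longrightarrow> w \<epsilon> nodes (app F \<alpha>) \<longrightarrow> edge (app F \<alpha>) v w \<longrightarrow>
          edge (app F (suc \<alpha>)) (H v) (H w))"
    proof (rule ex_hom_suc[OF \<kappa> U])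
      show "Tm (\<lambda>s. nodes (app F (s 0)))" by (intro df)
      show "Df (\<lambda>s. edge (app F (s 0)) (s 1) (s 2))" by (intro df)
      show "nodes (app F \<alpha>) \<epsilon> HV \<kappa>" if a: "\<alpha> \<epsilon> \<kappa>" for \<alpha>
      proof -
        obtain G E where "app F \<alpha> = pr G E" "G \<epsilon> HV \<kappa>"
          using L_graphE[OF aM[OF a] graph[OF a]] by blast
        then show ?thesis by simp
      qed
      fix \<alpha> \<alpha>' assume a: "\<alpha> \<epsilon> \<kappa>" "\<alpha>' \<epsilon> \<kappa>" "\<alpha> = \<alpha>' \<or> \<alpha> \<epsilon> \<alpha>'"
      obtain h where h: "h \<epsilon> HV \<kappa>" "L.homomorphism h (app F \<alpha>') (app F \<alpha>)"
        using hom1[OF a] unfolding L.hom_exists_def by auto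
      note D = L_homomorphismD[OF h(1) aM[OF a(2)] aM[OF a(1)] h(2)]
      show "\<exists>h. h \<epsilon> HV \<kappa> \<and> (\<forall>v. v \<epsilon> nodes (app F \<alpha>') \<longrightarrow> app h v \<epsilon> nodes (app F \<alpha>)) \<and>
        (\<forall>v w. v \<epsilon> nodes (app F \<alpha>') \<longrightarrow> w \<epsilon> nodes (app F \<alpha>') \<longrightarrow> edge (app F \<alpha>') v w \<longrightarrow>
          edge (app F \<alpha>) (app h v) (app h w))"
        using D h(1) by blast
    qed
    then obtain \<alpha> H where H: "\<alpha> \<epsilon> \<kappa>" "Tm (\<lambda>s. H (s 0))"
        "\<And>v. v \<epsilon> nodes (app F \<alpha>) \<Longrightarrow> H v \<epsilon> nodes (app F (suc \<alpha>))"
        "\<And>v w. v \<epsilon> nodes (app F \<alpha>) \<Longrightarrow> w \<epsilon> nodes (app F \<alpha>) \<Longrightarrow> edge (app F \<alpha>) v w \<Longrightarrow>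
          edge (app F (suc \<alpha>)) (H v) (H w)"
      by blast
    note s = suc[OF H(1)]
    have "L.hom_exists (app F \<alpha>) (app F (suc \<alpha>))"
      by (rule L_hom_existsI[OF aM[OF H(1)] aM[OF s] graph[OF H(1)] graph[OF s] H(2-4)])
    then show False using hom2[OF H(1) s] by simp
  qed
qed

text \<open>The bounding set in \<open>ex_fine_measure_limit\<close> is the level itself: strong
  compactness there gives, for each ordinal below \<open>\<kappa>\<close>, a measure in the level,
  which by absoluteness is one in the universe.\<close>

lemma no_strongly_compact_HV:
  assumes \<kappa>: "cardinal \<kappa>" and U: "\<And>X. \<exists>U. fine_measure \<kappa> X U"
    and first: "\<And>\<mu>. mem \<mu> \<kappa> \<Longrightarrow> \<not> strongly_compact \<mu>"
  shows "set_structure.no_strongly_compact_cardinal (elts (HV \<kappa>)) mem"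
proof -
  have o: "ordinal \<kappa>" using \<kappa> by (simp add: cardinal_def)
  \<comment> \<open>The fine measure for the set \<open>\<kappa>\<close> itself gives closure under
    successor.\<close>
  have suc: "suc \<beta> \<epsilon> \<kappa>" if "\<beta> \<epsilon> \<kappa>" for \<beta>
    using fine_measure_imp_limit[OF \<kappa> _ _ that] U[of \<kappa>] by blast
  interpret zfc_level mem "HV \<kappa>" by (rule zfc_level_HV[OF o suc])
  show ?thesis
    unfolding L.no_strongly_compact_cardinal_def
  proof (rule notI, elim bexE)
    fix \<mu> assume "\<mu> \<in> elts (HV \<kappa>)" and sc: "L.strongly_compact \<mu>"
    then have m: "\<mu> \<epsilon> HV \<kappa>" by simp
    have um: "uncountable_cardinal \<mu>"
      using sc m unfolding L.strongly_compact_def by simp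
    then have "ordinal \<mu>" by (simp add: uncountable_cardinal_def cardinal_def)
    then have mk: "\<mu> \<epsilon> \<kappa>" using ordinal_in_HV[OF o, of \<mu>] m by blast
    have W: "\<exists>W. W \<epsilon> HV \<kappa> \<and> fine_measure \<mu> \<nu> W" if "\<nu> \<epsilon> \<kappa>" for \<nu>
    proof -
      have n: "\<nu> \<epsilon> HV \<kappa>" using ordinal_in_HV[OF o, of \<nu>] that by blast
      then have "L.X_compact \<nu> \<mu>" using sc unfolding L.strongly_compact_def by simp
      then obtain W where W: "W \<epsilon> HV \<kappa>" "L.ultrafilter_on (Pk \<mu> \<nu>) W" "L.fine \<mu> \<nu> W" "L.complete \<mu> W"
        unfolding L.X_compact_def L_Pk[OF m n] by auto
      then show ?thesis
        using L_ultrafilter_on[OF W(1,2)] L_fine[OF W(1) m n W(3)] L_complete[OF W(1) m W(4)]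
        unfolding fine_measure_def by blast
    qed
    have "X_compact X \<mu>" for X
    proof -
      obtain V where V: "fine_measure \<kappa> X V" using U by blast
      show ?thesis using ex_fine_measure_limit[OF o mk V W] um
        unfolding X_compact_def fine_measure_def by blast
    qed
    then have "strongly_compact \<mu>" using um unfolding strongly_compact_def by blast
    with first[OF mk] show False ..
  qed
qed

end

theorem theorem1p3:
  fixes mem :: "'v \<Rightarrow> 'v \<Rightarrow> bool" and \<kappa> :: 'v
  assumes "zfc_model mem"
    and "set_structure.first_supercompact UNIV mem \<kappa>"
    and "set_structure.first_strongly_compact UNIV mem \<kappa>"
  shows "V_succ_satisfies_SWVP mem \<kappa> \<and> V_succ_satisfies_no_strongly_compact mem \<kappa>"
proof -
  interpret zfc_model mem by (rule assms(1))
  have sup: "supercompact \<kappa>" and str: "strongly_compact \<kappa>"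
    and first: "\<And>\<mu>. mem \<mu> \<kappa> \<Longrightarrow> \<not> strongly_compact \<mu>"
    using assms(2,3) by (simp_all add: first_supercompact_def first_strongly_compact_def)
  have \<kappa>: "cardinal \<kappa>"
    using sup by (simp add: supercompact_def uncountable_cardinal_def)
  then have o: "ordinal \<kappa>" by (simp add: cardinal_def)
  have level: "V_level mem \<kappa> = elts (HV \<kappa>)" "V_level mem (successor \<kappa>) = elts (vpow (HV \<kappa>))"
    by (simp_all only: V_level_def V_eq[OF o] successor_eq V_eq[OF ordinal_suc[OF o]] HV_suc[OF o])
  \<comment> \<open>Supercompactness enters SWVP through this one set, whose elements include every
    function from \<open>\<kappa>\<close> into the level.\<close>
  have "X_supercompact (vpow (HV \<kappa>)) \<kappa>" using sup unfolding supercompact_def by blast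
  then obtain U where U: "fine_measure \<kappa> (vpow (HV \<kappa>)) U" "normal U"
    unfolding X_supercompact_def fine_measure_def by blast
  \<comment> \<open>Every \<open>X\<close> of the universe is required, since the limit of measures
    has to show strong compactness in the universe.\<close>
  have "\<exists>U. fine_measure \<kappa> X U" for X
    using str unfolding strongly_compact_def X_compact_def fine_measure_def by blast
  then show ?thesis
    unfolding V_succ_satisfies_SWVP_def V_succ_satisfies_no_strongly_compact_def level
    using SWVP_HV[OF \<kappa> U] no_strongly_compact_HV[OF \<kappa> _ first] by blast
qed

end
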